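(* Let $A$ be a (not necessarily unital) cyclic $A_\infty$-algebra over $\mathbb{K}$ whose inner product is odd, and let $N\ge 1$ be an integer. The map $$\widehat{\sigma}_\hbar\circ\widehat{\mathcal M}_\hbar:\ \mathrm{P}^{\wedge\mathrm{nc}}_\hbar[\Sigma A]\longrightarrow \widehat{\mathrm P}_\hbar[\Sigma\mathfrak{gl}_N(A)]^{\mathfrak{gl}_N(\mathbb K)}$$ intertwines the Lie brackets, intertwines the differentials $\hbar(\delta+\nabla)$ and $\hbar\Delta$, and also intertwines the differentials $\{\tilde m_A,-\}$ and $\{\tilde l_{\mathfrak{gl}_N(A)},-\}$. Moreover, modulo $\hbar$ and $\nu$ (that is, after setting $\hbar=0$ and restricting to $\bigoplus_{i\ge1}[\widehat{\mathrm H}_+[\Sigma A]^{\widehat\otimes i}]_{\mathbb S_i}$) this map is the Loday-Quillen-Tsygan map.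
   Context: $\mathbb K$ is a field of characteristic zero; all vector spaces are $\mathbb Z/2$-graded and the Koszul sign rule is used. $\Sigma$ is the parity shift, $\mathbb S_k$ the symmetric group; a subscript group denotes coinvariants, a superscript invariants. $\widehat T,\widehat S$ are completed tensor and symmetric algebras (direct products of tensor powers, resp. of $\mathbb S_n$-coinvariants of tensor powers); $\widehat T_+,\widehat S_+$ are their parts of tensor degree $\ge1$. Commutative side. Let $V$ be finite-dimensional with an odd symplectic (nondegenerate skew) form $\langle-,-\rangle$. The inverse form on $V^*$ is defined by $\langle-,-\rangle^{-1}\circ(D_l\otimes D_r)=\langle-,-\rangle$, $D_l(y)=\langle y,-\rangle$, $D_r(y)=\langle -,y\rangle$; it is symmetric. It extends by the Leibniz rule to an odd Poisson bracket $\{-,-\}$ on $\widehat S V^*$. $\Delta$ is the unique operator on $\widehat SV^*$ vanishing on constants and linear terms with $\Delta(ab)=(\Delta a)b+(-1)^a a(\Delta b)+\{a,b\}$. $\widehat{\mathrm P}_\hbar[V]:=\mathbb K[[\hbar]]\widehat\otimes\widehat SV^*$ ($\hbar$ even) is the dg Lie algebra with $\hbar$-linear odd bracket $\{-,-\}$ and differential $\hbar\Delta$. Noncommutative side. $\widehat{\mathrm H}[V]:=\prod_{k\ge0}[(V^* )^{\widehat\otimes k}]_{\mathbb Z/k}$ (completed cyclic words), with $\nu$ the generator of the $k=0$ term and $\widehat{\mathrm H}_+[V]$ the product over $k\ge1$. It has the odd Lie bracket $$\{(a_1\cdots a_m),(b_1\cdots b_n)\}=\sum_{i,j}\pm\langle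 a_i,b_j\rangle^{-1}(a_{i+1}\cdots a_ma_1\cdots a_{i-1}b_{j+1}\cdots b_nb_1\cdots b_{j-1})$$ and odd cobracket $$\nabla(a_1\cdots a_n)=\sum_{i<j}\pm\langle a_i,a_j\rangle^{-1}(a_{i+1}\cdots a_{j-1})\otimes(a_{j+1}\cdots a_na_1\cdots a_{i-1}),$$ with Koszul signs; the empty word is $\nu$. $\mathrm P^{\wedge\mathrm{nc}}_\hbar[V]:=\mathbb K[\hbar]\otimes\bigoplus_{i\ge0}[\widehat{\mathrm H}[V]^{\widehat\otimes i}]_{\mathbb S_i}$ is the dg Lie algebra whose odd bracket is the Leibniz (Poisson) extension of the bracket of $\widehat{\mathrm H}[V]$, and whose differential is $\hbar(\delta+\nabla)$; here $\delta(a_1\cdots a_n)=\sum_{i<j}\pm\{a_i,a_j\}a_1\cdots\widehat{a_i}\cdots\widehat{a_j}\cdots a_n$ (Chevalley-Eilenberg differential) on a symmetric product of $a_i\in\widehat{\mathrm H}[V]$, and $\nabla$ is extended as a derivation. Maps. $V\otimes\mathrm M_N(\mathbb K)$ has the odd symplectic form $\langle a\otimes X,b\otimes Y\rangle=\langle a,b\rangle\mathrm{Tr}(XY)$. $\mathcal M:\widehat{\mathrm H}[V]\to\widehat{\mathrm H}[V\otimes\mathrm M_N(\mathbb K)]$ sends a length-$k$ ($k\ge1$) cyclic word, viewed as a $k$-multilinear form on $V$, to its tensor product with the form $t_k(X_1,\dots,X_k)=\mathrm{Tr}(X_1\cdots X_k)$, and $\nu\mapsto N\nu$. $\widehat{\mathcal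 M}_\hbar$ is its $\hbar$-linear multiplicative extension to $\mathrm P^{\wedge\mathrm{nc}}_\hbar$. $\widehat\sigma:\widehat{\mathrm H}[V]\to\widehat SV^*$ is the quotient map from cyclic to symmetric coinvariants ($\nu\mapsto1$), and $\widehat\sigma_\hbar:\mathrm P^{\wedge\mathrm{nc}}_\hbar[V]\to\widehat{\mathrm P}_\hbar[V]$ is its $\hbar$-linear multiplicative extension. $\mathfrak{gl}_N(\mathbb K)$ acts on $V\otimes\mathrm M_N(\mathbb K)$ by commutators in the second factor and on symmetric algebras by derivations. Algebras. An $A_\infty$-structure on $A$ is an odd continuous derivation $m$ of $\widehat T\Sigma A^*$ with $m^2=0$ and image in $\widehat T_+\Sigma A^*$; equivalently structure maps $m_k:A^{\otimes k}\to A$, $k\ge1$. It is cyclic with respect to a symmetric nondegenerate form $\langle-,-\rangle$ on (finite-dimensional) $A$ if each $\langle m_k(a_0,\dots,a_{k-1}),a_k\rangle$ is cyclically antisymmetric. An odd such form induces, via $\Sigma\otimes\Sigma$, an odd symplectic form on $\Sigma A$. The forms $\langle m_k(-),-\rangle$ give cyclically invariant tensors $\alpha_{k+1}$ on $\Sigma A$, and $\tilde m_A:=\sum_k\frac1{k+1}[\alpha_{k+1}]\in\widehat{\mathrm H}[\Sigma A]$; one has $\{\tilde m_A,\tilde m_A\}=0$. $\mathrm M_N(A)=A\otimes\mathrm M_N(\mathbb K)$ has structure maps $m_k$ tensored with the $k$-fold matrix product, and the product form with the trace pairing. $\mathfrak{gl}_N(A)$ is the commutator $L_\infty$-algebra of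 $\mathrm M_N(A)$: the derivation $l$ of $\widehat S\Sigma\mathfrak{gl}_N(A)^*$ induced by that of $\widehat T\Sigma\mathrm M_N(A)^*$. It is cyclic, and with structure maps $l_k$ the forms $\langle l_k(-),-\rangle$ give symmetric tensors $\beta_{k+1}$ on $\Sigma\mathfrak{gl}_N(A)$; set $\tilde l_{\mathfrak{gl}_N(A)}:=\sum_k\frac1{(k+1)!}[\beta_{k+1}]\in\widehat S\Sigma\mathfrak{gl}_N(A)^*$, which is $\mathfrak{gl}_N(\mathbb K)$-invariant. The Loday-Quillen-Tsygan map is $\widehat S_+(CC(A))\to[CE_+(\mathfrak{gl}_N(A))]^{\mathfrak{gl}_N(\mathbb K)}$, where $CC(A)=\prod_{k\ge1}[(\Sigma A^* )^{\widehat\otimes k}]_{\mathbb Z/k}=\widehat{\mathrm H}_+[\Sigma A]$ with differential induced by $m$, $CE_+(\mathfrak g)=(\widehat S_+\Sigma\mathfrak g^*,l)$: it is obtained by applying $\mathcal M$ to each factor, then the quotient map from cyclic to symmetric coinvariants, then multiplying. *)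

theory Defs
  imports
    "HOL-Library.Function_Algebras"
    "HOL-Library.Groups_Big_Fun"
    "HOL-Combinatorics.Multiset_Permutations"
begin

section \<open>Formal linear combinations of monomials\<close>

text \<open>
  A possibly infinite formal linear combination of monomials of type \<^typ>\<open>'b\<close> is its
  coefficient function \<^typ>\<open>'b \<Rightarrow> 'k\<close>.  If \<^term>\<open>B\<close> is a homogeneous basis of a
  finite-dimensional space \<open>V\<close>, the letters of the words below are the elements of the dual basis
  of \<open>V\<^sup>*\<close>, written as the elements of \<^term>\<open>B\<close> they are dual to; an element of the completed
  tensor algebra of \<open>V\<^sup>*\<close> is then any function on the words over \<^term>\<open>B\<close>.
\<close>

definition mon :: "'k::comm_ring_1 \<Rightarrow> 'b \<Rightarrow> ('b \<Rightarrow> 'k)" where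
  "mon c u = (\<lambda>v. if v = u then c else 0)"

definition smult :: "'k::comm_ring_1 \<Rightarrow> ('b \<Rightarrow> 'k) \<Rightarrow> ('b \<Rightarrow> 'k)" where
  "smult c f = (\<lambda>v. c * f v)"

text \<open>Linear and bilinear continuous extension of maps given on monomials.  In every use below the
  sums have only finitely many nonzero terms.\<close>

definition ext1 :: "('b \<Rightarrow> 'c \<Rightarrow> 'k::comm_ring_1) \<Rightarrow> ('b \<Rightarrow> 'k) \<Rightarrow> ('c \<Rightarrow> 'k)" where
  "ext1 T f = (\<lambda>w. Sum_any (\<lambda>u. f u * T u w))"

definition ext2 ::
  "('b \<Rightarrow> 'c \<Rightarrow> 'd \<Rightarrow> 'k::comm_ring_1) \<Rightarrow> ('b \<Rightarrow> 'k) \<Rightarrow> ('c \<Rightarrow> 'k) \<Rightarrow> ('d \<Rightarrow> 'k)" where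
  "ext2 T f g = (\<lambda>w. Sum_any (\<lambda>(u, v). f u * g v * T u v w))"

text \<open>Concatenation product; on lists of letters it is the product of the completed tensor algebra,
  on lists of words it represents the symmetric product of cyclic words.\<close>

definition cat :: "('b list \<Rightarrow> 'k::comm_ring_1) \<Rightarrow> ('b list \<Rightarrow> 'k) \<Rightarrow> ('b list \<Rightarrow> 'k)" where
  "cat f g = (\<lambda>w. \<Sum>k\<le>length w. f (take k w) * g (drop k w))"

definition catprod :: "('b list \<Rightarrow> 'k::comm_ring_1) list \<Rightarrow> ('b list \<Rightarrow> 'k)" where
  "catprod fs = foldr cat fs (mon 1 [])"

definition single :: "('b \<Rightarrow> 'k::comm_ring_1) \<Rightarrow> ('b list \<Rightarrow> 'k)" where
  "single f = (\<lambda>W. case W of [w] \<Rightarrow> f w | _ \<Rightarrow> 0)"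


section \<open>Koszul signs\<close>

definition msgn :: "bool \<Rightarrow> 'k::comm_ring_1" where
  "msgn b = (if b then - 1 else 1)"

text \<open>The sign of rearranging the product of the items \<open>xs\<close> into the product of the
  \<open>xs ! (ps ! 0)\<close>, \<open>xs ! (ps ! 1)\<close>, and so on, where \<open>ps\<close> lists the positions
  of \<open>xs\<close> in their new order; \<open>q\<close> tells which items are odd.\<close>

definition koszul :: "('b \<Rightarrow> bool) \<Rightarrow> 'b list \<Rightarrow> nat list \<Rightarrow> 'k::comm_ring_1" where
  "koszul q xs ps = (\<Prod>(r, s) \<in> {(r, s). r < s \<and> s < length ps \<and> ps ! s < ps ! r}.
     msgn (q (xs ! (ps ! r)) \<and> q (xs ! (ps ! s))))"

definition wpar :: "('x \<Rightarrow> bool) \<Rightarrow> 'x list \<Rightarrow> bool" where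
  "wpar p w = odd (length (filter p w))"

text \<open>The rearrangement of \<open>n\<close> items moving the listed positions to the front.\<close>

definition front :: "nat \<Rightarrow> nat list \<Rightarrow> nat list" where
  "front n ks = ks @ filter (\<lambda>k. k \<notin> set ks) [0..<n]"

text \<open>The derivation with given values on single items; \<open>od\<close> tells whether it is odd.\<close>

definition derm ::
  "bool \<Rightarrow> ('b \<Rightarrow> bool) \<Rightarrow> ('b \<Rightarrow> 'b list \<Rightarrow> 'k::comm_ring_1) \<Rightarrow> 'b list \<Rightarrow> 'b list \<Rightarrow> 'k" where
  "derm od q d xs = (\<Sum>i<length xs. smult (msgn (od \<and> wpar q (take i xs)))
     (cat (mon 1 (take i xs)) (cat (d (xs ! i)) (mon 1 (drop (Suc i) xs)))))"


section \<open>Coinvariants\<close>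

text \<open>
  Elements of spaces of coinvariants are given by representatives.  \<open>mv u c v\<close> means that
  some group element sends the monomial \<open>u\<close> to \<open>c\<close> times the monomial \<open>v\<close>.  The group
  actions preserve the number of letters (and the number of words), so the subspace that is
  divided out consists of all, possibly infinite, combinations of the elements \<open>u - c v\<close>.
\<close>

definition coinv_null :: "('b \<Rightarrow> 'k::comm_ring_1 \<Rightarrow> 'b \<Rightarrow> bool) \<Rightarrow> ('b \<Rightarrow> 'k) set" where
  "coinv_null mv = {f. \<exists>h. \<forall>w. f w =
     Sum_any (\<lambda>(u, c, v). if mv u c v then h (u, c, v) * (mon 1 u w - mon c v w) else 0)}"

definition sym_move :: "('b \<Rightarrow> bool) \<Rightarrow> 'b list \<Rightarrow> 'k::comm_ring_1 \<Rightarrow> 'b list \<Rightarrow> bool" where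
  "sym_move q u c v \<longleftrightarrow>
     (\<exists>ps \<in> permutations_of_set {..<length u}. c = koszul q u ps \<and> v = map ((!) u) ps)"

definition cyc_move :: "('x \<Rightarrow> bool) \<Rightarrow> 'x list \<Rightarrow> 'k::comm_ring_1 \<Rightarrow> 'x list \<Rightarrow> bool" where
  "cyc_move p u c v \<longleftrightarrow>
     (\<exists>i\<le>length u. c = koszul p u ([i..<length u] @ [0..<i]) \<and> v = drop i u @ take i u)"

text \<open>A monomial of the noncommutative side is a list of words \<open>[w\<^sub>1, \<dots>, w\<^sub>i]\<close>, standing for the
  symmetric product of the cyclic words \<open>w\<^sub>1, \<dots>, w\<^sub>i\<close>; the empty word is \<open>\<nu>\<close>.\<close>

definition nc_move ::
  "('x \<Rightarrow> bool) \<Rightarrow> 'x list list \<Rightarrow> 'k::comm_ring_1 \<Rightarrow> 'x list list \<Rightarrow> bool" where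
  "nc_move p U c V \<longleftrightarrow> sym_move (wpar p) U c V \<or>
     (\<exists>r<length U. \<exists>v. cyc_move p (U ! r) c v \<and> V = U[r := v])"

definition sym_eq :: "('x \<Rightarrow> bool) \<Rightarrow> ('x list \<Rightarrow> 'k::comm_ring_1) \<Rightarrow> ('x list \<Rightarrow> 'k) \<Rightarrow> bool" where
  "sym_eq p f g \<longleftrightarrow> f - g \<in> coinv_null (sym_move p)"

definition nc_eq ::
  "('x \<Rightarrow> bool) \<Rightarrow> ('x list list \<Rightarrow> 'k::comm_ring_1) \<Rightarrow> ('x list list \<Rightarrow> 'k) \<Rightarrow> bool" where
  "nc_eq p f g \<longleftrightarrow> f - g \<in> coinv_null (nc_move p)"

definition tens_carrier :: "'x set \<Rightarrow> ('x list \<Rightarrow> 'k::comm_ring_1) set" where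
  "tens_carrier B = {f. \<forall>w. w \<notin> lists B \<longrightarrow> f w = 0}"


section \<open>Adjoining \<open>\<hbar>\<close>\<close>

text \<open>\<open>F n\<close> is the coefficient of \<open>\<hbar>\<^sup>n\<close> in \<open>F\<close>.\<close>

definition hconst :: "('b \<Rightarrow> 'k::comm_ring_1) \<Rightarrow> (nat \<Rightarrow> 'b \<Rightarrow> 'k)" where
  "hconst f = (\<lambda>n. if n = 0 then f else 0)"

definition hmult :: "(nat \<Rightarrow> 'b \<Rightarrow> 'k::comm_ring_1) \<Rightarrow> (nat \<Rightarrow> 'b \<Rightarrow> 'k)" where
  "hmult F = (\<lambda>n. if n = 0 then 0 else F (n - 1))"

definition hlin ::
  "(('b \<Rightarrow> 'k) \<Rightarrow> ('c \<Rightarrow> 'k)) \<Rightarrow> (nat \<Rightarrow> 'b \<Rightarrow> 'k::comm_ring_1) \<Rightarrow> (nat \<Rightarrow> 'c \<Rightarrow> 'k)" where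
  "hlin T F = (\<lambda>n. T (F n))"

definition hbil ::
  "(('b \<Rightarrow> 'k) \<Rightarrow> ('b \<Rightarrow> 'k) \<Rightarrow> ('b \<Rightarrow> 'k)) \<Rightarrow>
   (nat \<Rightarrow> 'b \<Rightarrow> 'k::comm_ring_1) \<Rightarrow> (nat \<Rightarrow> 'b \<Rightarrow> 'k) \<Rightarrow> (nat \<Rightarrow> 'b \<Rightarrow> 'k)" where
  "hbil T F G = (\<lambda>n. \<Sum>i\<le>n. T (F i) (G (n - i)))"

text \<open>Representatives of elements of the commutative side (power series in \<open>\<hbar>\<close>) and of the
  noncommutative side (polynomials in \<open>\<hbar>\<close>, finite direct sum over the number of cyclic words, but
  direct product over their lengths).\<close>

definition P_carrier :: "'x set \<Rightarrow> (nat \<Rightarrow> 'x list \<Rightarrow> 'k::comm_ring_1) set" where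
  "P_carrier B = {F. \<forall>n. F n \<in> tens_carrier B}"

definition Pnc_carrier :: "'x set \<Rightarrow> (nat \<Rightarrow> 'x list list \<Rightarrow> 'k::comm_ring_1) set" where
  "Pnc_carrier B = {F. (\<forall>n W. W \<notin> lists (lists B) \<longrightarrow> F n W = 0) \<and>
     (\<exists>K. \<forall>n W. n > K \<or> length W > K \<longrightarrow> F n W = 0)}"

definition P_eq ::
  "('x \<Rightarrow> bool) \<Rightarrow> (nat \<Rightarrow> 'x list \<Rightarrow> 'k::comm_ring_1) \<Rightarrow> (nat \<Rightarrow> 'x list \<Rightarrow> 'k) \<Rightarrow> bool" where
  "P_eq p F G \<longleftrightarrow> (\<forall>n. sym_eq p (F n) (G n))"

definition Pnc_eq ::
  "('x \<Rightarrow> bool) \<Rightarrow> (nat \<Rightarrow> 'x list list \<Rightarrow> 'k::comm_ring_1) \<Rightarrow> (nat \<Rightarrow> 'x list list \<Rightarrow> 'k) \<Rightarrow> bool"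
  where "Pnc_eq p F G \<longleftrightarrow> (\<forall>n. nc_eq p (F n) (G n))"


section \<open>Inverse form\<close>

text \<open>
  With \<open>D\<^sub>l(x) = \<Sum>\<^sub>u \<omega>(x,u) u\<^sup>*\<close> and \<open>D\<^sub>r(y) = \<Sum>\<^sub>v \<omega>(v,y) v\<^sup>*\<close>, this is the
  equation \<open>\<omega>\<inverse> \<circ> (D\<^sub>l \<otimes> D\<^sub>r) = \<omega>\<close> on \<open>x \<otimes> y\<close>; the sign is the Koszul sign of moving the odd map
  \<open>D\<^sub>r\<close> past \<open>x\<close>.
\<close>

definition inv_form ::
  "'x set \<Rightarrow> ('x \<Rightarrow> bool) \<Rightarrow> ('x \<Rightarrow> 'x \<Rightarrow> 'k::comm_ring_1) \<Rightarrow> ('x \<Rightarrow> 'x \<Rightarrow> 'k)" where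
  "inv_form B p om = (THE eta.
     (\<forall>x y. x \<notin> B \<or> y \<notin> B \<longrightarrow> eta x y = 0) \<and>
     (\<forall>x\<in>B. \<forall>y\<in>B. msgn (p x) * (\<Sum>u\<in>B. \<Sum>v\<in>B. om x u * om v y * eta u v) = om x y))"


section \<open>Noncommutative side\<close>

text \<open>In the following, \<open>p\<close> is the parity of letters and \<open>eta\<close> the inverse form.  The sign of a
  term is the Koszul sign of bringing the contracted letters to the front, first and second
  argument in this order, and all other letters into the order in which they appear in the
  result.\<close>

definition cyc_bracket ::
  "('x \<Rightarrow> bool) \<Rightarrow> ('x \<Rightarrow> 'x \<Rightarrow> 'k::comm_ring_1) \<Rightarrow> 'x list \<Rightarrow> 'x list \<Rightarrow> 'x list \<Rightarrow> 'k" where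
  "cyc_bracket p eta a b = (let m = length a; n = length b in
     \<Sum>i<m. \<Sum>j<n.
       mon (koszul p (a @ b) ([i, m + j] @ [Suc i..<m] @ [0..<i] @ [Suc (m + j)..<m + n] @ [m..<m + j])
              * eta (a ! i) (b ! j))
         (drop (Suc i) a @ take i a @ drop (Suc j) b @ take j b))"

definition nc_bracket ::
  "('x \<Rightarrow> bool) \<Rightarrow> ('x \<Rightarrow> 'x \<Rightarrow> 'k::comm_ring_1) \<Rightarrow>
   'x list list \<Rightarrow> 'x list list \<Rightarrow> 'x list list \<Rightarrow> 'k" where
  "nc_bracket p eta U V = (let m = length U; n = length V in
     \<Sum>i<m. \<Sum>j<n. smult (koszul (wpar p) (U @ V) (front (m + n) [i, m + j]))
       (cat (single (cyc_bracket p eta (U ! i) (V ! j))) (mon 1 (nths (U @ V) (- {i, m + j})))))"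

definition nc_delta ::
  "('x \<Rightarrow> bool) \<Rightarrow> ('x \<Rightarrow> 'x \<Rightarrow> 'k::comm_ring_1) \<Rightarrow> 'x list list \<Rightarrow> 'x list list \<Rightarrow> 'k" where
  "nc_delta p eta U = (\<Sum>j<length U. \<Sum>i<j.
     smult (koszul (wpar p) U (front (length U) [i, j]))
       (cat (single (cyc_bracket p eta (U ! i) (U ! j))) (mon 1 (nths U (- {i, j})))))"

definition cobracket ::
  "('x \<Rightarrow> bool) \<Rightarrow> ('x \<Rightarrow> 'x \<Rightarrow> 'k::comm_ring_1) \<Rightarrow> 'x list \<Rightarrow> 'x list list \<Rightarrow> 'k" where
  "cobracket p eta a = (let n = length a in
     \<Sum>j<n. \<Sum>i<j.
       mon (koszul p a ([i, j] @ [Suc i..<j] @ [Suc j..<n] @ [0..<i]) * eta (a ! i) (a ! j))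
         [drop (Suc i) (take j a), drop (Suc j) a @ take i a])"

definition nc_nabla ::
  "('x \<Rightarrow> bool) \<Rightarrow> ('x \<Rightarrow> 'x \<Rightarrow> 'k::comm_ring_1) \<Rightarrow> 'x list list \<Rightarrow> 'x list list \<Rightarrow> 'k" where
  "nc_nabla p eta = derm True (wpar p) (cobracket p eta)"

definition Pnc_bracket ::
  "('x \<Rightarrow> bool) \<Rightarrow> ('x \<Rightarrow> 'x \<Rightarrow> 'k::comm_ring_1) \<Rightarrow>
   (nat \<Rightarrow> 'x list list \<Rightarrow> 'k) \<Rightarrow> (nat \<Rightarrow> 'x list list \<Rightarrow> 'k) \<Rightarrow> (nat \<Rightarrow> 'x list list \<Rightarrow> 'k)" where
  "Pnc_bracket p eta = hbil (ext2 (nc_bracket p eta))"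

definition Pnc_diff ::
  "('x \<Rightarrow> bool) \<Rightarrow> ('x \<Rightarrow> 'x \<Rightarrow> 'k::comm_ring_1) \<Rightarrow>
   (nat \<Rightarrow> 'x list list \<Rightarrow> 'k) \<Rightarrow> (nat \<Rightarrow> 'x list list \<Rightarrow> 'k)" where
  "Pnc_diff p eta F = hmult (hlin (ext1 (nc_delta p eta)) F + hlin (ext1 (nc_nabla p eta)) F)"


section \<open>Commutative side\<close>

definition sym_bracket ::
  "('x \<Rightarrow> bool) \<Rightarrow> ('x \<Rightarrow> 'x \<Rightarrow> 'k::comm_ring_1) \<Rightarrow> 'x list \<Rightarrow> 'x list \<Rightarrow> 'x list \<Rightarrow> 'k" where
  "sym_bracket p eta a b = (let m = length a; n = length b in
     \<Sum>i<m. \<Sum>j<n. mon (koszul p (a @ b) (front (m + n) [i, m + j]) * eta (a ! i) (b ! j))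
       (nths (a @ b) (- {i, m + j})))"

text \<open>The identity \<open>\<Delta>(ab) = (\<Delta>a)b + (-1)\<^sup>a a(\<Delta>b) + {a,b}\<close> for a letter \<open>a = x\<close>, where
  \<open>\<Delta>x = 0\<close>, together with \<open>\<Delta>1 = 0\<close>, determines \<open>\<Delta>\<close> on monomials.\<close>

primrec BV_laplacian ::
  "('x \<Rightarrow> bool) \<Rightarrow> ('x \<Rightarrow> 'x \<Rightarrow> 'k::comm_ring_1) \<Rightarrow> 'x list \<Rightarrow> 'x list \<Rightarrow> 'k" where
  "BV_laplacian p eta [] = 0"
| "BV_laplacian p eta (x # b) =
     smult (msgn (p x)) (cat (mon 1 [x]) (BV_laplacian p eta b)) + sym_bracket p eta [x] b"

definition P_bracket ::
  "('x \<Rightarrow> bool) \<Rightarrow> ('x \<Rightarrow> 'x \<Rightarrow> 'k::comm_ring_1) \<Rightarrow>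
   (nat \<Rightarrow> 'x list \<Rightarrow> 'k) \<Rightarrow> (nat \<Rightarrow> 'x list \<Rightarrow> 'k) \<Rightarrow> (nat \<Rightarrow> 'x list \<Rightarrow> 'k)" where
  "P_bracket p eta = hbil (ext2 (sym_bracket p eta))"

definition P_diff ::
  "('x \<Rightarrow> bool) \<Rightarrow> ('x \<Rightarrow> 'x \<Rightarrow> 'k::comm_ring_1) \<Rightarrow>
   (nat \<Rightarrow> 'x list \<Rightarrow> 'k) \<Rightarrow> (nat \<Rightarrow> 'x list \<Rightarrow> 'k)" where
  "P_diff p eta F = hmult (hlin (ext1 (BV_laplacian p eta)) F)"


section \<open>Matrices\<close>

text \<open>\<open>(x, i, j)\<close> stands for \<open>x \<otimes> E\<^sub>i\<^sub>j\<close>, with \<open>E\<^sub>i\<^sub>j\<close> a matrix unit.  \<open>unit_prod ps c d\<close> is the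
  \<open>(c, d)\<close> entry of the product of the matrix units with the indices listed in \<open>ps\<close>.\<close>

definition mat_basis :: "nat \<Rightarrow> 'x set \<Rightarrow> ('x \<times> nat \<times> nat) set" where
  "mat_basis N B = B \<times> {..<N} \<times> {..<N}"

fun unit_prod :: "(nat \<times> nat) list \<Rightarrow> nat \<Rightarrow> nat \<Rightarrow> 'k::comm_ring_1" where
  "unit_prod [] c d = (if c = d then 1 else 0)"
| "unit_prod ((a, b) # ps) c d = (if c = a then unit_prod ps b d else 0)"

definition unit_trace :: "nat \<Rightarrow> (nat \<times> nat) list \<Rightarrow> 'k::comm_ring_1" where
  "unit_trace N ps = (\<Sum>c<N. unit_prod ps c c)"

definition mat_form ::
  "nat \<Rightarrow> ('x \<Rightarrow> 'x \<Rightarrow> 'k::comm_ring_1) \<Rightarrow> ('x \<times> nat \<times> nat \<Rightarrow> 'x \<times> nat \<times> nat \<Rightarrow> 'k)" where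
  "mat_form N om y z = om (fst y) (fst z) * unit_trace N [snd y, snd z]"

text \<open>The value of \<open>\<M>\<close> on a word \<open>w\<close>: the multilinear form \<open>w \<otimes> t\<^sub>k\<close> evaluated on basis
  elements.  For the empty word this is \<open>N \<nu>\<close>, as the trace of the empty product is \<open>N\<close>.\<close>

definition M_word :: "nat \<Rightarrow> 'x list \<Rightarrow> ('x \<times> nat \<times> nat) list \<Rightarrow> 'k::comm_ring_1" where
  "M_word N w v = (if map fst v = w \<and> set (map snd v) \<subseteq> {..<N} \<times> {..<N}
     then unit_trace N (map snd v) else 0)"

definition M_hbar ::
  "nat \<Rightarrow> (nat \<Rightarrow> 'x list list \<Rightarrow> 'k::comm_ring_1) \<Rightarrow>
   (nat \<Rightarrow> ('x \<times> nat \<times> nat) list list \<Rightarrow> 'k)" where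
  "M_hbar N = hlin (ext1 (\<lambda>W. catprod (map (\<lambda>w. single (M_word N w)) W)))"

text \<open>On representatives the quotient map from cyclic to symmetric coinvariants is the identity, and
  \<open>\<nu> \<mapsto> 1\<close>.\<close>

definition sigma_hbar ::
  "(nat \<Rightarrow> 'y list list \<Rightarrow> 'k::comm_ring_1) \<Rightarrow> (nat \<Rightarrow> 'y list \<Rightarrow> 'k)" where
  "sigma_hbar = hlin (ext1 (\<lambda>W. catprod (map (mon 1) W)))"

text \<open>The action of the \<open>N\<close> by \<open>N\<close> matrix \<open>X\<close> on the dual basis: minus the coefficient of
  \<open>x \<otimes> E\<^sub>a\<^sub>b\<close> in \<open>x \<otimes> [X, E\<^sub>c\<^sub>d]\<close>.\<close>

definition gl_gen ::
  "nat \<Rightarrow> (nat \<Rightarrow> nat \<Rightarrow> 'k::comm_ring_1) \<Rightarrow> 'x \<times> nat \<times> nat \<Rightarrow> ('x \<times> nat \<times> nat) list \<Rightarrow> 'k" where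
  "gl_gen N X = (\<lambda>(x, a, b) w. case w of
       [(y, c, d)] \<Rightarrow> if y = x \<and> c < N \<and> d < N
          then - ((if b = d then X a c else 0) - (if a = c then X d b else 0)) else 0
     | _ \<Rightarrow> 0)"

definition gl_act ::
  "nat \<Rightarrow> ('x \<times> nat \<times> nat \<Rightarrow> bool) \<Rightarrow> (nat \<Rightarrow> nat \<Rightarrow> 'k::comm_ring_1) \<Rightarrow>
   (('x \<times> nat \<times> nat) list \<Rightarrow> 'k) \<Rightarrow> (('x \<times> nat \<times> nat) list \<Rightarrow> 'k)" where
  "gl_act N p X = ext1 (derm False p (gl_gen N X))"


section \<open>Structure constants and their shifts\<close>

text \<open>Multilinear maps \<open>A\<^sup>\<otimes>\<^sup>k \<rightarrow> A\<close> for all \<open>k \<ge> 1\<close> are given by structure constants \<open>mu w x\<close>: the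
  coefficient of the basis element \<open>x\<close> in the value on the basis elements listed in \<open>w\<close>.  \<open>par\<close> is the
  parity in \<open>A\<close>; in \<open>\<Sigma>A\<close> a basis element has the opposite parity, and so has the dual letter.

  The structure maps \<open>b\<^sub>k\<close> on \<open>\<Sigma>A\<close> are given by \<open>b\<^sub>k \<circ> \<Sigma>\<^sup>\<otimes>\<^sup>k = \<Sigma> \<circ> m\<^sub>k\<close>, and the form on \<open>\<Sigma>A\<close> by
  \<open>\<langle>-,-\<rangle> \<circ> (\<Sigma> \<otimes> \<Sigma>) = \<langle>-,-\<rangle>\<close>.\<close>

definition shift_consts ::
  "('x \<Rightarrow> bool) \<Rightarrow> ('x list \<Rightarrow> 'x \<Rightarrow> 'k::comm_ring_1) \<Rightarrow> ('x list \<Rightarrow> 'x \<Rightarrow> 'k)" where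
  "shift_consts par mu w x =
     (- 1) ^ (\<Sum>i<length w. if par (w ! i) then length w - 1 - i else 0) * mu w x"

definition shift_form ::
  "('x \<Rightarrow> bool) \<Rightarrow> ('x \<Rightarrow> 'x \<Rightarrow> 'k::comm_ring_1) \<Rightarrow> ('x \<Rightarrow> 'x \<Rightarrow> 'k)" where
  "shift_form par ip x y = msgn (par x) * ip x y"

text \<open>The sign \<open>\<Prod>\<^sub>i\<^sub><\<^sub>j (-1)\<^bsup>|x\<^sub>i||x\<^sub>j|\<^esup>\<close> relating the word \<open>x\<^sub>1\<dots>x\<^sub>k\<close>, regarded as a multilinear form by the
  Koszul sign rule, to the product of the evaluations of the \<open>x\<^sub>i\<close>.\<close>

definition eval_sgn :: "('x \<Rightarrow> bool) \<Rightarrow> 'x list \<Rightarrow> 'k::comm_ring_1" where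
  "eval_sgn p w = (- 1) ^ (length (filter p w) choose 2)"

text \<open>The value on a letter \<open>x\<close> of the odd derivation of the completed tensor algebra dual to odd maps
  \<open>b\<close> on \<open>\<Sigma>A\<close>: the form \<open>(-1)\<^bsup>|x|\<^esup> x \<circ> b\<close>.\<close>

definition dual_gen ::
  "('x \<Rightarrow> bool) \<Rightarrow> ('x list \<Rightarrow> 'x \<Rightarrow> 'k::comm_ring_1) \<Rightarrow> 'x \<Rightarrow> 'x list \<Rightarrow> 'k" where
  "dual_gen p b x w = (if w = [] then 0 else eval_sgn p w * msgn (p x) * b w x)"

text \<open>The tensors \<open>\<langle>b\<^sub>k(-),-\<rangle>\<close>.  With these sign conventions the Hamiltonian vector field \<open>{m_tilde, -}\<close> is
  the dual derivation itself, not its negative.\<close>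

definition form_tensor ::
  "'x set \<Rightarrow> ('x \<Rightarrow> bool) \<Rightarrow> ('x list \<Rightarrow> 'x \<Rightarrow> 'k::comm_ring_1) \<Rightarrow> ('x \<Rightarrow> 'x \<Rightarrow> 'k) \<Rightarrow> 'x list \<Rightarrow> 'k" where
  "form_tensor B p b om w = (if w \<in> lists B \<and> length w \<ge> 2
     then eval_sgn p w * (\<Sum>x\<in>B. b (butlast w) x * om x (last w)) else 0)"

text \<open>A derivation of the symmetric algebra corresponds to symmetric structure maps by identifying
  coinvariants with invariants through the sum over the group; for the commutator \<open>L\<^sub>\<infinity>\<close>-structure this
  yields the sum of \<open>b\<^sub>k\<close> over all permutations of its arguments.\<close>

definition commutator_consts ::
  "('x \<Rightarrow> bool) \<Rightarrow> ('x list \<Rightarrow> 'x \<Rightarrow> 'k::comm_ring_1) \<Rightarrow> ('x list \<Rightarrow> 'x \<Rightarrow> 'k)" where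
  "commutator_consts p b w x =
     (\<Sum>ps\<in>permutations_of_set {..<length w}. koszul p w ps * b (map ((!) w) ps) x)"

definition m_tilde ::
  "'x set \<Rightarrow> ('x \<Rightarrow> bool) \<Rightarrow> ('x list \<Rightarrow> 'x \<Rightarrow> 'k::field_char_0) \<Rightarrow> ('x \<Rightarrow> 'x \<Rightarrow> 'k) \<Rightarrow> 'x list \<Rightarrow> 'k" where
  "m_tilde B p b om w = form_tensor B p b om w / of_nat (length w)"

definition l_tilde ::
  "'x set \<Rightarrow> ('x \<Rightarrow> bool) \<Rightarrow> ('x list \<Rightarrow> 'x \<Rightarrow> 'k::field_char_0) \<Rightarrow> ('x \<Rightarrow> 'x \<Rightarrow> 'k) \<Rightarrow> 'x list \<Rightarrow> 'k" where
  "l_tilde B p b om w = form_tensor B p (commutator_consts p b) om w / fact (length w)"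

definition mat_consts ::
  "nat \<Rightarrow> 'x set \<Rightarrow> ('x list \<Rightarrow> 'x \<Rightarrow> 'k::comm_ring_1) \<Rightarrow>
   (('x \<times> nat \<times> nat) list \<Rightarrow> 'x \<times> nat \<times> nat \<Rightarrow> 'k)" where
  "mat_consts N B mu w y = (if w \<in> lists (mat_basis N B) \<and> y \<in> mat_basis N B
     then mu (map fst w) (fst y) * unit_prod (map snd w) (fst (snd y)) (snd (snd y)) else 0)"


section \<open>Cyclic \<open>A\<^sub>\<infinity>\<close>-algebras with odd inner product\<close>

text \<open>\<open>A0\<close> and \<open>A1\<close> are the even and odd parts of \<open>A\<close>, and \<open>B\<close> is a homogeneous basis.\<close>

locale finite_dim_super_space = vector_space scale
  for scale :: "'k::field_char_0 \<Rightarrow> 'a::ab_group_add \<Rightarrow> 'a" +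
  fixes A0 A1 B :: "'a set"
  assumes subspace_even: "subspace A0"
    and subspace_odd: "subspace A1"
    and even_odd_disjoint: "A0 \<inter> A1 = {0}"
    and even_odd_sum: "\<exists>x\<in>A0. \<exists>y\<in>A1. a = x + y"
    and finite_basis: "finite B"
    and independent_basis: "independent B"
    and span_basis: "span B = UNIV"
    and homogeneous_basis: "B \<subseteq> A0 \<union> A1"

definition struct_consts ::
  "('k::field_char_0 \<Rightarrow> 'a::ab_group_add \<Rightarrow> 'a) \<Rightarrow> 'a set \<Rightarrow> ('a list \<Rightarrow> 'a) \<Rightarrow> ('a list \<Rightarrow> 'a \<Rightarrow> 'k)" where
  "struct_consts scale B m w x = (if w \<noteq> [] \<and> w \<in> lists B \<and> x \<in> B
     then module.representation scale B (m w) x else 0)"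

text \<open>\<open>m\<^sub>k(a\<^sub>1, \<dots>, a\<^sub>k)\<close> is written \<open>m [a\<^sub>1, \<dots>, a\<^sub>k]\<close>; the value of \<open>m\<close> on the empty list is irrelevant,
  so the derivation automatically has image in the part of positive tensor degree.\<close>

locale cyclic_ainf_algebra = finite_dim_super_space scale A0 A1 B
  for scale :: "'k::field_char_0 \<Rightarrow> 'a::ab_group_add \<Rightarrow> 'a" and A0 A1 B :: "'a set" +
  fixes m :: "'a list \<Rightarrow> 'a" and ip :: "'a \<Rightarrow> 'a \<Rightarrow> 'k"
  assumes m_multilinear: "Vector_Spaces.linear scale scale (\<lambda>a. m (us @ a # vs))"
    and m_parity: "as \<noteq> [] \<Longrightarrow> set as \<subseteq> A0 \<union> A1 \<Longrightarrow>
      m as \<in> (if odd (length as) \<noteq> wpar (\<lambda>a. a \<in> A1) as then A1 else A0)"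
    and ainf_relations: "f \<in> tens_carrier B \<Longrightarrow>
      (let p = (\<lambda>a. a \<notin> A1);
           D = ext1 (derm True p
                 (dual_gen p (shift_consts (\<lambda>a. a \<in> A1) (struct_consts scale B m))))
       in D (D f) = 0)"
    and ip_linear_left: "Vector_Spaces.linear scale (*) (\<lambda>a. ip a b)"
    and ip_linear_right: "Vector_Spaces.linear scale (*) (ip a)"
    and ip_odd: "a \<in> A0 \<and> b \<in> A0 \<or> a \<in> A1 \<and> b \<in> A1 \<Longrightarrow> ip a b = 0"
    and ip_symmetric: "a \<in> A0 \<union> A1 \<Longrightarrow> b \<in> A0 \<union> A1 \<Longrightarrow>
      ip a b = msgn (a \<in> A1 \<and> b \<in> A1) * ip b a"
    and ip_nondegenerate: "(\<forall>b. ip a b = 0) \<Longrightarrow> a = 0"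
    and m_cyclic: "as \<noteq> [] \<Longrightarrow> set as \<subseteq> A0 \<union> A1 \<Longrightarrow> z \<in> A0 \<union> A1 \<Longrightarrow>
      ip (m as) z = (- 1) ^ length as * msgn (z \<in> A1 \<and> wpar (\<lambda>a. a \<in> A1) as)
        * ip (m (z # butlast as)) (last as)"


section \<open>Loday-Quillen-Tsygan map\<close>

text \<open>Symmetric products of at least one nonempty cyclic word; here the product over the number of words
  is complete.\<close>

definition SCC_carrier :: "'x set \<Rightarrow> ('x list list \<Rightarrow> 'k::comm_ring_1) set" where
  "SCC_carrier B = {f. \<forall>W. f W \<noteq> 0 \<longrightarrow> W \<noteq> [] \<and> W \<in> lists (lists B - {[]})}"

definition CE_carrier :: "'x set \<Rightarrow> ('x list \<Rightarrow> 'k::comm_ring_1) set" where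
  "CE_carrier B = {f \<in> tens_carrier B. f [] = 0}"

definition LQT_map ::
  "nat \<Rightarrow> ('x list list \<Rightarrow> 'k::comm_ring_1) \<Rightarrow> (('x \<times> nat \<times> nat) list \<Rightarrow> 'k)" where
  "LQT_map N = ext1 (\<lambda>W. catprod (map (M_word N) W))"

definition SCC_diff ::
  "('x \<Rightarrow> bool) \<Rightarrow> ('x list \<Rightarrow> 'x \<Rightarrow> 'k::comm_ring_1) \<Rightarrow> ('x list list \<Rightarrow> 'k) \<Rightarrow> ('x list list \<Rightarrow> 'k)" where
  "SCC_diff p b = ext1 (derm True (wpar p) (\<lambda>w. single (derm True p (dual_gen p b) w)))"

text \<open>The Chevalley-Eilenberg differential of the commutator \<open>L\<^sub>\<infinity>\<close>-algebra is induced by the derivation of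
  the tensor algebra.\<close>

definition CE_diff ::
  "('x \<Rightarrow> bool) \<Rightarrow> ('x list \<Rightarrow> 'x \<Rightarrow> 'k::comm_ring_1) \<Rightarrow> ('x list \<Rightarrow> 'k) \<Rightarrow> ('x list \<Rightarrow> 'k)" where
  "CE_diff p b = ext1 (derm True p (dual_gen p b))"

end

(*
An element of a space of coinvariants is determined by its values on the invariant functionals of
finite support, so every identity between infinite combinations of words can be tested on such a
functional phi, where it becomes a finite identity on words.  Pulled back along the Loday-Quillen-
Tsygan map, phi is summed over the closed paths of matrix indices that decorate a cyclic word.
Contracting two letters of different words with the inverse form of the trace pairing joins two
closed paths into one (the bracket of cyclic words); contracting two letters of the same word cuts a
closed path into two (the cobracket).  Since the BV Laplacian and the Poisson bracket are given by
all such contractions, they correspond to delta + nabla and to the bracket of cyclic words.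

The differentials {m_tilde, -} and {l_tilde, -} are Hamiltonian vector fields: cyclic invariance of
the tensor of m lets one contract always in its last letter, which cancels the factor 1/(k+1) and
turns the form back into the structure maps.
*)

theory Submission
  imports Defs
begin

section \<open>Formal sums tested against functionals of finite support\<close>

section \<open>Pairing with functionals\<close>

text \<open>Infinite sums shape the proof. \<open>Sum_any\<close> returns 0 when infinitely many
  terms are nonzero, so no exchange of summations is free: each one needs that a given output
  monomial arises from finitely many inputs. For brackets and differentials this comes from the
  finite basis, because the input letters are those of the output together with contracted letters
  of the basis. For the map itself it fails: the empty word \<nu> goes to N times the unit, so a
  product may be padded with \<nu> without changing the letters of its image. The direct sum over
  the number of words bounds that number, and test functionals pulled back to the noncommutative
  side are truncated at such a bound. Signs shape the rest. The rearrangements that occur permute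
  blocks of letters, so their Koszul signs depend only on the parities of the blocks. As the inverse
  form is odd, the contracted letters of a nonzero term have opposite parities, and the sign
  identities become Boolean identities that a case distinction settles.\<close>

definition finsupp :: "('b \<Rightarrow> 'k::zero) \<Rightarrow> bool" where
  "finsupp f \<longleftrightarrow> finite {w. f w \<noteq> 0}"

text \<open>A finite sum as soon as one argument has finite support; otherwise
  \<open>Sum_any\<close> may silently return 0. The left argument is a formal sum, the right one a
  test functional given by its values on monomials.\<close>

definition pairing :: "('b \<Rightarrow> 'k::field_char_0) \<Rightarrow> ('b \<Rightarrow> 'k) \<Rightarrow> 'k" where
  "pairing f \<phi> = Sum_any (\<lambda>w. f w * \<phi> w)"

lemma finsupp_subset: "finsupp f \<Longrightarrow> (\<And>w. f w = 0 \<Longrightarrow> g w = 0) \<Longrightarrow> finsupp g"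
  unfolding finsupp_def by (erule finite_subset[rotated]) auto

lemma finsupp_bounded: "finite S \<Longrightarrow> (\<And>w. f w \<noteq> 0 \<Longrightarrow> w \<in> S) \<Longrightarrow> finsupp f"
  unfolding finsupp_def by (erule finite_subset[rotated]) auto

lemma finsupp_mon [simp]: "finsupp (mon c u)"
  by (rule finsupp_bounded[of "{u}"]) (auto simp: mon_def split: if_splits)

lemma finsupp_comp_inj: "finsupp \<phi> \<Longrightarrow> inj h \<Longrightarrow> finsupp (\<lambda>x. \<phi> (h x))"
  unfolding finsupp_def using finite_vimageI[of "{w. \<phi> w \<noteq> 0}" h] by (simp add: vimage_def)

lemma finsupp_append_left [simp]: "finsupp \<phi> \<Longrightarrow> finsupp (\<lambda>t. \<phi> (s @ t))"
  by (rule finsupp_comp_inj) (auto simp: inj_def)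

lemma finsupp_append_right [simp]: "finsupp \<phi> \<Longrightarrow> finsupp (\<lambda>t. \<phi> (t @ s))"
  by (rule finsupp_comp_inj) (auto simp: inj_def)

lemma finsupp_Cons [simp]: "finsupp \<phi> \<Longrightarrow> finsupp (\<lambda>t. \<phi> (x # t))"
  by (rule finsupp_comp_inj) (auto simp: inj_def)

lemma finsupp_mult_const [simp]: "finsupp \<phi> \<Longrightarrow> finsupp (\<lambda>w. c * \<phi> w :: 'k::field_char_0)"
  by (erule finsupp_subset) auto

text \<open>A nonzero value of \<open>F\<close> at s needs a word with prefix s in the support of
  \<phi>, and finitely many words have finitely many prefixes. This keeps iterated pairings finite
  when functionals are evaluated on concatenations.\<close>

lemma finsupp_prefix:
  assumes "finsupp \<phi>" and "\<And>s. (\<And>t. \<phi> (s @ t) = 0) \<Longrightarrow> F s = 0"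
  shows "finsupp F"
proof (rule finsupp_bounded)
  let ?S = "{w. \<phi> w \<noteq> 0}"
  show "finite (\<Union>w\<in>?S. (\<lambda>k. take k w) ` {..length w})"
    using assms(1) by (auto simp: finsupp_def)
  fix s assume "F s \<noteq> 0"
  then obtain t where "\<phi> (s @ t) \<noteq> 0" using assms(2) by blast
  then show "s \<in> (\<Union>w\<in>?S. (\<lambda>k. take k w) ` {..length w})"
    by (auto intro!: bexI[of _ "s @ t"] image_eqI[of _ _ "length s"])
qed

lemma pairing_eq_sum:
  assumes "finite S" "\<And>w. \<phi> w \<noteq> 0 \<Longrightarrow> w \<in> S"
  shows "pairing f \<phi> = (\<Sum>w\<in>S. f w * \<phi> w)"
  unfolding pairing_def by (rule Sum_any.expand_superset) (use assms in auto)

lemma pairing_eq_sum':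
  assumes "finite S" "\<And>w. f w \<noteq> 0 \<Longrightarrow> \<phi> w \<noteq> 0 \<Longrightarrow> w \<in> S"
  shows "pairing f \<phi> = (\<Sum>w\<in>S. f w * \<phi> w)"
  unfolding pairing_def by (rule Sum_any.expand_superset) (use assms in auto)

lemma pairing_supp: "finsupp \<phi> \<Longrightarrow> pairing f \<phi> = (\<Sum>w | \<phi> w \<noteq> 0. f w * \<phi> w)"
  by (rule pairing_eq_sum) (auto simp: finsupp_def)

lemma pairing_cong: "(\<And>w. f w \<noteq> 0 \<Longrightarrow> \<phi> w = \<psi> w) \<Longrightarrow> pairing f \<phi> = pairing f \<psi>"
  unfolding pairing_def by (metis mult_zero_left)

lemma pairing_add: "finsupp \<phi> \<Longrightarrow> pairing (f + g) \<phi> = pairing f \<phi> + pairing g \<phi>"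
  by (simp add: pairing_supp sum.distrib distrib_right)

lemma pairing_diff: "finsupp \<phi> \<Longrightarrow> pairing (f - g) \<phi> = pairing f \<phi> - pairing g \<phi>"
  by (simp add: pairing_supp sum_subtractf left_diff_distrib)

lemma pairing_zero [simp]: "pairing 0 \<phi> = 0" "pairing (\<lambda>w. 0) \<phi> = 0"
  by (simp_all add: pairing_def)

lemma pairing_zero_right [simp]: "pairing f (\<lambda>w. 0) = 0"
  by (simp_all add: pairing_def)

lemma pairing_smult: "finsupp \<phi> \<Longrightarrow> pairing (smult c f) \<phi> = c * pairing f \<phi>"
  by (simp add: pairing_supp smult_def sum_distrib_left mult.assoc)

lemma pairing_sum: "finsupp \<phi> \<Longrightarrow> pairing (\<Sum>i\<in>I. f i) \<phi> = (\<Sum>i\<in>I. pairing (f i) \<phi>)"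
  by (induction I rule: infinite_finite_induct) (simp_all add: pairing_add)

lemma pairing_mult_right': "pairing f (\<lambda>w. c * \<phi> w) = c * pairing f \<phi>"
proof (cases "c = 0")
  case False
  then have "{w. f w * (c * \<phi> w) \<noteq> 0} = {w. f w * \<phi> w \<noteq> 0}" by auto
  then show ?thesis unfolding pairing_def Sum_any.expand_set
    by (simp add: sum_distrib_left mult_ac)
qed simp

lemma pairing_mon [simp]: "pairing (mon c u) \<phi> = c * \<phi> u"
  by (subst pairing_eq_sum'[where S = "{u}"]) (auto simp: mon_def split: if_splits)

lemma pairing_mon_right [simp]: "pairing f (mon 1 u) = f u"
  by (subst pairing_eq_sum[where S = "{u}"]) (auto simp: mon_def split: if_splits)

lemma pairing_single: "finsupp \<phi> \<Longrightarrow> pairing (single f) \<phi> = pairing f (\<lambda>r. \<phi> [r])"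
proof -
  assume fin: "finsupp \<phi>"
  let ?S = "{w. \<phi> w \<noteq> 0}" and ?R = "{r. \<phi> [r] \<noteq> 0}"
  have fin': "finsupp (\<lambda>r. \<phi> [r])" using finsupp_comp_inj[OF fin, of "\<lambda>r. [r]"] by (auto simp: inj_def)
  have "(\<Sum>W\<in>?S. single f W * \<phi> W) = (\<Sum>W\<in>(\<lambda>r. [r]) ` ?R. single f W * \<phi> W)"
    by (rule sum.mono_neutral_right)
      (use fin in \<open>auto simp: finsupp_def single_def split: list.splits\<close>)
  also have "\<dots> = (\<Sum>r\<in>?R. f r * \<phi> [r])"
    by (subst sum.reindex) (auto simp: inj_on_def single_def)
  finally show ?thesis using fin fin' by (simp add: pairing_supp)
qed

lemma finsupp_pairing_append: "finsupp \<phi> \<Longrightarrow> finsupp (\<lambda>s. pairing g (\<lambda>t. \<phi> (s @ t)))"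
  by (rule finsupp_prefix[of \<phi>]) auto

text \<open>Both sides sum over the words in the support of \<phi> together with a cut point.
  \<open>A\<close> and \<open>C\<close> collect the prefixes and suffixes that occur, so the
  rearrangement takes place in a finite rectangle.\<close>

lemma pairing_cat:
  assumes fin: "finsupp \<phi>"
  shows "pairing (cat f g) \<phi> = pairing f (\<lambda>s. pairing g (\<lambda>t. \<phi> (s @ t)))"
proof -
  let ?S = "{w. \<phi> w \<noteq> 0}"
  define A where "A = (\<Union>w\<in>?S. (\<lambda>k. take k w) ` {..length w})"
  define C where "C = (\<Union>w\<in>?S. (\<lambda>k. drop k w) ` {..length w})"
  have finS: "finite ?S" using fin by (simp add: finsupp_def)
  have finA: "finite A" and finC: "finite C" using finS by (auto simp: A_def C_def)
  have A: "s \<in> A" and C: "t \<in> C" if "\<phi> (s @ t) \<noteq> 0" for s t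
    using that by (auto simp: A_def C_def intro!: bexI[of _ "s @ t"] image_eqI[of _ _ "length s"])
  have "pairing (cat f g) \<phi> = (\<Sum>w\<in>?S. \<Sum>k\<le>length w. f (take k w) * g (drop k w) * \<phi> w)"
    using fin by (simp add: pairing_supp cat_def sum_distrib_right)
  also have "\<dots> = (\<Sum>(w,k)\<in>(SIGMA w:?S. {..length w}). f (take k w) * g (drop k w) * \<phi> w)"
    using finS by (subst sum.Sigma) auto
  also have "\<dots> = (\<Sum>(s,t)\<in>{(s,t)\<in>A\<times>C. \<phi> (s @ t) \<noteq> 0}. f s * g t * \<phi> (s @ t))"
    by (rule sum.reindex_bij_witness[where i = "\<lambda>(s,t). (s @ t, length s)" and
        j = "\<lambda>(w,k). (take k w, drop k w)"]) (auto simp: A_def C_def)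
  also have "\<dots> = (\<Sum>(s,t)\<in>A\<times>C. f s * g t * \<phi> (s @ t))"
    by (rule sum.mono_neutral_left) (use finA finC in auto)
  also have "\<dots> = (\<Sum>s\<in>A. \<Sum>t\<in>C. f s * g t * \<phi> (s @ t))"
    by (simp add: sum.cartesian_product)
  also have "\<dots> = (\<Sum>s\<in>A. f s * pairing g (\<lambda>t. \<phi> (s @ t)))"
    by (rule sum.cong[OF refl], subst pairing_eq_sum[OF finC])
      (auto intro: C simp: sum_distrib_left mult.assoc)
  also have "\<dots> = pairing f (\<lambda>s. pairing g (\<lambda>t. \<phi> (s @ t)))"
  proof (rule pairing_eq_sum[symmetric, OF finA])
    fix s assume "pairing g (\<lambda>t. \<phi> (s @ t)) \<noteq> 0"
    then have "(\<lambda>t. \<phi> (s @ t)) \<noteq> (\<lambda>t. 0)" by auto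
    then show "s \<in> A" using A by auto
  qed
  finally show ?thesis .
qed

text \<open>By \<open>loc\<close> the union \<open>D\<close> of the inputs that reach the support of
  \<phi> is finite, so the two sums can be exchanged. Local finiteness is asked only for monomials
  occurring in \<open>f\<close>, so that a bound on \<open>f\<close> can supply it.\<close>

lemma pairing_ext1:
  assumes fin: "finsupp \<phi>" and loc: "\<And>w. \<phi> w \<noteq> 0 \<Longrightarrow> finite {u. f u \<noteq> 0 \<and> T u w \<noteq> 0}"
  shows "pairing (ext1 T f) \<phi> = pairing f (\<lambda>u. pairing (T u) \<phi>)"
proof -
  let ?S = "{w. \<phi> w \<noteq> 0}"
  define D where "D = (\<Union>w\<in>?S. {u. f u \<noteq> 0 \<and> T u w \<noteq> 0})"
  have finD: "finite D" using fin loc by (auto simp: D_def finsupp_def)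
  have "pairing (ext1 T f) \<phi> = (\<Sum>w\<in>?S. (\<Sum>u\<in>D. f u * T u w) * \<phi> w)"
    unfolding pairing_supp[OF fin] ext1_def
    by (rule sum.cong[OF refl], subst Sum_any.expand_superset[OF finD]) (auto simp: D_def)
  also have "\<dots> = (\<Sum>u\<in>D. f u * pairing (T u) \<phi>)"
    unfolding pairing_supp[OF fin] sum_distrib_left sum_distrib_right
    by (subst sum.swap) (simp add: mult.assoc)
  also have "\<dots> = pairing f (\<lambda>u. pairing (T u) \<phi>)"
  proof (rule pairing_eq_sum'[symmetric, OF finD])
    fix u assume "f u \<noteq> 0" "pairing (T u) \<phi> \<noteq> 0"
    then obtain w where "\<phi> w \<noteq> 0" "T u w \<noteq> 0"
      unfolding pairing_supp[OF fin] by (force dest: sum.not_neutral_contains_not_neutral)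
    then show "u \<in> D" using \<open>f u \<noteq> 0\<close> by (auto simp: D_def)
  qed
  finally show ?thesis .
qed

text \<open>A bilinear extension is a linear one on pairs of monomials. Splitting the sum over pairs
  into an iterated pairing needs a product set, hence the enlargement of \<open>D\<close> to the
  product of its projections.\<close>

lemma pairing_ext2:
  assumes fin: "finsupp \<phi>" and loc: "\<And>w. \<phi> w \<noteq> 0 \<Longrightarrow> finite {(u,v). f u \<noteq> 0 \<and> g v \<noteq> 0 \<and> T u v w \<noteq> 0}"
  shows "pairing (ext2 T f g) \<phi> = pairing f (\<lambda>u. pairing g (\<lambda>v. pairing (T u v) \<phi>))"
proof -
  let ?S = "{w. \<phi> w \<noteq> 0}"
  define D where "D = (\<Union>w\<in>?S. {(u,v). f u \<noteq> 0 \<and> g v \<noteq> 0 \<and> T u v w \<noteq> 0})"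
  have finD: "finite D" using fin loc by (auto simp: D_def finsupp_def)
  have D: "(u, v) \<in> D" if "f u \<noteq> 0" "g v \<noteq> 0" "pairing (T u v) \<phi> \<noteq> 0" for u v
  proof -
    from that obtain w where "\<phi> w \<noteq> 0" "T u v w \<noteq> 0"
      unfolding pairing_supp[OF fin] by (force dest: sum.not_neutral_contains_not_neutral)
    then show ?thesis using that by (auto simp: D_def)
  qed
  have eq: "ext2 T f g = ext1 (\<lambda>(u,v). T u v) (\<lambda>(u,v). f u * g v)"
    by (auto simp: ext1_def ext2_def case_prod_unfold)
  have "pairing (ext2 T f g) \<phi> = pairing (\<lambda>(u,v). f u * g v) (\<lambda>(u,v). pairing (T u v) \<phi>)"
    unfolding eq by (subst pairing_ext1[OF fin])
      (use loc in \<open>auto simp: case_prod_unfold\<close>)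
  also have "\<dots> = (\<Sum>(u,v)\<in>fst ` D \<times> snd ` D. f u * g v * pairing (T u v) \<phi>)"
    by (subst pairing_eq_sum'[where S = "fst ` D \<times> snd ` D"])
      (use finD D in \<open>force simp: case_prod_unfold\<close>)+
  also have "\<dots> = (\<Sum>u\<in>fst ` D. f u * pairing g (\<lambda>v. pairing (T u v) \<phi>))"
    unfolding sum.cartesian_product[symmetric]
  proof (rule sum.cong[OF refl])
    fix u assume u: "u \<in> fst ` D"
    then have "f u \<noteq> 0" by (auto simp: D_def)
    then have "pairing g (\<lambda>v. pairing (T u v) \<phi>) = (\<Sum>v\<in>snd ` D. g v * pairing (T u v) \<phi>)"
      using finD D by (intro pairing_eq_sum') (force simp: image_iff)+
    then show "(\<Sum>v\<in>snd ` D. f u * g v * pairing (T u v) \<phi>) = f u * pairing g (\<lambda>v. pairing (T u v) \<phi>)"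
      by (simp add: sum_distrib_left mult.assoc)
  qed
  also have "\<dots> = pairing f (\<lambda>u. pairing g (\<lambda>v. pairing (T u v) \<phi>))"
  proof (rule pairing_eq_sum'[symmetric])
    fix u assume u: "f u \<noteq> 0" "pairing g (\<lambda>v. pairing (T u v) \<phi>) \<noteq> 0"
    have "\<exists>v. g v \<noteq> 0 \<and> pairing (T u v) \<phi> \<noteq> 0"
    proof (rule ccontr)
      assume "\<not> ?thesis"
      then have "pairing g (\<lambda>v. pairing (T u v) \<phi>) = pairing g (\<lambda>v. 0)"
        by (intro pairing_cong) auto
      then show False using u by simp
    qed
    then obtain v where "g v \<noteq> 0" "pairing (T u v) \<phi> \<noteq> 0" by blast
    then show "u \<in> fst ` D" using D u by force
  qed (use finD in auto)
  finally show ?thesis .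
qed

lemma ext1_nonzero: "ext1 T f w \<noteq> 0 \<Longrightarrow> \<exists>u. f u \<noteq> 0 \<and> T u w \<noteq> 0"
  unfolding ext1_def by (erule Sum_any.not_neutral_obtains_not_neutral) (metis mult_zero_left mult_zero_right)

lemma ext2_nonzero: "ext2 T f g w \<noteq> 0 \<Longrightarrow> \<exists>u v. f u \<noteq> 0 \<and> g v \<noteq> 0 \<and> T u v w \<noteq> 0"
proof -
  assume "ext2 T f g w \<noteq> 0"
  then obtain x where "(case x of (u, v) \<Rightarrow> f u * g v * T u v w) \<noteq> 0"
    unfolding ext2_def by (rule Sum_any.not_neutral_obtains_not_neutral)
  then show ?thesis by (cases x) (auto, metis mult_zero_left mult_zero_right)
qed

text \<open>Coefficients are the values on the functionals \<open>mon 1 w\<close>; this yields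
  equality of representatives, not just of classes in the coinvariants.\<close>

lemma pairing_eqI: "(\<And>w. pairing f (mon 1 w) = pairing g (mon 1 w)) \<Longrightarrow> f = g"
  by (rule ext) (metis pairing_mon_right)


section \<open>Factorisations of a word at one letter\<close>

section \<open>Sums over the positions of a word\<close>

text \<open>A sum over all factorisations \<open>w = a @ x # b\<close>. List patterns replace index
  arithmetic and give the recursions over \<open>#\<close> and \<open>@\<close> on which the later
  inductions run.\<close>

definition splits :: "('b list \<Rightarrow> 'b \<Rightarrow> 'b list \<Rightarrow> 'k::field_char_0) \<Rightarrow> 'b list \<Rightarrow> 'k" where
  "splits f w = (\<Sum>i<length w. f (take i w) (w ! i) (drop (Suc i) w))"

lemma splits_Nil [simp]: "splits f [] = 0"
  by (simp add: splits_def)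

lemma splits_Cons [simp]: "splits f (x # w) = f [] x w + splits (\<lambda>a. f (x # a)) w"
  unfolding splits_def length_Cons sum.lessThan_Suc_shift by simp

lemma splits_cong: "(\<And>a x b. w = a @ x # b \<Longrightarrow> f a x b = g a x b) \<Longrightarrow> splits f w = splits g w"
  unfolding splits_def by (rule sum.cong) (auto simp: id_take_nth_drop[symmetric])

lemma splits_append: "splits f (u @ v) = splits (\<lambda>a x b. f a x (b @ v)) u + splits (\<lambda>a. f (u @ a)) v"
  by (induction u arbitrary: f) (simp_all add: add.assoc)

lemma splits_add: "splits (\<lambda>a x b. f a x b + g a x b) w = splits f w + splits g w"
  by (simp add: splits_def sum.distrib)

lemma splits_mult: "splits (\<lambda>a x b. c * f a x b) w = c * splits f w"
  by (simp add: splits_def sum_distrib_left)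

lemma splits_zero [simp]: "splits (\<lambda>a x b. 0) w = 0"
  by (simp add: splits_def)

lemma splits_sum: "splits (\<lambda>a x b. \<Sum>i\<in>I. f i a x b) w = (\<Sum>i\<in>I. splits (f i) w)"
  unfolding splits_def by (rule sum.swap)

lemma splits_nonzero: "splits f w \<noteq> 0 \<Longrightarrow> \<exists>a x b. w = a @ x # b \<and> f a x b \<noteq> 0"
  using splits_cong[of w f "\<lambda>a x b. 0"] by auto

lemma pairing_derm:
  assumes "finsupp \<phi>"
  shows "pairing (derm od q d w) \<phi> =
    splits (\<lambda>a x b. msgn (od \<and> wpar q a) * pairing (d x) (\<lambda>r. \<phi> (a @ r @ b))) w"
  unfolding derm_def splits_def using assms
  by (simp add: pairing_sum pairing_smult pairing_cat finsupp_pairing_append)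

section \<open>Duality between coinvariants and invariant functionals\<close>

section \<open>Coinvariants are dual to invariant functionals\<close>

lemma smult_mon [simp]: "smult c (mon d u) = mon (c * d) u"
  by (auto simp: mon_def smult_def fun_eq_iff)

text \<open>Common frame for the symmetric coinvariants and for those of products of cyclic words.
  Moves preserve \<open>deg\<close> and its fibres are finite, so an infinite combination decomposes
  into finite problems, one for each degree.\<close>

locale signed_moves =
  fixes mv :: "'b \<Rightarrow> 'k::field_char_0 \<Rightarrow> 'b \<Rightarrow> bool" and deg :: "'b \<Rightarrow> 'd"
  assumes move_deg: "mv u c v \<Longrightarrow> deg u = deg v"
    and finite_fibre: "finite {u. deg u = d}"
    and move_sign: "mv u c v \<Longrightarrow> c = 1 \<or> c = - 1"
begin

text \<open>A finite set containing every relation that contributes to the coefficient of w; its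
  middle factor lists the only possible signs.\<close>

definition near :: "'b \<Rightarrow> ('b \<times> 'k \<times> 'b) set" where
  "near w = {u. deg u = deg w} \<times> {1, - 1} \<times> {u. deg u = deg w}"

lemma finite_near: "finite (near w)"
  by (simp add: near_def finite_fibre)

definition rel :: "('b \<times> 'k \<times> 'b \<Rightarrow> 'k) \<Rightarrow> 'b \<Rightarrow> 'b \<times> 'k \<times> 'b \<Rightarrow> 'k" where
  "rel h w = (\<lambda>(u, c, v). if mv u c v then h (u, c, v) * (mon 1 u w - mon c v w) else 0)"

lemma rel_near: "rel h w x \<noteq> 0 \<Longrightarrow> x \<in> near w"
  using move_deg move_sign by (force simp: rel_def near_def mon_def split: prod.splits if_splits)

lemma rel_sum: "finite S \<Longrightarrow> near w \<subseteq> S \<Longrightarrow> Sum_any (rel h w) = sum (rel h w) S"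
  by (rule Sum_any.expand_superset) (use rel_near in auto)

lemma coinv_null_iff: "f \<in> coinv_null mv \<longleftrightarrow> (\<exists>h. \<forall>w. f w = sum (rel h w) (near w))"
  unfolding coinv_null_def mem_Collect_eq rel_def[symmetric]
  by (simp only: rel_sum[OF finite_near order_refl])

lemma coinv_null_add: 
  assumes "f \<in> coinv_null mv" "g \<in> coinv_null mv" shows "f + g \<in> coinv_null mv"
proof -
  from assms obtain h k where "\<forall>w. f w = sum (rel h w) (near w)" "\<forall>w. g w = sum (rel k w) (near w)"
    unfolding coinv_null_iff by blast
  moreover have "rel (\<lambda>x. h x + k x) w x = rel h w x + rel k w x" for w x
    by (auto simp: rel_def distrib_right split: prod.splits)
  ultimately have "\<forall>w. (f + g) w = sum (rel (\<lambda>x. h x + k x) w) (near w)"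
    by (simp add: sum.distrib)
  then show ?thesis unfolding coinv_null_iff by blast
qed

lemma coinv_null_smult: 
  assumes "f \<in> coinv_null mv" shows "smult a f \<in> coinv_null mv"
proof -
  from assms obtain h where "\<forall>w. f w = sum (rel h w) (near w)"
    unfolding coinv_null_iff by blast
  moreover have "rel (\<lambda>x. a * h x) w x = a * rel h w x" for w x
    by (auto simp: rel_def mult.assoc split: prod.splits)
  ultimately have "\<forall>w. (smult a f) w = sum (rel (\<lambda>x. a * h x) w) (near w)"
    by (simp add: smult_def sum_distrib_left)
  then show ?thesis unfolding coinv_null_iff by blast
qed

lemma coinv_null_diff: 
  assumes "f \<in> coinv_null mv" "g \<in> coinv_null mv" shows "f - g \<in> coinv_null mv"
proof -
  have "f - g = f + smult (- 1) g" by (auto simp: smult_def)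
  then show ?thesis using coinv_null_add coinv_null_smult assms by metis
qed

lemma coinv_null_zero: "0 \<in> coinv_null mv"
  unfolding coinv_null_iff by (rule exI[of _ "\<lambda>x. 0"]) (auto simp: rel_def intro!: sum.neutral)

lemma coinv_null_move:
  assumes "mv u c v" shows "mon 1 u - mon c v \<in> coinv_null mv"
proof -
  let ?h = "\<lambda>x. if x = (u, c, v) then 1 else 0 :: 'k"
  have "sum (rel ?h w) (near w) = mon 1 u w - mon c v w" for w
  proof -
    have "sum (rel ?h w) (near w) = sum (rel ?h w) (insert (u,c,v) (near w))"
      by (rule sum.mono_neutral_left) (use finite_near rel_near[of ?h w] in blast)+
    also have "\<dots> = sum (rel ?h w) {(u,c,v)}"
      by (rule sum.mono_neutral_right) (use finite_near in \<open>auto simp: rel_def split: if_splits\<close>)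
    finally show ?thesis using assms by (simp add: rel_def)
  qed
  then show ?thesis unfolding coinv_null_iff by (intro exI[of _ ?h]) simp
qed

text \<open>The coefficients found for the various degrees are glued by taking \<open>h\<close> at
  the degree of the source of a relation, which is also the degree of its target.\<close>

lemma coinv_null_local:
  assumes "\<And>d. (\<lambda>w. if deg w = d then f w else 0) \<in> coinv_null mv"
  shows "f \<in> coinv_null mv"
proof -
  from assms obtain h where h: "\<And>d w. (if deg w = d then f w else 0) = sum (rel (h d) w) (near w)"
    unfolding coinv_null_iff by metis
  have "f w = sum (rel (\<lambda>(u,c,v). h (deg u) (u,c,v)) w) (near w)" for w
  proof -
    have "f w = sum (rel (h (deg w)) w) (near w)" using h[of w "deg w"] by simp
    also have "\<dots> = sum (rel (\<lambda>(u,c,v). h (deg u) (u,c,v)) w) (near w)"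
      by (rule sum.cong) (auto simp: rel_def near_def)
    finally show ?thesis .
  qed
  then show ?thesis unfolding coinv_null_iff by blast
qed

definition invariant :: "('b \<Rightarrow> 'k) \<Rightarrow> bool" where
  "invariant \<phi> \<longleftrightarrow> (\<forall>u c v. mv u c v \<longrightarrow> \<phi> u = c * \<phi> v)"

text \<open>Of an infinite combination of relations u - c v only the finitely many near the support
  of \<phi> are seen by \<phi>, and each of these is killed by invariance.\<close>

lemma pairing_coinv_null:
  assumes f: "f \<in> coinv_null mv" and fin: "finsupp \<phi>" and inv: "invariant \<phi>"
  shows "pairing f \<phi> = 0"
proof -
  let ?S = "{w. \<phi> w \<noteq> 0}"
  define D where "D = (\<Union>w\<in>?S. near w)"
  have finD: "finite D" using fin finite_near by (auto simp: D_def finsupp_def)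
  from f obtain h where h: "\<And>w. f w = Sum_any (rel h w)"
    unfolding coinv_null_def rel_def by blast
  have "pairing f \<phi> = (\<Sum>w\<in>?S. sum (rel h w) D * \<phi> w)"
    unfolding pairing_supp[OF fin]
    by (rule sum.cong[OF refl], subst h, subst rel_sum[OF finD]) (auto simp: D_def)
  also have "\<dots> = (\<Sum>x\<in>D. \<Sum>w\<in>?S. rel h w x * \<phi> w)"
    unfolding sum_distrib_right by (rule sum.swap)
  also have "\<dots> = 0"
  proof (rule sum.neutral, rule ballI)
    fix x assume "x \<in> D"
    obtain u c v where x: "x = (u, c, v)" by (cases x)
    have "(\<Sum>w\<in>?S. rel h w x * \<phi> w) = (if mv u c v then h x * pairing (mon 1 u - mon c v) \<phi> else 0)"
      unfolding pairing_supp[OF fin] by (simp add: x rel_def sum_distrib_left mult.assoc)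
    also have "\<dots> = 0" using inv fin by (auto simp: pairing_diff invariant_def)
    finally show "(\<Sum>w\<in>?S. rel h w x * \<phi> w) = 0" .
  qed
  finally show ?thesis .
qed

text \<open>In one degree, take a representative of \<open>f\<close> of minimal support and a monomial \<open>r\<close> in it.  By minimality
  \<open>r\<close> is not null, so sending the monomials congruent to \<open>\<plusminus>r\<close> to \<open>\<plusminus>1\<close> is a well-defined invariant functional;
  as it kills \<open>f\<close>, a second such monomial occurs and can be eliminated.\<close>

theorem coinv_null_dual:
  assumes f: "\<And>\<phi>. finsupp \<phi> \<Longrightarrow> invariant \<phi> \<Longrightarrow> pairing f \<phi> = 0"
  shows "f \<in> coinv_null mv"
proof (rule coinv_null_local)
  fix d
  let ?N = "coinv_null mv"
  define fd where "fd = (\<lambda>w. if deg w = d then f w else 0)"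
  define Q where "Q n \<longleftrightarrow> (\<exists>g. card {w. g w \<noteq> 0} = n \<and> (\<forall>w. g w \<noteq> 0 \<longrightarrow> deg w = d) \<and> fd - g \<in> ?N)" for n
  have "Q (card {w. fd w \<noteq> 0})"
    unfolding Q_def by (rule exI[of _ fd]) (auto simp: fd_def coinv_null_zero)
  then have "Q (LEAST n. Q n)" by (rule LeastI)
  then obtain g where g: "card {w. g w \<noteq> 0} = (LEAST n. Q n)" "\<And>w. g w \<noteq> 0 \<Longrightarrow> deg w = d" "fd - g \<in> ?N"
    unfolding Q_def by blast
  have fing: "finite {w. g w \<noteq> 0}"
    by (rule finite_subset[OF _ finite_fibre[of d]]) (use g(2) in auto)
  have smaller: False
    if k: "k \<in> ?N" and gw: "g w \<noteq> 0" and kw: "g w = k w" and supp: "\<And>v. g v = 0 \<Longrightarrow> k v = 0" for k w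
  proof -
    have "{v. (g - k) v \<noteq> 0} \<subset> {v. g v \<noteq> 0}"
    proof
      show "{v. (g - k) v \<noteq> 0} \<subseteq> {v. g v \<noteq> 0}" using supp by force
      show "{v. (g - k) v \<noteq> 0} \<noteq> {v. g v \<noteq> 0}" using gw kw by force
    qed
    then have "card {v. (g - k) v \<noteq> 0} < (LEAST n. Q n)"
      unfolding g(1)[symmetric] by (rule psubset_card_mono[OF fing])
    moreover have "Q (card {v. (g - k) v \<noteq> 0})"
      unfolding Q_def
    proof (intro exI conjI)
      show "fd - (g - k) \<in> ?N" using coinv_null_add[OF g(3) k] by (simp add: algebra_simps)
      show "\<forall>v. (g - k) v \<noteq> 0 \<longrightarrow> deg v = d" using g(2) supp by force
    qed simp
    ultimately show False using not_less_Least by blast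
  qed
  have "g = 0"
  proof (rule ccontr)
    assume "g \<noteq> 0"
    then obtain r where r: "g r \<noteq> 0" by (auto simp: fun_eq_iff)
    define R where "R u s \<longleftrightarrow> deg u = d \<and> mon 1 u - mon s r \<in> ?N" for u s
    have noN: "mon a r \<notin> ?N" if "a \<noteq> 0" for a
    proof
      assume "mon a r \<in> ?N"
      from coinv_null_smult[OF this, of "g r / a"] have "mon (g r) r \<in> ?N" using that by simp
      then show False by (rule smaller[where w = r]) (use r in \<open>auto simp: mon_def\<close>)
    qed
    \<comment> \<open>Both congruences together would make 2r null, which in characteristic zero
      contradicts \<open>noN\<close>.\<close>
    have unique: "\<not> (R u 1 \<and> R u (- 1))" for u
    proof
      assume "R u 1 \<and> R u (- 1)"
      then have "(mon 1 u - mon (- 1) r) - (mon 1 u - mon 1 r) \<in> ?N"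
        unfolding R_def using coinv_null_diff by blast
      moreover have "(mon 1 u - mon (- 1) r) - (mon 1 u - mon 1 r) = mon (2::'k) r"
        by (auto simp: mon_def)
      ultimately show False using noN[of 2] by simp
    qed
    have step: "R v (c * s)" if "R u s" "mv u c v" for u v c s
    proof -
      have "smult c (mon 1 u - mon s r) - smult c (mon 1 u - mon c v) \<in> ?N"
        using that unfolding R_def
        by (blast intro: coinv_null_move coinv_null_smult coinv_null_diff)
      moreover have "smult c (mon 1 u - mon s r) - smult c (mon 1 u - mon c v) = mon 1 v - mon (c * s) r"
        using move_sign[OF that(2)] by (auto simp: smult_def mon_def)
      ultimately show ?thesis using that move_deg unfolding R_def by metis
    qed
    have step': "R u (c * s)" if "R v s" "mv u c v" for u v c s
    proof -
      have "smult c (mon 1 v - mon s r) + (mon 1 u - mon c v) \<in> ?N"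
        using that unfolding R_def
        by (blast intro: coinv_null_move coinv_null_smult coinv_null_add)
      moreover have "smult c (mon 1 v - mon s r) + (mon 1 u - mon c v) = mon 1 u - mon (c * s) r"
        by (auto simp: smult_def mon_def algebra_simps)
      ultimately show ?thesis using that move_deg unfolding R_def by metis
    qed
    define \<phi> where "\<phi> u = (if R u 1 then 1 else if R u (- 1) then - 1 else 0 :: 'k)" for u
    have fin: "finsupp \<phi>"
      by (rule finsupp_bounded[OF finite_fibre[of d]]) (auto simp: \<phi>_def R_def split: if_splits)
    have inv: "invariant \<phi>"
      unfolding invariant_def
    proof (intro allI impI)
      fix u c v assume mv: "mv u c v"
      have "R u 1 \<longleftrightarrow> R v c" "R u (- 1) \<longleftrightarrow> R v (- c)"
        using step[OF _ mv, of 1] step'[OF _ mv, of c] step[OF _ mv, of "- 1"] step'[OF _ mv, of "- c"]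
          move_sign[OF mv] by auto
      then show "\<phi> u = c * \<phi> v"
        using move_sign[OF mv] unique[of u] unique[of v] by (auto simp: \<phi>_def)
    qed
    have "pairing f \<phi> = pairing fd \<phi>"
      unfolding pairing_supp[OF fin] by (rule sum.cong) (auto simp: fd_def \<phi>_def R_def split: if_splits)
    then have "pairing g \<phi> = 0"
      using f[OF fin inv] pairing_coinv_null[OF g(3) fin inv] fin by (simp add: pairing_diff)
    then have "(\<Sum>u | \<phi> u \<noteq> 0. g u * \<phi> u) = 0" by (simp add: pairing_supp fin)
    moreover have "R r 1" using g(2) r coinv_null_zero by (simp add: R_def)
    then have "\<phi> r = 1" by (simp add: \<phi>_def)
    ultimately have "(\<Sum>u \<in> {u. \<phi> u \<noteq> 0} - {r}. g u * \<phi> u) \<noteq> 0"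
      using r fin by (auto simp: sum.remove[of _ r] finsupp_def)
    then obtain u where "u \<in> {u. \<phi> u \<noteq> 0} - {r}" "g u * \<phi> u \<noteq> 0"
      by (rule sum.not_neutral_contains_not_neutral)
    then have u: "u \<noteq> r" "\<phi> u \<noteq> 0" "g u \<noteq> 0" by auto
    then have "R u (\<phi> u)" by (auto simp: \<phi>_def split: if_splits)
    then have "smult (g u) (mon 1 u - mon (\<phi> u) r) \<in> ?N" unfolding R_def by (intro coinv_null_smult) auto
    then show False
      by (rule smaller[where w = u]) (use u r in \<open>auto simp: smult_def mon_def\<close>)
  qed
  then show "(\<lambda>w. if deg w = d then f w else 0) \<in> ?N" using g(3) by (simp add: fd_def)
qed

end

section \<open>Koszul signs of block permutations\<close>

section \<open>Koszul signs of rearrangements of intervals\<close>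

lemma msgn_mult: "msgn a * msgn b = (msgn (a \<noteq> b) :: 'k::comm_ring_1)"
  by (auto simp: msgn_def)

lemma msgn_mult_left: "msgn a * (msgn b * c) = (msgn (a \<noteq> b) * c :: 'k::comm_ring_1)"
  by (auto simp: msgn_def)

lemma msgn_False [simp]: "msgn False = 1"
  by (simp add: msgn_def)

lemma msgn_cases: "msgn b = (1::'k::comm_ring_1) \<or> msgn b = (- 1 :: 'k)"
  by (simp add: msgn_def)

lemma wpar_Nil [simp]: "wpar p [] \<longleftrightarrow> False"
  and wpar_Cons [simp]: "wpar p (x # w) \<longleftrightarrow> (p x \<noteq> wpar p w)"
  and wpar_append [simp]: "wpar p (u @ v) \<longleftrightarrow> (wpar p u \<noteq> wpar p v)"
  by (auto simp: wpar_def)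

lemma wpar_map: "wpar p (map f w) = wpar (\<lambda>x. p (f x)) w"
  by (induction w) auto

lemma wpar_upt:
  assumes "i \<le> j" "j \<le> length xs"
  shows "wpar (\<lambda>k. q (xs ! k)) [i..<j] = wpar q (drop i (take j xs))"
proof -
  have "drop i (take j xs) = map ((!) xs) [i..<j]"
    using assms by (auto intro!: nth_equalityI)
  then show ?thesis by (simp add: wpar_map)
qed

primrec cross :: "(nat \<Rightarrow> bool) \<Rightarrow> nat list \<Rightarrow> nat list \<Rightarrow> 'k::field_char_0" where
  "cross Q [] qs = 1"
| "cross Q (k # ps) qs = msgn (Q k \<and> wpar Q (filter (\<lambda>i. i < k) qs)) * cross Q ps qs"

text \<open>\<open>invsgn\<close> is the Koszul sign of a list of positions, computed recursively; \<open>cross\<close> counts only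
  the inversions between two lists.\<close>

primrec invsgn :: "(nat \<Rightarrow> bool) \<Rightarrow> nat list \<Rightarrow> 'k::field_char_0" where
  "invsgn Q [] = 1"
| "invsgn Q (k # ps) = msgn (Q k \<and> wpar Q (filter (\<lambda>i. i < k) ps)) * invsgn Q ps"

lemma prod_msgn_filter:
  "(\<Prod>s\<in>{s. s < length ps \<and> ps ! s < k}. msgn (c \<and> Q (ps ! s)))
    = (msgn (c \<and> wpar Q (filter (\<lambda>i. i < k) ps)) :: 'k::field_char_0)"
proof (induction ps rule: rev_induct)
  case (snoc x ps)
  let ?A = "{s. s < length ps \<and> ps ! s < k}"
  let ?L = "{s. s < length (ps @ [x]) \<and> (ps @ [x]) ! s < k}"
  let ?f = "\<lambda>s. msgn (c \<and> Q ((ps @ [x]) ! s)) :: 'k"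
  have set: "?L = (if x < k then insert (length ps) ?A else ?A)"
    by (auto simp: nth_append less_Suc_eq)
  have "prod ?f ?L = (if x < k then msgn (c \<and> Q x) else 1) * prod ?f ?A"
    unfolding set by simp
  also have "prod ?f ?A = (\<Prod>s\<in>?A. msgn (c \<and> Q (ps ! s)))"
    by (rule prod.cong) (auto simp: nth_append)
  also have "\<dots> = msgn (c \<and> wpar Q (filter (\<lambda>i. i < k) ps))" by (rule snoc)
  also have "(if x < k then msgn (c \<and> Q x) else 1) * \<dots> = (msgn (c \<and> wpar Q (filter (\<lambda>i. i < k) (ps @ [x]))) :: 'k)"
    by (auto simp: msgn_def)
  finally show ?case .
qed simp

text \<open>The inversions that involve the first position are those counted by the head of the
  recursion; all others are inversions of the tail.\<close>

lemma koszul_eq_invsgn: "koszul q xs ps = (invsgn (\<lambda>i. q (xs ! i)) ps :: 'k::field_char_0)"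
proof (induction ps)
  case Nil
  then show ?case by (simp add: koszul_def)
next
  case (Cons k ps)
  let ?P = "{(r, s). r < s \<and> s < length ps \<and> ps ! s < ps ! r}"
  let ?A = "{s. s < length ps \<and> ps ! s < k}"
  let ?f = "\<lambda>(r, s). msgn (q (xs ! ((k # ps) ! r)) \<and> q (xs ! ((k # ps) ! s))) :: 'k"
  have finP: "finite ?P" by (rule finite_subset[of _ "{..<length ps} \<times> {..<length ps}"]) auto
  have set: "{(r, s). r < s \<and> s < length (k # ps) \<and> (k # ps) ! s < (k # ps) ! r} =
      (\<lambda>s. (0, Suc s)) ` ?A \<union> (\<lambda>(r, s). (Suc r, Suc s)) ` ?P"  (is "?L = ?R")
  proof
    show "?L \<subseteq> ?R"
    proof clarify
      fix r s assume *: "r < s" "s < length (k # ps)" "(k # ps) ! s < (k # ps) ! r"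
        "(r, s) \<notin> (\<lambda>(r, s). (Suc r, Suc s)) ` ?P"
      then obtain s' where s: "s = Suc s'" by (cases s) auto
      show "(r, s) \<in> (\<lambda>s. (0, Suc s)) ` ?A"
        using * s by (cases r) (auto simp: image_iff)
    qed
  qed auto
  have "koszul q xs (k # ps) = prod ?f ?L"
    by (simp add: koszul_def)
  also have "\<dots> = prod ?f ((\<lambda>s. (0, Suc s)) ` ?A) * prod ?f ((\<lambda>(r, s). (Suc r, Suc s)) ` ?P)"
    unfolding set using finP by (intro prod.union_disjoint) auto
  also have "prod ?f ((\<lambda>s. (0, Suc s)) ` ?A) = (\<Prod>s\<in>?A. msgn (q (xs ! k) \<and> q (xs ! (ps ! s))))"
    by (subst prod.reindex) (auto simp: inj_on_def)
  also have "prod ?f ((\<lambda>(r, s). (Suc r, Suc s)) ` ?P) = koszul q xs ps"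
    unfolding koszul_def by (subst prod.reindex) (auto simp: inj_on_def intro!: prod.cong)
  finally show ?case using Cons by (simp add: prod_msgn_filter[where Q = "\<lambda>i. q (xs ! i)"])
qed

lemma invsgn_append: "invsgn Q (ps @ qs) = cross Q ps qs * invsgn Q ps * invsgn Q qs"
  by (induction ps) (auto simp: msgn_def)

lemma cross_append_left: "cross Q (ps @ ps') qs = cross Q ps qs * cross Q ps' qs"
  by (induction ps) (auto simp: mult_ac)

lemma cross_append_right: "cross Q ps (qs @ qs') = cross Q ps qs * cross Q ps qs'"
  by (induction ps) (auto simp: msgn_def)

lemma cross_greater: 
  "(\<And>k l. k \<in> set ps \<Longrightarrow> l \<in> set qs \<Longrightarrow> l < k) \<Longrightarrow> cross Q ps qs = msgn (wpar Q ps \<and> wpar Q qs)"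
proof (induction ps)
  case (Cons k ps)
  have "filter (\<lambda>i. i < k) qs = qs" using Cons.prems by (auto simp: filter_id_conv)
  with Cons show ?case by (auto simp: msgn_def)
qed simp

lemma cross_less: "(\<And>k l. k \<in> set ps \<Longrightarrow> l \<in> set qs \<Longrightarrow> k \<le> l) \<Longrightarrow> cross Q ps qs = 1"
proof (induction ps)
  case (Cons k ps)
  have "filter (\<lambda>i. i < k) qs = []" using Cons.prems by (force simp: filter_empty_conv)
  with Cons show ?case by auto
qed simp

lemma cross_upt_greater: "b' \<le> a \<Longrightarrow> cross Q [a..<b] [a'..<b'] = msgn (wpar Q [a..<b] \<and> wpar Q [a'..<b'])"
  by (rule cross_greater) auto

lemma cross_upt_less: "b \<le> a' \<Longrightarrow> cross Q [a..<b] [a'..<b'] = 1"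
  by (rule cross_less) auto

lemma invsgn_sorted: "sorted ps \<Longrightarrow> invsgn Q ps = 1"
proof (induction ps)
  case (Cons k ps)
  have "filter (\<lambda>i. i < k) ps = []" using Cons.prems by (force simp: filter_empty_conv)
  with Cons show ?case by auto
qed simp

lemma invsgn_upt [simp]: "invsgn Q [a..<b] = 1"
  by (rule invsgn_sorted) simp

lemma koszul_cases: "koszul q xs ps = (1::'k::field_char_0) \<or> koszul q xs ps = (- 1 :: 'k)"
proof -
  have "invsgn Q ps = (1::'k) \<or> invsgn Q ps = (- 1 :: 'k)" for Q
    by (induction ps) (auto simp: msgn_def)
  then show ?thesis by (simp add: koszul_eq_invsgn)
qed

text \<open>A permutation of consecutive blocks is a concatenation of intervals of positions. These
  rules reduce its sign to the crossings of pairs of blocks, and each crossing to the parities of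
  two blocks.\<close>

lemmas interval_signs =
  koszul_eq_invsgn invsgn_append cross_append_left cross_append_right cross_upt_greater cross_upt_less
  msgn_mult msgn_mult_left

lemma upt_singleton: "[k] = [k..<Suc k]"
  by simp

lemma wpar_segment:
  "wpar (\<lambda>k. q ((u @ v @ w) ! k)) [length u..<length u + length v] = wpar q v"
  by (subst wpar_upt) auto

lemma koszul_rotate:
  "koszul p (u @ v) ([length u..<length (u @ v)] @ [0..<length u]) =
    (msgn (wpar p v \<and> wpar p u) :: 'k::field_char_0)"
  using wpar_segment[of p u v "[]"] wpar_segment[of p "[]" u v]
  by (simp add: koszul_eq_invsgn invsgn_append cross_upt_greater)

lemma koszul_swap:
  "koszul p (a @ x # y # b) ([0..<length a] @ [Suc (length a)] @ [length a] @ [Suc (Suc (length a))..<length (a @ x # y # b)]) =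
    (msgn (p y \<and> p x) :: 'k::field_char_0)"
  unfolding upt_singleton using wpar_segment[of p a "[x]" "y # b"] wpar_segment[of p "a @ [x]" "[y]" b]
  by (simp add: interval_signs del: upt_Suc)

lemma front_pair:
  assumes "i < j" "j < n"
  shows "front n [i, j] = [i] @ [j] @ [0..<i] @ [Suc i..<j] @ [Suc j..<n]"
proof -
  have "[0..<n] = [0..<i] @ [i] @ [Suc i..<j] @ [j] @ [Suc j..<n]"
    by (rule sorted_distinct_set_unique) (use assms in \<open>auto simp: sorted_append\<close>)
  then show ?thesis using assms by (simp add: front_def filter_empty_conv)
qed

text \<open>The letter x passes a, and y passes a and b but not x, which stays ahead of it.\<close>

lemma koszul_front:
  "koszul p (a @ x # b @ y # c) (front (length (a @ x # b @ y # c)) [length a, Suc (length a + length b)]) =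
    (msgn ((p x \<and> wpar p a) \<noteq> (p y \<and> (wpar p a \<noteq> wpar p b))) :: 'k::field_char_0)"
proof -
  let ?i = "length a" and ?j = "Suc (length a + length b)" and ?w = "a @ x # b @ y # c"
  have *: "front (length ?w) [?i, ?j] =
    [?i..<Suc ?i] @ [?j..<Suc ?j] @ [0..<?i] @ [Suc ?i..<?j] @ [Suc ?j..<length ?w]"
    by (subst front_pair) auto
  have "koszul p ?w (front (length ?w) [?i, ?j]) =
      (msgn ((p x \<and> wpar p a) = ((p y \<and> wpar p a) = (p y \<and> wpar p b))) :: 'k)"
    unfolding *
    using wpar_segment[of p "[]" a "x # b @ y # c"] wpar_segment[of p a "[x]" "b @ y # c"]
      wpar_segment[of p "a @ [x]" b "y # c"] wpar_segment[of p "a @ x # b" "[y]" c]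
    by (simp add: interval_signs del: upt_Suc)
  also have "((p x \<and> wpar p a) = ((p y \<and> wpar p a) = (p y \<and> wpar p b))) \<longleftrightarrow>
      ((p x \<and> wpar p a) \<noteq> (p y \<and> (wpar p a \<noteq> wpar p b)))"
    by auto
  finally show ?thesis .
qed

lemma nths_remove_two:
  "nths (a @ x # b @ y # c) (- {length a, Suc (length a + length b)}) = a @ b @ c"
  by (simp add: nths_append nths_Cons nths_all)

section \<open>Symmetric invariance from adjacent transpositions\<close>

definition sinv :: "('b \<Rightarrow> bool) \<Rightarrow> ('b list \<Rightarrow> 'k::field_char_0) \<Rightarrow> bool" where
  "sinv p \<phi> \<longleftrightarrow> (\<forall>a x y b. \<phi> (a @ x # y # b) = msgn (p x \<and> p y) * \<phi> (a @ y # x # b))"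

lemma sinvD: "sinv p \<phi> \<Longrightarrow> \<phi> (a @ x # y # b) = msgn (p x \<and> p y) * \<phi> (a @ y # x # b)"
  unfolding sinv_def by blast

lemma sinv_append_left: "sinv p \<phi> \<Longrightarrow> sinv p (\<lambda>t. \<phi> (s @ t))"
  unfolding sinv_def by (metis append_assoc)

lemma sinv_append_right: "sinv p \<phi> \<Longrightarrow> sinv p (\<lambda>t. \<phi> (t @ s))"
  unfolding sinv_def by (metis append_assoc append_Cons)

lemma sinv_Cons: "sinv p \<phi> \<Longrightarrow> sinv p (\<lambda>t. \<phi> (x # t))"
  using sinv_append_left[of p \<phi> "[x]"] by simp

lemma sinv_letter:
  assumes "sinv p \<phi>"
  shows "\<phi> (a @ x # u @ b) = msgn (p x \<and> wpar p u) * \<phi> (a @ u @ x # b)"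
proof (induction u arbitrary: a)
  case (Cons y u)
  have "\<phi> (a @ x # y # u @ b) = msgn (p x \<and> p y) * \<phi> ((a @ [y]) @ x # u @ b)"
    using sinvD[OF assms, of a x y "u @ b"] by simp
  also have "\<dots> = msgn (p x \<and> p y) * (msgn (p x \<and> wpar p u) * \<phi> (a @ y # u @ x # b))"
    using Cons[of "a @ [y]"] by simp
  finally show ?case by (auto simp: msgn_def)
qed simp

lemma sinv_swap:
  assumes "sinv p \<phi>"
  shows "\<phi> (a @ u @ v @ b) = msgn (wpar p u \<and> wpar p v) * \<phi> (a @ v @ u @ b)"
proof (induction u arbitrary: a b)
  case (Cons x u)
  have "\<phi> (a @ x # u @ v @ b) = msgn (wpar p u \<and> wpar p v) * \<phi> (a @ x # v @ u @ b)"
    using Cons[of "a @ [x]"] by simp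
  also have "\<phi> (a @ x # v @ u @ b) = msgn (p x \<and> wpar p v) * \<phi> (a @ v @ x # u @ b)"
    by (rule sinv_letter[OF assms])
  finally show ?case by (auto simp: msgn_def)
qed simp

text \<open>Inserting k into a sorted list carries it past exactly the smaller entries, and each
  adjacent transposition costs its Koszul sign.\<close>

lemma sinv_insort:
  assumes "sinv p \<phi>" "sorted l"
  shows "\<phi> (map f (insort k l)) = msgn (p (f k) \<and> wpar (\<lambda>i. p (f i)) (filter (\<lambda>i. i < k) l)) * \<phi> (map f (k # l))"
  using assms
proof (induction l arbitrary: \<phi>)
  case (Cons x l)
  show ?case
  proof (cases "k \<le> x")
    case True
    then have "filter (\<lambda>i. i < k) (x # l) = []" using Cons.prems by (force simp: filter_empty_conv)
    then show ?thesis using True by simp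
  next
    case False
    have "\<phi> (f x # map f (insort k l)) =
        msgn (p (f k) \<and> wpar (\<lambda>i. p (f i)) (filter (\<lambda>i. i < k) l)) * \<phi> (f x # f k # map f l)"
      using Cons.IH[OF sinv_Cons[OF Cons.prems(1)]] Cons.prems by simp
    also have "\<phi> (f x # f k # map f l) = msgn (p (f x) \<and> p (f k)) * \<phi> (f k # f x # map f l)"
      using sinvD[OF Cons.prems(1), of "[]" "f x" "f k" "map f l"] by simp
    finally show ?thesis using False by (auto simp: msgn_def not_le)
  qed
qed simp

text \<open>Insertion sort writes an arbitrary permutation as a product of adjacent transpositions,
  and the collected sign obeys the recursion of \<open>invsgn\<close>.\<close>

lemma sinv_sort:
  assumes "sinv p \<phi>"
  shows "\<phi> (map f (sort ps)) = invsgn (\<lambda>i. p (f i)) ps * \<phi> (map f ps)"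
  using assms
proof (induction ps arbitrary: \<phi>)
  case (Cons k ps)
  have "filter (\<lambda>i. i < k) (sort ps) = sort (filter (\<lambda>i. i < k) ps)" by (simp add: filter_sort)
  moreover have "wpar Q (sort qs) = wpar Q qs" for Q and qs :: "nat list"
    unfolding wpar_def by (simp add: filter_sort)
  ultimately have "wpar Q (filter (\<lambda>i. i < k) (sort ps)) = wpar Q (filter (\<lambda>i. i < k) ps)" for Q
    by simp
  then show ?case
    using sinv_insort[OF Cons.prems, of "sort ps" f k] Cons.IH[OF sinv_Cons[OF Cons.prems], of "f k"]
    by (simp add: mult.assoc)
qed simp

lemma sinv_sym_move:
  assumes "sinv p \<phi>" "sym_move p u c v"
  shows "\<phi> u = c * \<phi> v"
proof -
  from assms(2) obtain ps where ps: "ps \<in> permutations_of_set {..<length u}"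
    and c: "c = koszul p u ps" and v: "v = map ((!) u) ps"
    unfolding sym_move_def by blast
  have "sort ps = [0..<length u]"
    using permutations_of_setD[OF ps]
    by (intro sorted_distinct_set_unique) (simp_all add: atLeast0LessThan)
  then have "\<phi> (map ((!) u) [0..<length u]) = c * \<phi> v"
    using sinv_sort[OF assms(1), of "(!) u" ps] by (simp add: c v koszul_eq_invsgn)
  then show ?thesis by (simp add: map_nth)
qed

lemma sym_move_swap: "sym_move p (a @ x # y # b) (msgn (p x \<and> p y) :: 'k::field_char_0) (a @ y # x # b)"
proof -
  let ?u = "a @ x # y # b" and ?i = "length a"
  let ?ps = "[0..<?i] @ [Suc ?i] @ [?i] @ [Suc (Suc ?i)..<length ?u]"
  have set: "set ?ps = {..<length ?u}" by auto
  have dist: "distinct ?ps" by auto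
  have ps: "?ps \<in> permutations_of_set {..<length ?u}"
    unfolding permutations_of_set_def using set dist by blast
  have "map ((!) ?u) [0..<?i] = a" by (rule nth_equalityI) (auto simp: nth_append)
  moreover have "map ((!) ?u) [Suc (Suc ?i)..<length ?u] = b"
    by (rule nth_equalityI) (auto simp: nth_append simp del: upt_Suc)
  ultimately have "map ((!) ?u) ?ps = a @ y # x # b" by (simp add: nth_append del: upt_Suc)
  moreover have "koszul p ?u ?ps = (msgn (p x \<and> p y) :: 'k)"
    using koszul_swap[of p a x y b] by (simp add: conj_commute)
  ultimately show ?thesis unfolding sym_move_def using ps by metis
qed

lemma sym_move_mset: "sym_move p u c v \<Longrightarrow> mset v = mset u"
proof -
  assume "sym_move p u c v"
  then obtain ps where ps: "ps \<in> permutations_of_set {..<length u}" and v: "v = map ((!) u) ps"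
    unfolding sym_move_def by blast
  have "set ps = set [0..<length u]" using permutations_of_setD(1)[OF ps] by (simp add: atLeast0LessThan)
  then have "mset ps = mset [0..<length u]"
    using permutations_of_setD(2)[OF ps] by (metis distinct_upt mset_set_set)
  then have "mset v = mset (map ((!) u) [0..<length u])" by (simp add: v del: mset_upt)
  then show ?thesis by (simp add: map_nth)
qed

lemma finite_mset_fibre: "finite {u. mset u = M}"
proof (rule finite_subset)
  show "{u. mset u = M} \<subseteq> {u. set u \<subseteq> set_mset M \<and> length u = size M}" by auto
qed (simp add: finite_lists_length_eq)

interpretation sym: signed_moves "sym_move p :: 'b list \<Rightarrow> 'k::field_char_0 \<Rightarrow> 'b list \<Rightarrow> bool" mset
  for p
proof
  show "sym_move p u c v \<Longrightarrow> mset u = mset v" for u v :: "'b list" and c :: 'k by (simp add: sym_move_mset)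
  show "sym_move p u c v \<Longrightarrow> c = 1 \<or> c = - 1" for u v :: "'b list" and c :: 'k
    unfolding sym_move_def using koszul_cases by blast
qed (rule finite_mset_fibre)

text \<open>Adjacent transpositions are moves and generate all of them with the right signs, so the
  condition convenient for inductions is full invariance.\<close>

lemma sym_invariant_iff: "sym.invariant p \<phi> \<longleftrightarrow> sinv p \<phi>"
proof
  assume *: "sym.invariant p \<phi>"
  show "sinv p \<phi>"
    unfolding sinv_def by (intro allI *[unfolded sym.invariant_def, rule_format] sym_move_swap)
next
  assume *: "sinv p \<phi>"
  show "sym.invariant p \<phi>"
    unfolding sym.invariant_def by (intro allI impI sinv_sym_move[OF *])
qed

lemma sym_eqI:
  "(\<And>\<phi>. finsupp \<phi> \<Longrightarrow> sinv p \<phi> \<Longrightarrow> pairing f \<phi> = pairing g \<phi>) \<Longrightarrow> sym_eq p f g"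
  unfolding sym_eq_def by (rule sym.coinv_null_dual) (auto simp: pairing_diff sym_invariant_iff)

lemma sym_eqD: "sym_eq p f g \<Longrightarrow> finsupp \<phi> \<Longrightarrow> sinv p \<phi> \<Longrightarrow> pairing f \<phi> = pairing g \<phi>"
  unfolding sym_eq_def using sym.pairing_coinv_null[of "f - g" p \<phi>]
  by (simp add: pairing_diff sym_invariant_iff)

section \<open>Invariance under rotations and exchanges of cyclic words\<close>

definition cinv :: "('x \<Rightarrow> bool) \<Rightarrow> ('x list \<Rightarrow> 'k::field_char_0) \<Rightarrow> bool" where
  "cinv p \<phi> \<longleftrightarrow> (\<forall>u v. \<phi> (u @ v) = msgn (wpar p u \<and> wpar p v) * \<phi> (v @ u))"

definition nc_inv :: "('x \<Rightarrow> bool) \<Rightarrow> ('x list list \<Rightarrow> 'k::field_char_0) \<Rightarrow> bool" where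
  "nc_inv p \<phi> \<longleftrightarrow> sinv (wpar p) \<phi> \<and> (\<forall>U V. cinv p (\<lambda>w. \<phi> (U @ w # V)))"

lemma cinvD: "cinv p \<phi> \<Longrightarrow> \<phi> (u @ v) = msgn (wpar p u \<and> wpar p v) * \<phi> (v @ u)"
  unfolding cinv_def by blast

lemma nc_inv_rotate:
  "nc_inv p \<phi> \<Longrightarrow> \<phi> (U @ (u @ v) # V) = msgn (wpar p u \<and> wpar p v) * \<phi> (U @ (v @ u) # V)"
  unfolding nc_inv_def by (blast dest: cinvD[of p "\<lambda>w. \<phi> (U @ w # V)"])

lemma cyc_move_iff:
  "cyc_move p w (c :: 'k::field_char_0) w' \<longleftrightarrow>
    (\<exists>u v. w = u @ v \<and> w' = v @ u \<and> c = msgn (wpar p u \<and> wpar p v))"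
proof
  assume "cyc_move p w c w'"
  then obtain i where i: "i \<le> length w" "c = koszul p w ([i..<length w] @ [0..<i])" "w' = drop i w @ take i w"
    unfolding cyc_move_def by blast
  then have "c = msgn (wpar p (take i w) \<and> wpar p (drop i w))"
    using koszul_rotate[of p "take i w" "drop i w", where 'k = 'k] by (simp add: min.absorb2 conj_commute)
  then show "\<exists>u v. w = u @ v \<and> w' = v @ u \<and> c = msgn (wpar p u \<and> wpar p v)"
    using i by (metis append_take_drop_id)
next
  assume "\<exists>u v. w = u @ v \<and> w' = v @ u \<and> c = msgn (wpar p u \<and> wpar p v)"
  then obtain u v where "w = u @ v" "w' = v @ u" "c = msgn (wpar p u \<and> wpar p v)" by blast
  then show "cyc_move p w c w'" unfolding cyc_move_def
    using koszul_rotate[of p u v, where 'k = 'k] by (intro exI[of _ "length u"]) (simp add: conj_commute)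
qed

lemma nc_move_cases:
  "nc_move p U (c :: 'k::field_char_0) V \<longleftrightarrow> sym_move (wpar p) U c V \<or>
    (\<exists>A u v B. U = A @ (u @ v) # B \<and> V = A @ (v @ u) # B \<and> c = msgn (wpar p u \<and> wpar p v))"
proof -
  have "(\<exists>r<length U. \<exists>v. cyc_move p (U ! r) c v \<and> V = U[r := v]) \<longleftrightarrow>
    (\<exists>A u v B. U = A @ (u @ v) # B \<and> V = A @ (v @ u) # B \<and> c = msgn (wpar p u \<and> wpar p v))"
    (is "?L \<longleftrightarrow> ?R")
  proof
    assume ?L
    then obtain r u v where r: "r < length U" "U ! r = u @ v" "V = U[r := v @ u]"
      "c = msgn (wpar p u \<and> wpar p v)" unfolding cyc_move_iff by blast
    then have "U = take r U @ (u @ v) # drop (Suc r) U" "V = take r U @ (v @ u) # drop (Suc r) U"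
      using id_take_nth_drop[of r U] by (auto simp: upd_conv_take_nth_drop)
    then show ?R using r(4) by blast
  next
    assume ?R
    then obtain A u v B where "U = A @ (u @ v) # B" "V = A @ (v @ u) # B" "c = msgn (wpar p u \<and> wpar p v)"
      by blast
    then show ?L unfolding cyc_move_iff by (intro exI[of _ "length A"]) auto
  qed
  then show ?thesis by (simp add: nc_move_def)
qed

text \<open>The number of words belongs to the degree because empty words carry no letters: the
  multiset of letters alone would leave infinitely many monomials.\<close>

lemma finite_nc_fibre: "finite {U. (length U, mset (concat U)) = d}"
proof -
  obtain n M where d: "d = (n, M)" by fastforce
  have "{U. (length U, mset (concat U)) = d} \<subseteq>
      {U. set U \<subseteq> {u. set u \<subseteq> set_mset M \<and> length u \<le> size M} \<and> length U = n}"
  proof (rule subsetI, rule CollectI, rule conjI, rule subsetI, rule CollectI)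
    fix U u assume "U \<in> {U. (length U, mset (concat U)) = d}" and u: "u \<in> set U"
    then have U: "mset (concat U) = M" by (simp add: d)
    from u have "mset u \<subseteq># mset (concat U)" by (auto simp: mset_concat in_set_conv_decomp)
    then show "set u \<subseteq> set_mset M \<and> length u \<le> size M"
      unfolding U by (metis set_mset_mono set_mset_mset size_mset size_mset_mono)
  qed (simp add: d)
  then show ?thesis
    by (rule finite_subset) (intro finite_lists_length_eq finite_lists_length_le, simp)
qed

interpretation nc: signed_moves "nc_move p :: 'x list list \<Rightarrow> 'k::field_char_0 \<Rightarrow> 'x list list \<Rightarrow> bool"
    "\<lambda>U. (length U, mset (concat U))"
  for p
proof
  fix U V :: "'x list list" and c :: 'k
  assume mv: "nc_move p U c V"
  then show "(length U, mset (concat U)) = (length V, mset (concat V))"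
    unfolding nc_move_cases
  proof
    assume "sym_move (wpar p) U c V"
    then have "mset V = mset U" by (rule sym_move_mset)
    then show ?thesis using mset_eq_length[of V U]
      by (simp add: mset_concat mset_map flip: sum_mset_sum_list)
  qed auto
  from mv show "c = 1 \<or> c = - 1"
    unfolding nc_move_cases sym_move_def using koszul_cases msgn_cases by blast
qed (rule finite_nc_fibre)

lemma nc_invariant_iff: "nc.invariant p \<phi> \<longleftrightarrow> nc_inv p \<phi>"
proof
  assume *: "nc.invariant p \<phi>"
  have "sinv (wpar p) \<phi>"
    unfolding sym_invariant_iff[symmetric] sym.invariant_def
    by (intro allI impI *[unfolded nc.invariant_def, rule_format]) (simp add: nc_move_def)
  moreover have "cinv p (\<lambda>w. \<phi> (U @ w # V))" for U V
    unfolding cinv_def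
    by (intro allI *[unfolded nc.invariant_def, rule_format]) (auto simp: nc_move_cases)
  ultimately show "nc_inv p \<phi>" by (simp add: nc_inv_def)
next
  assume *: "nc_inv p \<phi>"
  show "nc.invariant p \<phi>"
    unfolding nc.invariant_def nc_move_cases
  proof (intro allI impI, elim disjE exE conjE)
    show "\<phi> U = c * \<phi> V" if "sym_move (wpar p) U c V" for U c V
      using * that unfolding nc_inv_def by (intro sinv_sym_move) auto
    show "\<phi> U = c * \<phi> V" if "U = A @ (u @ v) # B" "V = A @ (v @ u) # B" "c = msgn (wpar p u \<and> wpar p v)"
      for U c V A u v B
      using nc_inv_rotate[OF *, of A u v B] by (simp only: that)
  qed
qed

lemma nc_eqI:
  "(\<And>\<phi>. finsupp \<phi> \<Longrightarrow> nc_inv p \<phi> \<Longrightarrow> pairing f \<phi> = pairing g \<phi>) \<Longrightarrow> nc_eq p f g"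
  unfolding nc_eq_def by (rule nc.coinv_null_dual) (auto simp: pairing_diff nc_invariant_iff)

lemma nc_eqD: "nc_eq p f g \<Longrightarrow> finsupp \<phi> \<Longrightarrow> nc_inv p \<phi> \<Longrightarrow> pairing f \<phi> = pairing g \<phi>"
  unfolding nc_eq_def using nc.pairing_coinv_null[of "f - g" p \<phi>]
  by (simp add: pairing_diff nc_invariant_iff)

section \<open>Transposes of the brackets, the cobracket and the Laplacian\<close>

section \<open>Brackets and differentials as functionals\<close>

lemma sum_splits:
  "(\<And>a x b. s = a @ x # b \<Longrightarrow> F (length a) = G a x b) \<Longrightarrow> (\<Sum>i<length s. F i) = splits G s"
  unfolding splits_def
proof (rule sum.cong[OF refl])
  fix i assume *: "\<And>a x b. s = a @ x # b \<Longrightarrow> F (length a) = G a x b" and "i \<in> {..<length s}"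
  then show "F i = G (take i s) (s ! i) (drop (Suc i) s)"
    using *[OF id_take_nth_drop, of i] by simp
qed

lemma sum_sum_splits:
  assumes "\<And>a x b c y d. s = a @ x # b \<Longrightarrow> t = c @ y # d \<Longrightarrow> F (length a) (length c) = G a x b c y d"
  shows "(\<Sum>i<length s. \<Sum>j<length t. F i j) = splits (\<lambda>a x b. splits (G a x b) t) s"
  by (rule sum_splits, rule sum_splits, rule assms)

text \<open>The definitions sum with the later position outermost, nested \<open>splits\<close> with
  the earlier one. The induction separates the pairs containing the first letter from the
  rest.\<close>

lemma sum_pairs_splits:
  assumes "\<And>a x b y c. s = a @ x # b @ y # c \<Longrightarrow> F (length a) (Suc (length a + length b)) = G a x b y c"
  shows "(\<Sum>j<length s. \<Sum>i<j. F i j) = splits (\<lambda>a x. splits (G a x)) s"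
  using assms
proof (induction s arbitrary: F G)
  case (Cons z s)
  have "(\<Sum>j<length (z # s). \<Sum>i<j. F i j) = (\<Sum>j<length s. F 0 (Suc j)) + (\<Sum>j<length s. \<Sum>i<j. F (Suc i) (Suc j))"
    by (simp only: length_Cons sum.lessThan_Suc_shift sum.distrib) simp
  also have "(\<Sum>j<length s. F 0 (Suc j)) = splits (G [] z) s"
    by (rule sum_splits) (use Cons.prems[of "[]"] in simp)
  also have "(\<Sum>j<length s. \<Sum>i<j. F (Suc i) (Suc j)) = splits (\<lambda>a x. splits (G (z # a) x)) s"
    by (rule Cons.IH) (use Cons.prems[of "z # _"] in simp)
  finally show ?case by simp
qed simp

text \<open>The transpose of the bracket, with the Koszul sign evaluated in terms of blocks. As a
  finite sum of values it makes sense for every functional \<phi>, also for pullbacks, whose support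
  may be infinite; the other \<open>_fun\<close> definitions serve the same purpose.\<close>

definition sym_bracket_fun ::
  "('x \<Rightarrow> bool) \<Rightarrow> ('x \<Rightarrow> 'x \<Rightarrow> 'k::field_char_0) \<Rightarrow> 'x list \<Rightarrow> 'x list \<Rightarrow> ('x list \<Rightarrow> 'k) \<Rightarrow> 'k" where
  "sym_bracket_fun p eta s t \<phi> = splits (\<lambda>a x b. splits (\<lambda>c y d.
     msgn ((p x \<and> wpar p a) \<noteq> (p y \<and> wpar p (a @ b @ c))) * eta x y * \<phi> (a @ b @ c @ d)) t) s"

lemma pairing_sym_bracket:
  assumes "finsupp \<phi>"
  shows "pairing (sym_bracket p eta s t) \<phi> = sym_bracket_fun p eta s t \<phi>"
proof -
  have "pairing (sym_bracket p eta s t) \<phi> = (\<Sum>i<length s. \<Sum>j<length t.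
      koszul p (s @ t) (front (length s + length t) [i, length s + j]) * eta (s ! i) (t ! j) *
        \<phi> (nths (s @ t) (- {i, length s + j})))"
    by (simp add: sym_bracket_def Let_def pairing_sum assms)
  also have "\<dots> = sym_bracket_fun p eta s t \<phi>"
    unfolding sym_bracket_fun_def
  proof (rule sum_sum_splits)
    fix a x b c y d assume s: "s = a @ x # b" and t: "t = c @ y # d"
    show "koszul p (s @ t) (front (length s + length t) [length a, length s + length c]) *
        eta (s ! length a) (t ! length c) * \<phi> (nths (s @ t) (- {length a, length s + length c})) =
      msgn ((p x \<and> wpar p a) \<noteq> (p y \<and> wpar p (a @ b @ c))) * eta x y * \<phi> (a @ b @ c @ d)"
      using koszul_front[of p a x "b @ c" y d, where 'k = 'b] nths_remove_two[of a x "b @ c" y d]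
      by (simp add: s t add.assoc)
  qed
  finally show ?thesis .
qed

text \<open>The pieces end up in the order x y b a d c. Thus x passes a, then y passes a, b and c,
  and finally b passes a and d passes c.\<close>

lemma koszul_cyc_bracket:
  fixes p
  defines "par \<equiv> wpar p"
  shows "koszul p ((a @ x # b) @ (c @ y # d))
      ([length a, Suc (length a + length b) + length c] @ [Suc (length a)..<Suc (length a + length b)] @ [0..<length a] @
       [Suc (Suc (length a + length b) + length c)..<Suc (length a + length b) + Suc (length c + length d)] @
       [Suc (length a + length b)..<Suc (length a + length b) + length c]) =
    (msgn (((p x \<and> par a) \<noteq> (p y \<and> (par a \<noteq> (par b \<noteq> par c)))) \<noteq>
       ((par b \<and> par a) \<noteq> (par d \<and> par c))) :: 'k::field_char_0)"
proof -
  let ?w = "a @ x # b @ c @ y # d"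
  let ?Q = "\<lambda>k. p (?w ! k)"
  let ?m = "Suc (length a + length b)"
  have a: "wpar ?Q [0..<length a] = par a"
    using wpar_segment[of p "[]" a "x # b @ c @ y # d"] by (simp add: par_def)
  have x: "wpar ?Q [length a..<Suc (length a)] = p x"
    using wpar_segment[of p a "[x]" "b @ c @ y # d"] by (simp del: upt_Suc)
  have b: "wpar ?Q [Suc (length a)..<?m] = par b"
    using wpar_segment[of p "a @ [x]" b "c @ y # d"] by (simp add: par_def del: upt_Suc)
  have c: "wpar ?Q [?m..<Suc (length a + length b + length c)] = par c"
    using wpar_segment[of p "a @ x # b" c "y # d"] by (simp add: par_def del: upt_Suc)
  have y: "wpar ?Q [Suc (length a + length b + length c)..<Suc (Suc (length a + length b + length c))] = p y"
    using wpar_segment[of p "a @ x # b @ c" "[y]" d] by (simp add: add.assoc del: upt_Suc)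
  have d: "wpar ?Q [Suc (Suc (length a + length b + length c))..<
      Suc (Suc (length a + length b + (length c + length d)))] = par d"
    using wpar_segment[of p "a @ x # b @ c @ [y]" d "[]"] by (simp add: par_def add.assoc del: upt_Suc)
  have "[length a, ?m + length c] = [length a..<Suc (length a)] @ [?m + length c..<Suc (?m + length c)]"
    by simp
  then have "koszul p ?w
      ([length a, ?m + length c] @ [Suc (length a)..<?m] @ [0..<length a] @
       [Suc (?m + length c)..<?m + Suc (length c + length d)] @ [?m..<?m + length c]) =
    (msgn (p x \<and> par a) * (msgn (p y \<and> par a) * msgn (p y \<and> par b) * msgn (p y \<and> par c)) *
      (msgn (par b \<and> par a) * msgn (par d \<and> par c)) :: 'k)"
    by (simp only: append_assoc koszul_eq_invsgn invsgn_append cross_append_left cross_append_right)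
      (simp add: cross_upt_greater cross_upt_less a x b c y d del: upt_Suc)
  also have "\<dots> = msgn (((p x \<and> par a) \<noteq> (p y \<and> (par a \<noteq> (par b \<noteq> par c)))) \<noteq>
       ((par b \<and> par a) \<noteq> (par d \<and> par c)))"
    by (cases "p x"; cases "p y"; cases "par a"; cases "par b"; cases "par c"; cases "par d"; simp add: msgn_def)
  finally show ?thesis by simp
qed

definition cyc_bracket_fun ::
  "('x \<Rightarrow> bool) \<Rightarrow> ('x \<Rightarrow> 'x \<Rightarrow> 'k::field_char_0) \<Rightarrow> 'x list \<Rightarrow> 'x list \<Rightarrow> ('x list \<Rightarrow> 'k) \<Rightarrow> 'k" where
  "cyc_bracket_fun p eta u v \<phi> = splits (\<lambda>a x b. splits (\<lambda>c y d.
     msgn (((p x \<and> wpar p a) \<noteq> (p y \<and> (wpar p a \<noteq> (wpar p b \<noteq> wpar p c)))) \<noteq>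
       ((wpar p b \<and> wpar p a) \<noteq> (wpar p d \<and> wpar p c))) * eta x y * \<phi> (b @ a @ d @ c)) v) u"

lemma pairing_cyc_bracket:
  assumes "finsupp \<phi>"
  shows "pairing (cyc_bracket p eta u v) \<phi> = cyc_bracket_fun p eta u v \<phi>"
proof -
  have "pairing (cyc_bracket p eta u v) \<phi> = (\<Sum>i<length u. \<Sum>j<length v.
      koszul p (u @ v) ([i, length u + j] @ [Suc i..<length u] @ [0..<i] @
        [Suc (length u + j)..<length u + length v] @ [length u..<length u + j]) * eta (u ! i) (v ! j) *
        \<phi> (drop (Suc i) u @ take i u @ drop (Suc j) v @ take j v))"
    by (simp add: cyc_bracket_def Let_def pairing_sum assms)
  also have "\<dots> = cyc_bracket_fun p eta u v \<phi>"
    unfolding cyc_bracket_fun_def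
  proof (rule sum_sum_splits)
    fix a x b c y d assume s: "u = a @ x # b" and t: "v = c @ y # d"
    have l: "length u = Suc (length a + length b)" "length v = Suc (length c + length d)" using s t by auto
    show "koszul p (u @ v) ([length a, length u + length c] @ [Suc (length a)..<length u] @ [0..<length a] @
        [Suc (length u + length c)..<length u + length v] @ [length u..<length u + length c]) *
        eta (u ! length a) (v ! length c) *
        \<phi> (drop (Suc (length a)) u @ take (length a) u @ drop (Suc (length c)) v @ take (length c) v) =
      msgn (((p x \<and> wpar p a) \<noteq> (p y \<and> (wpar p a \<noteq> (wpar p b \<noteq> wpar p c)))) \<noteq>
       ((wpar p b \<and> wpar p a) \<noteq> (wpar p d \<and> wpar p c))) * eta x y * \<phi> (b @ a @ d @ c)"
      unfolding l unfolding s t koszul_cyc_bracket by simp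
  qed
  finally show ?thesis .
qed

text \<open>The pieces end up in the order x y b c a: x passes a, y passes a and b, and then b and c
  pass a.\<close>

lemma koszul_cobracket:
  fixes p
  defines "par \<equiv> wpar p"
  shows "koszul p (a @ x # b @ y # c)
      ([length a, Suc (length a + length b)] @ [Suc (length a)..<Suc (length a + length b)] @
       [Suc (Suc (length a + length b))..<length (a @ x # b @ y # c)] @ [0..<length a]) =
    (msgn (((p x \<and> par a) \<noteq> (p y \<and> (par a \<noteq> par b))) \<noteq> ((par b \<noteq> par c) \<and> par a)) :: 'k::field_char_0)"
proof -
  let ?w = "a @ x # b @ y # c"
  let ?Q = "\<lambda>k. p (?w ! k)"
  let ?m = "Suc (length a + length b)"
  have a: "wpar ?Q [0..<length a] = par a"
    using wpar_segment[of p "[]" a "x # b @ y # c"] by (simp add: par_def)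
  have x: "wpar ?Q [length a..<Suc (length a)] = p x"
    using wpar_segment[of p a "[x]" "b @ y # c"] by (simp del: upt_Suc)
  have b: "wpar ?Q [Suc (length a)..<?m] = par b"
    using wpar_segment[of p "a @ [x]" b "y # c"] by (simp add: par_def del: upt_Suc)
  have y: "wpar ?Q [?m..<Suc ?m] = p y"
    using wpar_segment[of p "a @ x # b" "[y]" c] by (simp del: upt_Suc)
  have c: "wpar ?Q [Suc ?m..<Suc (Suc (length a + (length b + length c)))] = par c"
    using wpar_segment[of p "a @ x # b @ [y]" c "[]"] by (simp add: par_def add.assoc del: upt_Suc)
  have "[length a, ?m] = [length a..<Suc (length a)] @ [?m..<Suc ?m]"
    by simp
  then have "koszul p ?w
      ([length a, ?m] @ [Suc (length a)..<?m] @ [Suc ?m..<length ?w] @ [0..<length a]) =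
    (msgn (p x \<and> par a) * (msgn (p y \<and> par a) * msgn (p y \<and> par b)) *
      (msgn (par b \<and> par a) * msgn (par c \<and> par a)) :: 'k)"
    by (simp only: append_assoc koszul_eq_invsgn invsgn_append cross_append_left cross_append_right)
      (simp add: cross_upt_greater cross_upt_less a x b y c del: upt_Suc)
  also have "\<dots> = msgn (((p x \<and> par a) \<noteq> (p y \<and> (par a \<noteq> par b))) \<noteq> ((par b \<noteq> par c) \<and> par a))"
    by (cases "p x"; cases "p y"; cases "par a"; cases "par b"; cases "par c"; simp add: msgn_def)
  finally show ?thesis .
qed

definition cobracket_fun ::
  "('x \<Rightarrow> bool) \<Rightarrow> ('x \<Rightarrow> 'x \<Rightarrow> 'k::field_char_0) \<Rightarrow> 'x list \<Rightarrow> ('x list list \<Rightarrow> 'k) \<Rightarrow> 'k" where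
  "cobracket_fun p eta w \<phi> = splits (\<lambda>a x. splits (\<lambda>b y c.
     msgn (((p x \<and> wpar p a) \<noteq> (p y \<and> (wpar p a \<noteq> wpar p b))) \<noteq> ((wpar p b \<noteq> wpar p c) \<and> wpar p a)) *
       eta x y * \<phi> [b, c @ a])) w"

lemma pairing_cobracket:
  assumes "finsupp \<phi>"
  shows "pairing (cobracket p eta w) \<phi> = cobracket_fun p eta w \<phi>"
proof -
  have "pairing (cobracket p eta w) \<phi> = (\<Sum>j<length w. \<Sum>i<j.
      koszul p w ([i, j] @ [Suc i..<j] @ [Suc j..<length w] @ [0..<i]) * eta (w ! i) (w ! j) *
        \<phi> [drop (Suc i) (take j w), drop (Suc j) w @ take i w])"
    by (simp add: cobracket_def Let_def pairing_sum assms)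
  also have "\<dots> = cobracket_fun p eta w \<phi>"
    unfolding cobracket_fun_def
  proof (rule sum_pairs_splits)
    fix a x b y c assume w: "w = a @ x # b @ y # c"
    show "koszul p w ([length a, Suc (length a + length b)] @ [Suc (length a)..<Suc (length a + length b)] @
        [Suc (Suc (length a + length b))..<length w] @ [0..<length a]) *
        eta (w ! length a) (w ! Suc (length a + length b)) *
        \<phi> [drop (Suc (length a)) (take (Suc (length a + length b)) w),
          drop (Suc (Suc (length a + length b))) w @ take (length a) w] =
      msgn (((p x \<and> wpar p a) \<noteq> (p y \<and> (wpar p a \<noteq> wpar p b))) \<noteq> ((wpar p b \<noteq> wpar p c) \<and> wpar p a)) *
       eta x y * \<phi> [b, c @ a]"
      unfolding w koszul_cobracket by (simp add: nth_append)
  qed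
  finally show ?thesis .
qed

definition nc_bracket_fun ::
  "('x \<Rightarrow> bool) \<Rightarrow> ('x \<Rightarrow> 'x \<Rightarrow> 'k::field_char_0) \<Rightarrow> 'x list list \<Rightarrow> 'x list list \<Rightarrow> ('x list list \<Rightarrow> 'k) \<Rightarrow> 'k" where
  "nc_bracket_fun p eta U V \<phi> = splits (\<lambda>A u B. splits (\<lambda>C v D.
     msgn ((wpar p u \<and> wpar (wpar p) A) \<noteq> (wpar p v \<and> wpar (wpar p) (A @ B @ C))) *
       cyc_bracket_fun p eta u v (\<lambda>r. \<phi> (r # A @ B @ C @ D))) V) U"

lemma pairing_nc_term:
  "finsupp \<phi> \<Longrightarrow> pairing (cat (single f) (mon 1 W)) \<phi> = pairing f (\<lambda>r. \<phi> (r # W))"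
proof -
  assume "finsupp \<phi>"
  then have "finsupp (\<lambda>t. \<phi> (t @ W))" by simp
  then show ?thesis using \<open>finsupp \<phi>\<close> by (simp add: pairing_cat pairing_single)
qed

lemma finsupp_Cons_left [simp]: "finsupp \<phi> \<Longrightarrow> finsupp (\<lambda>r. \<phi> (r # W))"
  by (rule finsupp_comp_inj) (auto simp: inj_def)

lemma pairing_nc_bracket:
  assumes "finsupp \<phi>"
  shows "pairing (nc_bracket p eta U V) \<phi> = nc_bracket_fun p eta U V \<phi>"
proof -
  have "pairing (nc_bracket p eta U V) \<phi> = (\<Sum>i<length U. \<Sum>j<length V.
      koszul (wpar p) (U @ V) (front (length U + length V) [i, length U + j]) *
      cyc_bracket_fun p eta (U ! i) (V ! j) (\<lambda>r. \<phi> (r # nths (U @ V) (- {i, length U + j}))))"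
    by (simp add: nc_bracket_def Let_def pairing_sum pairing_smult pairing_nc_term pairing_cyc_bracket assms)
  also have "\<dots> = nc_bracket_fun p eta U V \<phi>"
    unfolding nc_bracket_fun_def
  proof (rule sum_sum_splits)
    fix a x b c y d assume s: "U = a @ x # b" and t: "V = c @ y # d"
    show "koszul (wpar p) (U @ V) (front (length U + length V) [length a, length U + length c]) *
      cyc_bracket_fun p eta (U ! length a) (V ! length c) (\<lambda>r. \<phi> (r # nths (U @ V) (- {length a, length U + length c}))) =
      msgn ((wpar p x \<and> wpar (wpar p) a) \<noteq> (wpar p y \<and> wpar (wpar p) (a @ b @ c))) *
       cyc_bracket_fun p eta x y (\<lambda>r. \<phi> (r # a @ b @ c @ d))"
      using koszul_front[of "wpar p" a x "b @ c" y d, where 'k = 'b] nths_remove_two[of a x "b @ c" y d]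
      by (simp add: s t add.assoc)
  qed
  finally show ?thesis .
qed

definition nc_delta_fun ::
  "('x \<Rightarrow> bool) \<Rightarrow> ('x \<Rightarrow> 'x \<Rightarrow> 'k::field_char_0) \<Rightarrow> 'x list list \<Rightarrow> ('x list list \<Rightarrow> 'k) \<Rightarrow> 'k" where
  "nc_delta_fun p eta U \<phi> = splits (\<lambda>A u. splits (\<lambda>B v C.
     msgn ((wpar p u \<and> wpar (wpar p) A) \<noteq> (wpar p v \<and> (wpar (wpar p) A \<noteq> wpar (wpar p) B))) *
       cyc_bracket_fun p eta u v (\<lambda>r. \<phi> (r # A @ B @ C)))) U"

lemma pairing_nc_delta:
  assumes "finsupp \<phi>"
  shows "pairing (nc_delta p eta U) \<phi> = nc_delta_fun p eta U \<phi>"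
proof -
  have "pairing (nc_delta p eta U) \<phi> = (\<Sum>j<length U. \<Sum>i<j.
      koszul (wpar p) U (front (length U) [i, j]) *
      cyc_bracket_fun p eta (U ! i) (U ! j) (\<lambda>r. \<phi> (r # nths U (- {i, j}))))"
    by (simp add: nc_delta_def Let_def pairing_sum pairing_smult pairing_nc_term pairing_cyc_bracket assms)
  also have "\<dots> = nc_delta_fun p eta U \<phi>"
    unfolding nc_delta_fun_def
  proof (rule sum_pairs_splits)
    fix a x b y c assume s: "U = a @ x # b @ y # c"
    show "koszul (wpar p) U (front (length U) [length a, Suc (length a + length b)]) *
      cyc_bracket_fun p eta (U ! length a) (U ! Suc (length a + length b))
        (\<lambda>r. \<phi> (r # nths U (- {length a, Suc (length a + length b)}))) =
      msgn ((wpar p x \<and> wpar (wpar p) a) \<noteq> (wpar p y \<and> (wpar (wpar p) a \<noteq> wpar (wpar p) b))) *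
       cyc_bracket_fun p eta x y (\<lambda>r. \<phi> (r # a @ b @ c))"
      unfolding s koszul_front nths_remove_two by (simp add: nth_append)
  qed
  finally show ?thesis .
qed

definition nc_nabla_fun ::
  "('x \<Rightarrow> bool) \<Rightarrow> ('x \<Rightarrow> 'x \<Rightarrow> 'k::field_char_0) \<Rightarrow> 'x list list \<Rightarrow> ('x list list \<Rightarrow> 'k) \<Rightarrow> 'k" where
  "nc_nabla_fun p eta U \<phi> = splits (\<lambda>A u B.
     msgn (wpar (wpar p) A) * cobracket_fun p eta u (\<lambda>r. \<phi> (A @ r @ B))) U"

lemma pairing_nc_nabla:
  assumes "finsupp \<phi>"
  shows "pairing (nc_nabla p eta U) \<phi> = nc_nabla_fun p eta U \<phi>"
proof -
  have "finsupp (\<lambda>r. \<phi> (A @ r @ B))" for A B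
    using finsupp_append_right[OF finsupp_append_left[OF assms, of A], of B] by simp
  then show ?thesis
    by (simp add: nc_nabla_def pairing_derm assms nc_nabla_fun_def pairing_cobracket)
qed

primrec BV_fun ::
  "('x \<Rightarrow> bool) \<Rightarrow> ('x \<Rightarrow> 'x \<Rightarrow> 'k::field_char_0) \<Rightarrow> 'x list \<Rightarrow> ('x list \<Rightarrow> 'k) \<Rightarrow> 'k" where
  "BV_fun p eta [] \<phi> = 0"
| "BV_fun p eta (x # b) \<phi> = msgn (p x) * BV_fun p eta b (\<lambda>r. \<phi> (x # r)) + sym_bracket_fun p eta [x] b \<phi>"

lemma pairing_BV: "finsupp \<phi> \<Longrightarrow> pairing (BV_laplacian p eta w) \<phi> = BV_fun p eta w \<phi>"
  by (induction w arbitrary: \<phi>) (simp_all add: pairing_add pairing_smult pairing_cat pairing_sym_bracket)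

section \<open>Sums over paths of matrix indices\<close>

section \<open>Words of matrix units\<close>

definition lin :: "(('a \<Rightarrow> 'k::field_char_0) \<Rightarrow> 'k) \<Rightarrow> bool" where
  "lin L \<longleftrightarrow> (\<forall>f g. L (\<lambda>x. f x + g x) = L f + L g) \<and> (\<forall>c f. L (\<lambda>x. c * f x) = c * L f)"

lemma linI: "(\<And>f g. L (\<lambda>x. f x + g x) = L f + L g) \<Longrightarrow> (\<And>c f. L (\<lambda>x. c * f x) = c * L f) \<Longrightarrow> lin L"
  by (auto simp: lin_def)

lemma lin_add: "lin L \<Longrightarrow> L (\<lambda>x. f x + g x) = L f + L g"
  by (auto simp: lin_def)

lemma lin_mult: "lin L \<Longrightarrow> L (\<lambda>x. c * f x) = c * L f"
  by (auto simp: lin_def)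

lemma lin_zero: "lin L \<Longrightarrow> L (\<lambda>x. 0) = 0"
  using lin_mult[of L 0 "\<lambda>x. 0"] by simp

lemma lin_sum: "lin L \<Longrightarrow> L (\<lambda>x. \<Sum>i\<in>I. f i x) = (\<Sum>i\<in>I. L (f i))"
proof (induction I rule: infinite_finite_induct)
  case (insert i I)
  then show ?case using lin_add[of L "f i" "\<lambda>x. \<Sum>i\<in>I. f i x"] by simp
qed (simp_all add: lin_zero)

lemma lin_splits: "lin L \<Longrightarrow> L (\<lambda>r. splits (\<lambda>a x b. f a x b r) w) = splits (\<lambda>a x b. L (f a x b)) w"
  unfolding splits_def by (rule lin_sum)

text \<open>\<open>paths N w c d \<phi>\<close> sums \<open>\<phi>\<close> over the words \<open>(x\<^sub>1,c,e\<^sub>1)(x\<^sub>2,e\<^sub>1,e\<^sub>2)\<dots>(x\<^sub>k,e\<^bsub>k-1\<^esub>,d)\<close> over \<open>w = x\<^sub>1\<dots>x\<^sub>k\<close>: these are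
  the words of matrix units whose product has a nonzero entry \<open>(c,d)\<close>.\<close>

primrec paths :: "nat \<Rightarrow> 'x list \<Rightarrow> nat \<Rightarrow> nat \<Rightarrow> (('x \<times> nat \<times> nat) list \<Rightarrow> 'k::field_char_0) \<Rightarrow> 'k" where
  "paths N [] c d \<phi> = (if c = d then \<phi> [] else 0)"
| "paths N (x # w) c d \<phi> = (\<Sum>e<N. paths N w e d (\<lambda>v. \<phi> ((x, c, e) # v)))"

text \<open>For the empty word this is N times the value of \<phi> on the empty word, one summand
  for each index c; it is the factor N in the image of \<nu>.\<close>

definition loops :: "nat \<Rightarrow> 'x list \<Rightarrow> (('x \<times> nat \<times> nat) list \<Rightarrow> 'k::field_char_0) \<Rightarrow> 'k" where
  "loops N w \<phi> = (\<Sum>c<N. paths N w c c \<phi>)"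

primrec loopss :: "nat \<Rightarrow> 'x list list \<Rightarrow> (('x \<times> nat \<times> nat) list \<Rightarrow> 'k::field_char_0) \<Rightarrow> 'k" where
  "loopss N [] \<phi> = \<phi> []"
| "loopss N (w # W) \<phi> = loops N w (\<lambda>s. loopss N W (\<lambda>t. \<phi> (s @ t)))"

lemma lin_paths: "lin (paths N w c d)"
proof (rule linI)
  show "paths N w c d (\<lambda>x. f x + g x) = paths N w c d f + paths N w c d g" for f g
    by (induction w arbitrary: c f g) (auto simp: sum.distrib)
  show "paths N w c d (\<lambda>x. k * f x) = k * paths N w c d f" for k f
    by (induction w arbitrary: c f) (auto simp: sum_distrib_left)
qed

lemma lin_loops: "lin (loops N w)"
  by (rule linI) (simp_all add: loops_def lin_add[OF lin_paths] lin_mult[OF lin_paths] sum.distrib sum_distrib_left)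

lemma lin_loopss: "lin (loopss N W)"
proof (rule linI)
  show "loopss N W (\<lambda>x. f x + g x) = loopss N W f + loopss N W g" for f g
    by (induction W arbitrary: f g) (simp_all add: lin_add[OF lin_loops])
  show "loopss N W (\<lambda>x. k * f x) = k * loopss N W f" for k f
    by (induction W arbitrary: f) (simp_all add: lin_mult[OF lin_loops])
qed

text \<open>\<open>paths\<close> is a finite combination of evaluations at words, so it commutes
  with any linear functional. This replaces explicit exchanges of sums whenever two sums over paths,
  or a path and a contraction, change places.\<close>

lemma paths_lin: "lin L \<Longrightarrow> paths N w c d (\<lambda>v. L (F v)) = L (\<lambda>x. paths N w c d (\<lambda>v. F v x))"
  by (induction w arbitrary: c F) (simp_all add: lin_zero lin_sum[where L = L])

lemma loops_lin: "lin L \<Longrightarrow> loops N w (\<lambda>v. L (F v)) = L (\<lambda>x. loops N w (\<lambda>v. F v x))"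
  unfolding loops_def by (simp add: paths_lin[of L] lin_sum[where L = L])

lemma loopss_lin: "lin L \<Longrightarrow> loopss N W (\<lambda>v. L (F v)) = L (\<lambda>x. loopss N W (\<lambda>v. F v x))"
  by (induction W arbitrary: F) (simp_all add: loops_lin[where L = L])

lemma paths_cong: "(\<And>v. map fst v = w \<Longrightarrow> f v = g v) \<Longrightarrow> paths N w c d f = paths N w c d g"
proof (induction w arbitrary: c f g)
  case (Cons x w)
  show ?case unfolding paths.simps by (intro sum.cong refl Cons.IH Cons.prems) simp
qed simp

lemma loops_cong: "(\<And>v. map fst v = w \<Longrightarrow> f v = g v) \<Longrightarrow> loops N w f = loops N w g"
  unfolding loops_def by (intro sum.cong refl paths_cong)

lemma loopss_cong: "(\<And>v. map fst v = concat W \<Longrightarrow> f v = g v) \<Longrightarrow> loopss N W f = loopss N W g"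
proof (induction W arbitrary: f g)
  case (Cons w W)
  show ?case unfolding loopss.simps by (intro loops_cong Cons.IH Cons.prems) simp
qed simp

lemma paths_append: 
  "c < N \<Longrightarrow> paths N (u @ w) c d \<phi> = (\<Sum>e<N. paths N u c e (\<lambda>s. paths N w e d (\<lambda>t. \<phi> (s @ t))))"
proof (induction u arbitrary: c \<phi>)
  case Nil
  then show ?case by (simp add: if_distrib sum.delta')
next
  case (Cons x u)
  then show ?case by (simp, subst sum.swap) simp
qed

lemma loops_append: 
  "loops N (u @ w) \<phi> = (\<Sum>c<N. \<Sum>e<N. paths N u c e (\<lambda>s. paths N w e c (\<lambda>t. \<phi> (s @ t))))"
  unfolding loops_def by (simp add: paths_append)

lemma loopss_append: "loopss N (U @ V) \<phi> = loopss N U (\<lambda>s. loopss N V (\<lambda>t. \<phi> (s @ t)))"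
  by (induction U arbitrary: \<phi>) simp_all

lemma wpar_fst: "wpar (\<lambda>y. p (fst y)) v \<longleftrightarrow> wpar p (map fst v)"
  by (simp add: wpar_map)

lemma wpar_concat: "wpar (wpar p) W \<longleftrightarrow> wpar p (concat W)"
  by (induction W) auto

text \<open>A closed path over u followed by v, started anew at the junction, is a closed path over
  v followed by u; rearranging the letters costs the block sign.\<close>

lemma cinv_loops:
  assumes "sinv (\<lambda>y. p (fst y)) \<phi>"
  shows "cinv p (\<lambda>w. loops N w \<phi>)"
  unfolding cinv_def
proof (intro allI)
  fix u v
  have "loops N (u @ v) \<phi> = (\<Sum>c<N. \<Sum>e<N. paths N u c e (\<lambda>s. paths N v e c (\<lambda>t. msgn (wpar p u \<and> wpar p v) * \<phi> (t @ s))))"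
    unfolding loops_append
  proof (intro sum.cong refl paths_cong)
    fix s t :: "('a \<times> nat \<times> nat) list"
    assume "map fst s = u" "map fst t = v"
    then show "\<phi> (s @ t) = msgn (wpar p u \<and> wpar p v) * \<phi> (t @ s)"
      using sinv_swap[OF assms, of "[]" s t "[]"] by (simp add: wpar_fst)
  qed
  also have "\<dots> = msgn (wpar p u \<and> wpar p v) * (\<Sum>c<N. \<Sum>e<N. paths N u c e (\<lambda>s. paths N v e c (\<lambda>t. \<phi> (t @ s))))"
    by (simp add: lin_mult[OF lin_paths] sum_distrib_left)
  also have "(\<Sum>c<N. \<Sum>e<N. paths N u c e (\<lambda>s. paths N v e c (\<lambda>t. \<phi> (t @ s)))) =
      (\<Sum>c<N. \<Sum>e<N. paths N v e c (\<lambda>t. paths N u c e (\<lambda>s. \<phi> (t @ s))))"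
    by (intro sum.cong refl paths_lin[OF lin_paths])
  also have "\<dots> = loops N (v @ u) \<phi>"
    unfolding loops_append by (rule sum.swap)
  finally show "loops N (u @ v) \<phi> = msgn (wpar p u \<and> wpar p v) * loops N (v @ u) \<phi>" .
qed

text \<open>Dual to the statement that the map descends to coinvariants. An exchange of two words is
  an exchange of blocks of letters; for a rotation inside one word, the other words are first summed
  out, which leaves an invariant functional on that word.\<close>

lemma nc_inv_loopss:
  assumes inv: "sinv (\<lambda>y. p (fst y)) \<phi>"
  shows "nc_inv p (\<lambda>W. loopss N W \<phi>)"
  unfolding nc_inv_def
proof (intro conjI allI)
  show "sinv (wpar p) (\<lambda>W. loopss N W \<phi>)"
    unfolding sinv_def
  proof (intro allI)
    fix A x y B
    have "loopss N (A @ x # y # B) \<phi> =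
        loopss N A (\<lambda>a. loops N x (\<lambda>s. loops N y (\<lambda>t. loopss N B (\<lambda>b. msgn (wpar p x \<and> wpar p y) * \<phi> (a @ t @ s @ b)))))"
      unfolding loopss_append loopss.simps
    proof (intro loopss_cong loops_cong)
      fix a s t b :: "('a \<times> nat \<times> nat) list"
      assume "map fst s = x" "map fst t = y"
      then show "\<phi> (a @ s @ t @ b) = msgn (wpar p x \<and> wpar p y) * \<phi> (a @ t @ s @ b)"
        using sinv_swap[OF inv, of a s t b] by (simp add: wpar_fst)
    qed
    also have "\<dots> = msgn (wpar p x \<and> wpar p y) *
        loopss N A (\<lambda>a. loops N x (\<lambda>s. loops N y (\<lambda>t. loopss N B (\<lambda>b. \<phi> (a @ t @ s @ b)))))"
      by (simp add: lin_mult[OF lin_loopss] lin_mult[OF lin_loops])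
    also have "loopss N A (\<lambda>a. loops N x (\<lambda>s. loops N y (\<lambda>t. loopss N B (\<lambda>b. \<phi> (a @ t @ s @ b))))) =
        loopss N (A @ y # x # B) \<phi>"
      by (simp add: loopss_append) (subst loops_lin[OF lin_loops], rule refl)
    finally show "loopss N (A @ x # y # B) \<phi> = msgn (wpar p x \<and> wpar p y) * loopss N (A @ y # x # B) \<phi>" .
  qed
  fix U V
  have "loopss N (U @ w # V) \<phi> = loops N w (\<lambda>s. loopss N U (\<lambda>a. loopss N V (\<lambda>b. \<phi> (a @ s @ b))))" for w
    by (simp add: loopss_append loopss_lin[OF lin_loops])
  moreover have "sinv (\<lambda>y. p (fst y)) (\<lambda>s. loopss N U (\<lambda>a. loopss N V (\<lambda>b. \<phi> (a @ s @ b))))"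
    unfolding sinv_def
  proof (intro allI)
    fix c x y d
    have "\<phi> (a @ (c @ x # y # d) @ b) = msgn (p (fst x) \<and> p (fst y)) * \<phi> (a @ (c @ y # x # d) @ b)" for a b
      using sinvD[OF inv, of "a @ c" x y "d @ b"] by simp
    then show "loopss N U (\<lambda>a. loopss N V (\<lambda>b. \<phi> (a @ (c @ x # y # d) @ b))) = msgn (p (fst x) \<and> p (fst y)) *
        loopss N U (\<lambda>a. loopss N V (\<lambda>b. \<phi> (a @ (c @ y # x # d) @ b)))"
      by (simp only: lin_mult[OF lin_loopss])
  qed
  ultimately show "cinv p (\<lambda>w. loopss N (U @ w # V) \<phi>)" using cinv_loops[of p] by simp
qed

lemma sum_apply: "(\<Sum>i\<in>I. f i) v = (\<Sum>i\<in>I. f i v :: 'k::field_char_0)"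
  by (induction I rule: infinite_finite_induct) simp_all

lemma cat_mon_letter: "cat (mon 1 [y]) g v = (case v of [] \<Rightarrow> 0 | z # v' \<Rightarrow> if z = y then g v' else 0)"
proof (cases v)
  case (Cons z v')
  have "cat (mon 1 [y]) g v = (\<Sum>k\<in>{Suc 0}. mon 1 [y] (take k v) * g (drop k v))"
    unfolding cat_def
    by (rule sum.mono_neutral_right) (auto simp: Cons mon_def take_Cons split: nat.splits)
  then show ?thesis by (simp add: Cons mon_def)
qed (simp add: cat_def mon_def)

text \<open>The (c,d) entry of the product of generic matrices, one for each letter of w;
  \<open>M_word\<close> is the trace.\<close>

definition path_word :: "nat \<Rightarrow> 'x list \<Rightarrow> nat \<Rightarrow> nat \<Rightarrow> ('x \<times> nat \<times> nat) list \<Rightarrow> 'k::field_char_0" where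
  "path_word N w c d v = (if map fst v = w \<and> set (map snd v) \<subseteq> {..<N} \<times> {..<N}
     then unit_prod (map snd v) c d else 0)"

lemma path_word_Cons:
  assumes "c < N"
  shows "path_word N (x # w) c d = (\<Sum>e<N. cat (mon 1 [(x, c, e)]) (path_word N w e d))"
proof
  fix v
  have "(\<Sum>e<N. cat (mon 1 [(x, c, e)]) (path_word N w e d)) v =
      (\<Sum>e<N. case v of [] \<Rightarrow> 0 | z # v' \<Rightarrow> if z = (x, c, e) then path_word N w e d v' else 0)"
    by (simp add: sum_apply cat_mon_letter)
  also have "\<dots> = path_word N (x # w) c d v"
  proof (cases v)
    case (Cons z v')
    obtain x' a b where z: "z = (x', a, b)" by (cases z)
    have "(\<Sum>e<N. if z = (x, c, e) then path_word N w e d v' else 0) =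
        (\<Sum>e<N. if e = b then (if x' = x \<and> a = c then path_word N w b d v' else 0) else 0)"
      by (rule sum.cong) (auto simp: z)
    also have "\<dots> = (if b < N \<and> x' = x \<and> a = c then path_word N w b d v' else 0)"
      by (subst sum.delta) auto
    also have "\<dots> = path_word N (x # w) c d v"
      using assms by (auto simp: Cons z path_word_def)
    finally show ?thesis by (simp add: Cons)
  qed (simp add: path_word_def)
  finally show "path_word N (x # w) c d v = (\<Sum>e<N. cat (mon 1 [(x, c, e)]) (path_word N w e d)) v" ..
qed

lemma pairing_path_word: "c < N \<Longrightarrow> finsupp \<phi> \<Longrightarrow> pairing (path_word N w c d) \<phi> = paths N w c d \<phi>"
proof (induction w arbitrary: c \<phi>)
  case Nil
  have "path_word N ([] :: 'a list) c d = (mon (if c = d then 1 else 0) [] :: _ \<Rightarrow> 'b)"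
    by (auto simp: path_word_def mon_def fun_eq_iff)
  then show ?case by simp
next
  case (Cons x w)
  then show ?case by (simp add: path_word_Cons pairing_sum pairing_cat)
qed

lemma pairing_M_word:
  assumes "finsupp \<phi>" shows "pairing (M_word N w) \<phi> = loops N w \<phi>"
proof -
  have "M_word N w = (\<Sum>c<N. path_word N w c c :: _ \<Rightarrow> 'b)"
  proof
    fix v
    show "M_word N w v = (\<Sum>c<N. path_word N w c c :: _ \<Rightarrow> 'b) v"
      unfolding sum_apply M_word_def path_word_def unit_trace_def
      by (cases "map fst v = w \<and> set (map snd v) \<subseteq> {..<N} \<times> {..<N}"; simp only: if_True if_False simp_thms sum.neutral_const)
  qed
  then show ?thesis using assms by (simp add: pairing_sum pairing_path_word loops_def)
qed

lemma finsupp_loopss: "finsupp \<phi> \<Longrightarrow> finsupp (\<lambda>s. loopss N W (\<lambda>t. \<phi> (s @ t)))"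
  by (rule finsupp_prefix[of \<phi>]) (auto simp: lin_zero[OF lin_loopss])

lemma pairing_M_words: "finsupp \<phi> \<Longrightarrow> pairing (catprod (map (M_word N) W)) \<phi> = loopss N W \<phi>"
  by (induction W arbitrary: \<phi>) (simp_all add: catprod_def pairing_cat pairing_M_word finsupp_loopss)

text \<open>Marking a letter (x, e, f) on a path cuts it into a path from c to e and a path from f
  to d.\<close>

lemma paths_splits:
  "c < N \<Longrightarrow> paths N w c d (splits F) =
    splits (\<lambda>a x b. \<Sum>e<N. \<Sum>f<N. paths N a c e (\<lambda>s. paths N b f d (F s (x, e, f)))) w"
proof (induction w arbitrary: c F)
  case (Cons x w)
  let ?G = "\<lambda>e a y b e' f. paths N a e e' (\<lambda>s. paths N b f d (F ((x, c, e) # s) (y, e', f)))"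
  have "paths N (x # w) c d (splits F) =
      (\<Sum>e<N. paths N w e d (F [] (x, c, e))) + (\<Sum>e<N. paths N w e d (splits (\<lambda>a. F ((x, c, e) # a))))"
    by (simp add: lin_add[OF lin_paths] sum.distrib)
  also have "(\<Sum>e<N. paths N w e d (splits (\<lambda>a. F ((x, c, e) # a)))) =
      (\<Sum>e<N. splits (\<lambda>a y b. \<Sum>e'<N. \<Sum>f<N. ?G e a y b e' f) w)"
    by (rule sum.cong[OF refl]) (simp add: Cons.IH)
  also have "\<dots> = splits (\<lambda>a y b. \<Sum>e<N. \<Sum>e'<N. \<Sum>f<N. ?G e a y b e' f) w"
    by (simp add: splits_sum)
  also have "\<dots> = splits (\<lambda>a y b. \<Sum>e'<N. \<Sum>f<N. \<Sum>e<N. ?G e a y b e' f) w"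
    by (subst sum.swap, subst (2) sum.swap) simp
  also have "(\<Sum>e<N. paths N w e d (F [] (x, c, e))) =
      (\<Sum>e<N. \<Sum>f<N. paths N [] c e (\<lambda>s. paths N w f d (F s (x, e, f))))"
    using Cons.prems by (simp add: if_distrib sum.delta' sum.swap[of _ "{..<N}" "{..<N}"])
  finally show ?case by simp
qed simp

text \<open>Removing the marked letter (x, e, f) opens a closed path: what remains runs from f to e,
  through b and then a. \<open>H\<close> is the summand after the pieces have been put into this
  order.\<close>

lemma loops_splits:
  assumes "\<And>a x b s e f t. w = a @ x # b \<Longrightarrow> map fst s = a \<Longrightarrow> map fst t = b \<Longrightarrow> e < N \<Longrightarrow> f < N \<Longrightarrow>
    F s (x, e, f) t = H a (x, e, f) b (t @ s)"
  shows "loops N w (splits F) = splits (\<lambda>a x b. \<Sum>e<N. \<Sum>f<N. paths N (b @ a) f e (H a (x, e, f) b)) w"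
proof -
  have "loops N w (splits F) =
      splits (\<lambda>a x b. \<Sum>c<N. \<Sum>e<N. \<Sum>f<N. paths N a c e (\<lambda>s. paths N b f c (F s (x, e, f)))) w"
    by (simp add: loops_def paths_splits splits_sum)
  also have "\<dots> = splits (\<lambda>a x b. \<Sum>e<N. \<Sum>f<N. paths N (b @ a) f e (H a (x, e, f) b)) w"
  proof (rule splits_cong)
    fix a x b assume w: "w = a @ x # b"
    have "(\<Sum>c<N. \<Sum>e<N. \<Sum>f<N. paths N a c e (\<lambda>s. paths N b f c (F s (x, e, f)))) =
        (\<Sum>e<N. \<Sum>f<N. \<Sum>c<N. paths N a c e (\<lambda>s. paths N b f c (F s (x, e, f))))"
      by (subst sum.swap, rule sum.cong[OF refl], rule sum.swap)
    also have "\<dots> = (\<Sum>e<N. \<Sum>f<N. \<Sum>c<N. paths N a c e (\<lambda>s. paths N b f c (\<lambda>t. H a (x, e, f) b (t @ s))))"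
      by (intro sum.cong refl paths_cong) (use assms w in auto)
    also have "\<dots> = (\<Sum>e<N. \<Sum>f<N. paths N (b @ a) f e (H a (x, e, f) b))"
      by (intro sum.cong refl, subst paths_append, simp) (intro sum.cong refl paths_lin[OF lin_paths])
    finally show "(\<Sum>c<N. \<Sum>e<N. \<Sum>f<N. paths N a c e (\<lambda>s. paths N b f c (F s (x, e, f)))) =
      (\<Sum>e<N. \<Sum>f<N. paths N (b @ a) f e (H a (x, e, f) b))" .
  qed
  finally show ?thesis .
qed

section \<open>Leibniz rules and contractions along closed paths\<close>

section \<open>The matrix map intertwines brackets and differentials\<close>

text \<open>The inverse of the form \<open>om\<close> tensored with the trace pairing, if \<open>eta\<close> is the inverse of \<open>om\<close>.\<close>

definition mat_eta :: "nat \<Rightarrow> ('x \<Rightarrow> 'x \<Rightarrow> 'k::field_char_0) \<Rightarrow> ('x \<times> nat \<times> nat \<Rightarrow> 'x \<times> nat \<times> nat \<Rightarrow> 'k)" where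
  "mat_eta N eta y z = (if fst (snd y) < N \<and> snd (snd y) < N \<and> fst (snd z) = snd (snd y) \<and> snd (snd z) = fst (snd y)
     then eta (fst y) (fst z) else 0)"

lemma lin_sym_bracket: "lin (sym_bracket_fun p eta s t)"
  by (rule linI) (simp_all add: sym_bracket_fun_def distrib_left splits_add mult.left_commute[of _ c for c] splits_mult)

lemma lin_cyc_bracket: "lin (cyc_bracket_fun p eta u v)"
  by (rule linI) (simp_all add: cyc_bracket_fun_def distrib_left splits_add mult.left_commute[of _ c for c] splits_mult)

lemma lin_BV: "lin (BV_fun p eta s)"
proof (rule linI)
  show "BV_fun p eta s (\<lambda>x. f x + g x) = BV_fun p eta s f + BV_fun p eta s g" for f g
    by (induction s arbitrary: f g) (simp_all add: lin_add[OF lin_sym_bracket] distrib_left)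
  show "BV_fun p eta s (\<lambda>x. c * f x) = c * BV_fun p eta s f" for c f
    by (induction s arbitrary: f) (simp_all add: lin_mult[OF lin_sym_bracket] distrib_left mult.left_commute)
qed

text \<open>In every nonzero term the contracted letters have opposite parities; with this the sign
  identities below become Boolean identities in the parities of the remaining blocks.\<close>

locale odd_form =
  fixes p :: "'x \<Rightarrow> bool" and eta :: "'x \<Rightarrow> 'x \<Rightarrow> 'k::field_char_0"
  assumes odd_form: "eta x y \<noteq> 0 \<Longrightarrow> p x \<noteq> p y"
begin

lemma odd_mat_eta: "mat_eta N eta y z \<noteq> 0 \<Longrightarrow> p (fst y) \<noteq> p (fst z)"
  using odd_form by (auto simp: mat_eta_def split: if_splits)

text \<open>Leibniz rule. If the contracted letter lies in s, the factor s' has to leave the middle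
  for the end, past what remains of t; this is where invariance of \<phi> enters.\<close>

lemma sym_bracket_append_left:
  assumes inv: "sinv p \<phi>"
  shows "sym_bracket_fun p eta (s @ s') t \<phi> =
    msgn (wpar p s' \<and> wpar p t) * sym_bracket_fun p eta s t (\<lambda>r. \<phi> (r @ s')) +
    msgn (wpar p s) * sym_bracket_fun p eta s' t (\<lambda>r. \<phi> (s @ r))"
proof -
  have 1: "msgn ((p x \<and> wpar p a) \<noteq> (p y \<and> wpar p (a @ (b @ s') @ c))) * eta x y * \<phi> (a @ (b @ s') @ c @ d) =
     msgn (wpar p s' \<and> wpar p t) * (msgn ((p x \<and> wpar p a) \<noteq> (p y \<and> wpar p (a @ b @ c))) * eta x y * \<phi> ((a @ b @ c @ d) @ s'))"
    if "t = c @ y # d" for a x b c y d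
  proof (cases "eta x y = 0")
    case False
    then have "p x = (\<not> p y)" using odd_form by blast
    moreover have "\<phi> (a @ (b @ s') @ c @ d) = msgn (wpar p s' \<and> wpar p (c @ d)) * \<phi> ((a @ b @ c @ d) @ s')"
      using sinv_swap[OF inv, of "a @ b" s' "c @ d" "[]"] by simp
    ultimately show ?thesis unfolding that
      by (simp only: wpar_append wpar_Cons)
        (cases "p y"; cases "wpar p a"; cases "wpar p b"; cases "wpar p c"; cases "wpar p d"; cases "wpar p s'"; simp add: msgn_def)
  qed simp
  have 2: "msgn ((p x \<and> wpar p (s @ a)) \<noteq> (p y \<and> wpar p ((s @ a) @ b @ c))) * eta x y * \<phi> ((s @ a) @ b @ c @ d) =
     msgn (wpar p s) * (msgn ((p x \<and> wpar p a) \<noteq> (p y \<and> wpar p (a @ b @ c))) * eta x y * \<phi> (s @ a @ b @ c @ d))"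
    for a x b c y d
  proof (cases "eta x y = 0")
    case False
    then have "p x = (\<not> p y)" using odd_form by blast
    then show ?thesis
      by (simp only: wpar_append append_assoc)
        (cases "p y"; cases "wpar p a"; cases "wpar p b"; cases "wpar p c"; cases "wpar p s"; simp add: msgn_def)
  qed simp
  show ?thesis
    unfolding sym_bracket_fun_def splits_append splits_mult[symmetric]
    by (intro arg_cong2[where f = "(+)"] splits_cong) (use 1 2 in \<open>simp_all only:\<close>)
qed

text \<open>Leibniz rule in the second argument. If the contraction meets t', the factor t is
  carried to the front past s and past the odd bracket, whence \<open>\<not> wpar p s\<close> in the
  sign.\<close>

lemma sym_bracket_append_right:
  assumes inv: "sinv p \<phi>"
  shows "sym_bracket_fun p eta s (t @ t') \<phi> =
    sym_bracket_fun p eta s t (\<lambda>r. \<phi> (r @ t')) +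
    msgn (wpar p t \<and> \<not> wpar p s) * sym_bracket_fun p eta s t' (\<lambda>r. \<phi> (t @ r))"
proof -
  have 1: "msgn ((p x \<and> wpar p a) \<noteq> (p y \<and> wpar p (a @ b @ (t @ c)))) * eta x y * \<phi> (a @ b @ (t @ c) @ d) =
     msgn (wpar p t \<and> \<not> wpar p s) * (msgn ((p x \<and> wpar p a) \<noteq> (p y \<and> wpar p (a @ b @ c))) * eta x y * \<phi> (t @ a @ b @ c @ d))"
    if "s = a @ x # b" for a x b c y d
  proof (cases "eta x y = 0")
    case False
    then have "p x = (\<not> p y)" using odd_form by blast
    moreover have "\<phi> (a @ b @ (t @ c) @ d) = msgn (wpar p (a @ b) \<and> wpar p t) * \<phi> (t @ a @ b @ c @ d)"
      using sinv_swap[OF inv, of "[]" "a @ b" t "c @ d"] by simp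
    ultimately show ?thesis unfolding that
      by (simp only: wpar_append wpar_Cons)
        (cases "p y"; cases "wpar p a"; cases "wpar p b"; cases "wpar p c"; cases "wpar p t"; simp add: msgn_def)
  qed simp
  have "sym_bracket_fun p eta s (t @ t') \<phi> =
      sym_bracket_fun p eta s t (\<lambda>r. \<phi> (r @ t')) +
      splits (\<lambda>a x b. splits (\<lambda>c y d. msgn ((p x \<and> wpar p a) \<noteq> (p y \<and> wpar p (a @ b @ (t @ c)))) * eta x y *
        \<phi> (a @ b @ (t @ c) @ d)) t') s"
    unfolding sym_bracket_fun_def splits_append splits_add by simp
  also have "splits (\<lambda>a x b. splits (\<lambda>c y d. msgn ((p x \<and> wpar p a) \<noteq> (p y \<and> wpar p (a @ b @ (t @ c)))) * eta x y *
        \<phi> (a @ b @ (t @ c) @ d)) t') s = msgn (wpar p t \<and> \<not> wpar p s) * sym_bracket_fun p eta s t' (\<lambda>r. \<phi> (t @ r))"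
    unfolding sym_bracket_fun_def splits_mult[symmetric]
    by (intro splits_cong) (use 1 in \<open>simp only:\<close>)
  finally show ?thesis .
qed

text \<open>The defining identity of the Laplacian, passed from a letter to words by induction: a
  contraction in the product lies within s, within t, or joins the two.\<close>

lemma BV_append:
  "BV_fun p eta (s @ t) \<phi> = BV_fun p eta s (\<lambda>r. \<phi> (r @ t)) + msgn (wpar p s) * BV_fun p eta t (\<lambda>r. \<phi> (s @ r)) +
    sym_bracket_fun p eta s t \<phi>"
proof (induction s arbitrary: \<phi>)
  case Nil
  then show ?case by (simp add: sym_bracket_fun_def)
next
  case (Cons x s)
  let ?X = "splits (\<lambda>c y d. msgn (p y \<and> wpar p (s @ c)) * eta x y * \<phi> (s @ c @ d)) t"
  have 1: "sym_bracket_fun p eta [x] (s @ t) \<phi> = sym_bracket_fun p eta [x] s (\<lambda>r. \<phi> (r @ t)) + ?X"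
    by (simp add: sym_bracket_fun_def splits_append)
  have 2: "sym_bracket_fun p eta (x # s) t \<phi> = ?X + msgn (p x) * sym_bracket_fun p eta s t (\<lambda>r. \<phi> (x # r))"
  proof -
    have "msgn ((p x' \<and> wpar p (x # a)) \<noteq> (p y \<and> wpar p ((x # a) @ b @ c))) * eta x' y * \<phi> ((x # a) @ b @ c @ d) =
       msgn (p x) * (msgn ((p x' \<and> wpar p a) \<noteq> (p y \<and> wpar p (a @ b @ c))) * eta x' y * \<phi> (x # a @ b @ c @ d))"
      for a x' b c y d
    proof (cases "eta x' y = 0")
      case False
      then have "p x' = (\<not> p y)" using odd_form by blast
      then show ?thesis
        by (simp only: wpar_append wpar_Cons append_Cons)
          (cases "p y"; cases "wpar p a"; cases "wpar p b"; cases "wpar p c"; cases "p x"; simp add: msgn_def)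
    qed simp
    then have "splits (\<lambda>a x' b. splits (\<lambda>c y d. msgn ((p x' \<and> wpar p (x # a)) \<noteq> (p y \<and> wpar p ((x # a) @ b @ c))) *
        eta x' y * \<phi> ((x # a) @ b @ c @ d)) t) s = msgn (p x) * sym_bracket_fun p eta s t (\<lambda>r. \<phi> (x # r))"
      by (simp only: sym_bracket_fun_def splits_mult)
    then show ?thesis
      unfolding sym_bracket_fun_def[of p eta "x # s"] splits_Cons
      by (simp only: wpar_Nil append_Nil simp_thms)
  qed
  show ?case
    by (simp add: Cons 1 2 distrib_left) (simp add: msgn_def)
qed

text \<open>An odd contraction only produces words of this parity, so a sign depending on the parity
  of the result is a constant factor.\<close>

lemma cyc_bracket_cong:
  assumes "\<And>r. (wpar p r \<longleftrightarrow> wpar p u = wpar p v) \<Longrightarrow> \<phi> r = \<psi> r"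
  shows "cyc_bracket_fun p eta u v \<phi> = cyc_bracket_fun p eta u v \<psi>"
  unfolding cyc_bracket_fun_def
proof (intro splits_cong)
  fix a x b c y d assume "u = a @ x # b" "v = c @ y # d"
  then have "eta x y \<noteq> 0 \<Longrightarrow> \<phi> (b @ a @ d @ c) = \<psi> (b @ a @ d @ c)"
    using odd_form[of x y] by (intro assms) auto
  then show "msgn (((p x \<and> wpar p a) \<noteq> (p y \<and> (wpar p a \<noteq> (wpar p b \<noteq> wpar p c)))) \<noteq>
       ((wpar p b \<and> wpar p a) \<noteq> (wpar p d \<and> wpar p c))) * eta x y * \<phi> (b @ a @ d @ c) =
     msgn (((p x \<and> wpar p a) \<noteq> (p y \<and> (wpar p a \<noteq> (wpar p b \<noteq> wpar p c)))) \<noteq>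
       ((wpar p b \<and> wpar p a) \<noteq> (wpar p d \<and> wpar p c))) * eta x y * \<psi> (b @ a @ d @ c)"
    by (cases "eta x y = 0") simp_all
qed

end

text \<open>Opening the closed paths at the contracted letters (x, e, f) and (y, g, h) leaves paths
  over \<open>b @ a\<close> from f to e and over \<open>d @ c\<close> from h to g. The form on
  matrix units forces g = f and h = e, so the two pieces close up to one path over
  \<open>b @ a @ d @ c\<close>.\<close>

lemma loops_cyc_bracket:
  assumes inv: "sinv (\<lambda>y. p (fst y)) \<phi>"
  shows "loops N u (\<lambda>s. loops N v (\<lambda>t. sym_bracket_fun (\<lambda>y. p (fst y)) (mat_eta N eta) s t \<phi>)) =
    cyc_bracket_fun p eta u v (\<lambda>r. loops N r \<phi>)"
proof -
  define S where "S a x b c y d = ((((p x \<and> wpar p a) \<noteq> (p y \<and> (wpar p a \<noteq> (wpar p b \<noteq> wpar p c)))) \<noteq>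
       ((wpar p b \<and> wpar p a) \<noteq> (wpar p d \<and> wpar p c))))" for a x b c y d
  define K where "K s X b t Y d = msgn ((p (fst X) \<and> wpar p (map fst s)) \<noteq> (p (fst Y) \<and> wpar p (map fst (s @ b @ t)))) *
      mat_eta N eta X Y * \<phi> (s @ b @ t @ d)" for s X b t Y d
  let ?E = "\<lambda>x e f c y d r. \<Sum>g<N. \<Sum>h<N. paths N (d @ c) h g (\<lambda>q. mat_eta N eta (x, e, f) (y, g, h) * \<phi> (r @ q))"
  \<comment> \<open>\<open>H\<close> is \<open>K\<close> after the second path has been rotated,
    with the block sign of c and d included.\<close>
  define H where "H s X b c Y d q =
      msgn (((p (fst X) \<and> wpar p (map fst s)) \<noteq> (p (fst Y) \<and> (wpar p (map fst s) \<noteq> (wpar p (map fst b) \<noteq> wpar p c)))) \<noteq>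
        (wpar p d \<and> wpar p c)) * (mat_eta N eta X Y * \<phi> (s @ b @ q))" for s X b c Y d q
  have inner: "loops N v (splits (K s X b)) =
      splits (\<lambda>c y d. \<Sum>g<N. \<Sum>h<N. paths N (d @ c) h g (H s X b c (y, g, h) d)) v" for s X b
  proof (rule loops_splits[where H = "H s X b"])
    fix c y d g h and t d' :: "('a \<times> nat \<times> nat) list" assume *: "v = c @ y # d" "map fst t = c" "map fst d' = d"
    have "\<phi> (s @ b @ t @ d') = msgn (wpar p c \<and> wpar p d) * \<phi> (s @ b @ d' @ t)"
      using sinv_swap[OF inv, of "s @ b" t d' "[]"] * by (simp add: wpar_fst)
    then show "K s X b t (y, g, h) d' = H s X b c (y, g, h) d (d' @ t)"
      unfolding K_def H_def using *(2)
      by (cases "p (fst X)"; cases "p y"; cases "wpar p (map fst s)"; cases "wpar p (map fst b)";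
          cases "wpar p c"; cases "wpar p d"; simp add: msgn_def)
  qed
  have "loops N u (\<lambda>s. loops N v (\<lambda>t. sym_bracket_fun (\<lambda>y. p (fst y)) (mat_eta N eta) s t \<phi>)) =
      loops N u (splits (\<lambda>s X b. loops N v (splits (K s X b))))"
    unfolding sym_bracket_fun_def K_def wpar_fst by (simp add: lin_splits[OF lin_loops])
  also have "\<dots> = splits (\<lambda>a x b. \<Sum>e<N. \<Sum>f<N. paths N (b @ a) f e (\<lambda>r.
      splits (\<lambda>c y d. msgn (S a x b c y d) * ?E x e f c y d r) v)) u"
  proof (rule loops_splits[where H = "\<lambda>a X b r. splits (\<lambda>c y d. msgn (S a (fst X) b c y d) *
        ?E (fst X) (fst (snd X)) (snd (snd X)) c y d r) v", unfolded fst_conv snd_conv])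
    fix a x b e f and s t :: "('a \<times> nat \<times> nat) list" assume u: "u = a @ x # b" and s: "map fst s = a" "map fst t = b"
    show "loops N v (splits (K s (x, e, f) t)) = splits (\<lambda>c y d. msgn (S a x b c y d) * ?E x e f c y d (t @ s)) v"
      unfolding inner
    proof (rule splits_cong)
      fix c y d
      have sw: "\<phi> (s @ t @ q) = msgn (wpar p b \<and> wpar p a) * \<phi> (t @ s @ q)" for q
        using sinv_swap[OF inv, of "[]" s t q] s by (simp add: wpar_fst conj_commute)
      have "msgn (((p x \<and> wpar p a) \<noteq> (p y \<and> (wpar p a \<noteq> (wpar p b \<noteq> wpar p c)))) \<noteq> (wpar p d \<and> wpar p c)) *
          (m * (msgn (wpar p b \<and> wpar p a) * k)) = msgn (S a x b c y d) * (m * k)" for m k :: 'b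
        unfolding S_def by (auto simp: msgn_def)
      then have "H s (x, e, f) t c (y, g, h) d =
          (\<lambda>q. msgn (S a x b c y d) * (mat_eta N eta (x, e, f) (y, g, h) * \<phi> ((t @ s) @ q)))" for g h
        by (simp add: H_def s sw fun_eq_iff)
      then show "(\<Sum>g<N. \<Sum>h<N. paths N (d @ c) h g (H s (x, e, f) t c (y, g, h) d)) = msgn (S a x b c y d) * ?E x e f c y d (t @ s)"
        by (simp add: lin_mult[OF lin_paths] sum_distrib_left)
    qed
  qed
  also have "\<dots> = splits (\<lambda>a x b. splits (\<lambda>c y d. msgn (S a x b c y d) * eta x y * loops N (b @ a @ d @ c) \<phi>) v) u"
  proof (rule splits_cong)
    fix a x b
    \<comment> \<open>The index conditions in \<open>mat_eta\<close> leave the single summand g = f,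
      h = e of the double sum.\<close>
    have E: "?E x e f c y d r = eta x y * paths N (d @ c) e f (\<lambda>q. \<phi> (r @ q))" if "e < N" "f < N" for e f c y d r
    proof -
      have "?E x e f c y d r = (\<Sum>g<N. \<Sum>h<N. if h = e then (if g = f then eta x y * paths N (d @ c) e f (\<lambda>q. \<phi> (r @ q)) else 0) else 0)"
        by (intro sum.cong refl) (use that in \<open>auto simp: lin_mult[OF lin_paths] lin_zero[OF lin_paths] mat_eta_def\<close>)
      then show ?thesis using that by simp
    qed
    have "(\<Sum>e<N. \<Sum>f<N. paths N (b @ a) f e (\<lambda>r. splits (\<lambda>c y d. msgn (S a x b c y d) * ?E x e f c y d r) v)) =
        (\<Sum>e<N. \<Sum>f<N. splits (\<lambda>c y d. msgn (S a x b c y d) * eta x y *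
          paths N (b @ a) f e (\<lambda>r. paths N (d @ c) e f (\<lambda>q. \<phi> (r @ q)))) v)"
      by (intro sum.cong refl, simp only: lessThan_iff E)
        (simp only: lin_splits[OF lin_paths] lin_mult[OF lin_paths] mult.assoc)
    also have "\<dots> = splits (\<lambda>c y d. msgn (S a x b c y d) * eta x y * 
        (\<Sum>e<N. \<Sum>f<N. paths N (b @ a) f e (\<lambda>r. paths N (d @ c) e f (\<lambda>q. \<phi> (r @ q))))) v"
      by (simp add: splits_sum sum_distrib_left)
    also have "\<dots> = splits (\<lambda>c y d. msgn (S a x b c y d) * eta x y * loops N (b @ a @ d @ c) \<phi>) v"
      using loops_append[of N "b @ a" "d @ c" \<phi> for d c] by (subst sum.swap) simp
    finally show "(\<Sum>e<N. \<Sum>f<N. paths N (b @ a) f e (\<lambda>r. splits (\<lambda>c y d. msgn (S a x b c y d) * ?E x e f c y d r) v)) =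
      splits (\<lambda>c y d. msgn (S a x b c y d) * eta x y * loops N (b @ a @ d @ c) \<phi>) v" .
  qed
  finally show ?thesis by (simp add: cyc_bracket_fun_def S_def)
qed

lemma splits_add_fun: "splits (\<lambda>a x b. f a x b + g a x b) = (\<lambda>w. splits f w + splits g w)"
  by (rule ext) (rule splits_add)

lemma splits_mult_fun: "splits (\<lambda>a x b. c * f a x b) = (\<lambda>w. c * splits f w)"
  by (rule ext) (rule splits_mult)

lemma lin_nc_bracket: "lin (nc_bracket_fun p eta U V)"
  by (rule linI)
    (simp_all add: nc_bracket_fun_def lin_add[OF lin_cyc_bracket] lin_mult[OF lin_cyc_bracket]
      distrib_left splits_add mult.left_commute[of _ c for c] splits_mult)

lemma lin_nc_delta: "lin (nc_delta_fun p eta U)"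
  by (rule linI)
    (simp_all add: nc_delta_fun_def lin_add[OF lin_cyc_bracket] lin_mult[OF lin_cyc_bracket]
      distrib_left splits_add_fun mult.left_commute[of _ c for c] splits_mult_fun)

lemma lin_cobracket: "lin (cobracket_fun p eta w)"
  by (rule linI)
    (simp_all add: cobracket_fun_def distrib_left splits_add_fun mult.left_commute[of _ c for c] splits_mult_fun)

lemma lin_nc_nabla: "lin (nc_nabla_fun p eta U)"
  by (rule linI)
    (simp_all add: nc_nabla_fun_def lin_add[OF lin_cobracket] lin_mult[OF lin_cobracket]
      distrib_left splits_add mult.left_commute[of _ c for c] splits_mult)

lemma sinv_loopss_right:
  assumes "sinv q \<phi>" shows "sinv q (\<lambda>r. loopss N W (\<lambda>t. \<phi> (r @ t)))"
  unfolding sinv_def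
proof (intro allI)
  fix a x y b
  have "\<phi> ((a @ x # y # b) @ t) = msgn (q x \<and> q y) * \<phi> ((a @ y # x # b) @ t)" for t
    using sinvD[OF assms, of a x y "b @ t"] by simp
  then show "loopss N W (\<lambda>t. \<phi> ((a @ x # y # b) @ t)) = msgn (q x \<and> q y) * loopss N W (\<lambda>t. \<phi> ((a @ y # x # b) @ t))"
    by (simp only: lin_mult[OF lin_loopss])
qed

context odd_form
begin

lemma odd_form_mat: "odd_form (\<lambda>y. p (fst y)) (mat_eta N eta)"
  by unfold_locales (rule odd_mat_eta)

text \<open>The spectator w passes the contracted word, whose parity is the same in all nonzero
  terms by oddness of the form.\<close>

lemma cyc_bracket_swap:
  assumes "sinv (\<lambda>y. p (fst y)) \<phi>"
  shows "cyc_bracket_fun p eta u v (\<lambda>r. loopss N (w # r # W) \<phi>) =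
    msgn (wpar p w \<and> (wpar p u = wpar p v)) * cyc_bracket_fun p eta u v (\<lambda>r. loopss N (r # w # W) \<phi>)"
  unfolding lin_mult[OF lin_cyc_bracket, symmetric]
proof (rule cyc_bracket_cong)
  fix r assume r: "wpar p r \<longleftrightarrow> wpar p u = wpar p v"
  have "sinv (wpar p) (\<lambda>W. loopss N W \<phi>)" using nc_inv_loopss[OF assms] by (simp add: nc_inv_def)
  from sinvD[OF this, of "[]" w r W]
  have "loopss N (w # r # W) \<phi> = msgn (wpar p w \<and> wpar p r) * loopss N (r # w # W) \<phi>"
    unfolding append_Nil .
  then show "loopss N (w # r # W) \<phi> = msgn (wpar p w \<and> (wpar p u = wpar p v)) * loopss N (r # w # W) \<phi>"
    unfolding r .
qed

text \<open>The right Leibniz rule peels off the first word v of the second factor. Either v is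
  contracted with u, and its successors are absorbed into the functional, or v is a spectator that
  has to pass the new word.\<close>

lemma loops_loopss_bracket:
  assumes "sinv (\<lambda>y. p (fst y)) \<phi>"
  shows "loops N u (\<lambda>s. loopss N V (\<lambda>t. sym_bracket_fun (\<lambda>y. p (fst y)) (mat_eta N eta) s t \<phi>)) =
    splits (\<lambda>C v D. msgn (wpar p v \<and> wpar (wpar p) C) *
      cyc_bracket_fun p eta u v (\<lambda>r. loopss N (r # C @ D) \<phi>)) V"
  using assms
proof (induction V arbitrary: \<phi>)
  case Nil
  then show ?case by (simp add: sym_bracket_fun_def lin_zero[OF lin_loops])
next
  case (Cons v V)
  note inv = Cons.prems
  let ?B = "sym_bracket_fun (\<lambda>y. p (fst y)) (mat_eta N eta)"
  have "loops N u (\<lambda>s. loopss N (v # V) (\<lambda>t. ?B s t \<phi>)) =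
      loops N u (\<lambda>s. loops N v (\<lambda>t. loopss N V (\<lambda>t'. ?B s t (\<lambda>r. \<phi> (r @ t')) +
        msgn (wpar p v \<and> \<not> wpar p u) * ?B s t' (\<lambda>r. \<phi> (t @ r)))))"
    unfolding loopss.simps
  proof (intro loops_cong loopss_cong)
    fix s t t' :: "('x \<times> nat \<times> nat) list" assume "map fst s = u" "map fst t = v"
    then show "?B s (t @ t') \<phi> = ?B s t (\<lambda>r. \<phi> (r @ t')) + msgn (wpar p v \<and> \<not> wpar p u) * ?B s t' (\<lambda>r. \<phi> (t @ r))"
      using odd_form.sym_bracket_append_right[OF odd_form_mat inv, of N s t t'] by (simp add: wpar_fst)
  qed
  also have "\<dots> = loops N u (\<lambda>s. loops N v (\<lambda>t. loopss N V (\<lambda>t'. ?B s t (\<lambda>r. \<phi> (r @ t'))))) +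
      msgn (wpar p v \<and> \<not> wpar p u) * loops N u (\<lambda>s. loops N v (\<lambda>t. loopss N V (\<lambda>t'. ?B s t' (\<lambda>r. \<phi> (t @ r)))))"
    by (simp only: lin_add[OF lin_loops] lin_add[OF lin_loopss] lin_mult[OF lin_loops] lin_mult[OF lin_loopss])
  also have "loops N u (\<lambda>s. loops N v (\<lambda>t. loopss N V (\<lambda>t'. ?B s t (\<lambda>r. \<phi> (r @ t'))))) =
      loops N u (\<lambda>s. loops N v (\<lambda>t. ?B s t (\<lambda>r. loopss N V (\<lambda>t'. \<phi> (r @ t')))))"
    by (intro loops_cong loopss_lin[OF lin_sym_bracket])
  also have "\<dots> = cyc_bracket_fun p eta u v (\<lambda>r. loopss N (r # V) \<phi>)"
    unfolding loopss.simps by (rule loops_cyc_bracket[OF sinv_loopss_right[OF inv]])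
  also have "loops N u (\<lambda>s. loops N v (\<lambda>t. loopss N V (\<lambda>t'. ?B s t' (\<lambda>r. \<phi> (t @ r))))) =
      loops N v (\<lambda>t. loops N u (\<lambda>s. loopss N V (\<lambda>t'. ?B s t' (\<lambda>r. \<phi> (t @ r)))))"
    by (rule loops_lin[OF lin_loops])
  also have "\<dots> = loops N v (\<lambda>t. splits (\<lambda>C v' D. msgn (wpar p v' \<and> wpar (wpar p) C) *
      cyc_bracket_fun p eta u v' (\<lambda>r. loopss N (r # C @ D) (\<lambda>q. \<phi> (t @ q)))) V)"
    by (intro loops_cong Cons.IH sinv_append_left inv)
  also have "\<dots> = splits (\<lambda>C v' D. msgn (wpar p v' \<and> wpar (wpar p) C) *
      cyc_bracket_fun p eta u v' (\<lambda>r. loopss N (v # r # C @ D) \<phi>)) V"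
    unfolding lin_splits[OF lin_loops] lin_mult[OF lin_loops] loops_lin[OF lin_cyc_bracket] loopss.simps(2)[of N v] ..
  also have "msgn (wpar p v \<and> \<not> wpar p u) * \<dots> = splits (\<lambda>C v' D. msgn (wpar p v' \<and> wpar (wpar p) (v # C)) *
      cyc_bracket_fun p eta u v' (\<lambda>r. loopss N (r # (v # C) @ D) \<phi>)) V"
    unfolding splits_mult[symmetric] append_Cons cyc_bracket_swap[OF inv]
    by (intro splits_cong)
      (simp only: mult.assoc[symmetric] msgn_mult, intro arg_cong2[where f = "(*)"] arg_cong[where f = msgn] refl, auto)
  finally show ?case by simp
qed

text \<open>The left Leibniz rule peels off the first word u. When u is contracted, the other words
  of U end up behind what remains of V, and moving them in front of it gives the order used in
  \<open>nc_bracket\<close>.\<close>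

theorem loopss_bracket:
  assumes "sinv (\<lambda>y. p (fst y)) \<phi>"
  shows "loopss N U (\<lambda>s. loopss N V (\<lambda>t. sym_bracket_fun (\<lambda>y. p (fst y)) (mat_eta N eta) s t \<phi>)) =
    nc_bracket_fun p eta U V (\<lambda>W. loopss N W \<phi>)"
  using assms
proof (induction U arbitrary: \<phi>)
  case Nil
  then show ?case by (simp add: sym_bracket_fun_def nc_bracket_fun_def lin_zero[OF lin_loopss])
next
  case (Cons u U)
  note inv = Cons.prems
  let ?B = "sym_bracket_fun (\<lambda>y. p (fst y)) (mat_eta N eta)"
  let ?W = "wpar (wpar p)"
  have "loopss N (u # U) (\<lambda>s. loopss N V (\<lambda>t. ?B s t \<phi>)) =
      loops N u (\<lambda>s. loopss N U (\<lambda>s'. loopss N V (\<lambda>t. msgn (?W U \<and> ?W V) * ?B s t (\<lambda>r. \<phi> (r @ s')) +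
        msgn (wpar p u) * ?B s' t (\<lambda>r. \<phi> (s @ r)))))"
    unfolding loopss.simps
  proof (intro loops_cong loopss_cong)
    fix s s' t :: "('x \<times> nat \<times> nat) list" assume "map fst s = u" "map fst s' = concat U" "map fst t = concat V"
    then show "?B (s @ s') t \<phi> = msgn (?W U \<and> ?W V) * ?B s t (\<lambda>r. \<phi> (r @ s')) + msgn (wpar p u) * ?B s' t (\<lambda>r. \<phi> (s @ r))"
      using odd_form.sym_bracket_append_left[OF odd_form_mat inv, of N s s' t] by (simp add: wpar_fst wpar_concat)
  qed
  also have "\<dots> = msgn (?W U \<and> ?W V) * loops N u (\<lambda>s. loopss N U (\<lambda>s'. loopss N V (\<lambda>t. ?B s t (\<lambda>r. \<phi> (r @ s'))))) +
      msgn (wpar p u) * loops N u (\<lambda>s. loopss N U (\<lambda>s'. loopss N V (\<lambda>t. ?B s' t (\<lambda>r. \<phi> (s @ r)))))"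
    by (simp only: lin_add[OF lin_loops] lin_add[OF lin_loopss] lin_mult[OF lin_loops] lin_mult[OF lin_loopss])
  also have "loops N u (\<lambda>s. loopss N U (\<lambda>s'. loopss N V (\<lambda>t. ?B s' t (\<lambda>r. \<phi> (s @ r))))) =
      loops N u (\<lambda>s. nc_bracket_fun p eta U V (\<lambda>W. loopss N W (\<lambda>r. \<phi> (s @ r))))"
    by (intro loops_cong Cons.IH sinv_append_left inv)
  also have "\<dots> = nc_bracket_fun p eta U V (\<lambda>W. loopss N (u # W) \<phi>)"
    unfolding loops_lin[OF lin_nc_bracket] loopss.simps(2)[of N u] ..
  also have "msgn (wpar p u) * \<dots> = splits (\<lambda>A u' B. splits (\<lambda>C v D.
     msgn ((wpar p u' \<and> ?W (u # A)) \<noteq> (wpar p v \<and> ?W ((u # A) @ B @ C))) *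
       cyc_bracket_fun p eta u' v (\<lambda>r. loopss N (r # (u # A) @ B @ C @ D) \<phi>)) V) U"
    unfolding nc_bracket_fun_def splits_mult[symmetric] append_Cons cyc_bracket_swap[OF inv]
    by (intro splits_cong)
      (simp only: mult.assoc[symmetric] msgn_mult, intro arg_cong2[where f = "(*)"] arg_cong[where f = msgn] refl, auto)
  also have "loops N u (\<lambda>s. loopss N U (\<lambda>s'. loopss N V (\<lambda>t. ?B s t (\<lambda>r. \<phi> (r @ s'))))) =
      loops N u (\<lambda>s. loopss N V (\<lambda>t. loopss N U (\<lambda>s'. ?B s t (\<lambda>r. \<phi> (r @ s')))))"
    by (intro loops_cong loopss_lin[OF lin_loopss])
  also have "\<dots> = loops N u (\<lambda>s. loopss N V (\<lambda>t. ?B s t (\<lambda>r. loopss N U (\<lambda>s'. \<phi> (r @ s')))))"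
    by (intro loops_cong loopss_cong loopss_lin[OF lin_sym_bracket])
  also have "\<dots> = splits (\<lambda>C v D. msgn (wpar p v \<and> ?W C) *
      cyc_bracket_fun p eta u v (\<lambda>r. loopss N (r # C @ D) (\<lambda>r. loopss N U (\<lambda>s'. \<phi> (r @ s'))))) V"
    by (rule loops_loopss_bracket[OF sinv_loopss_right[OF inv]])
  also have "\<dots> = splits (\<lambda>C v D. msgn (wpar p v \<and> ?W C) *
      (msgn (?W (C @ D) \<and> ?W U) * cyc_bracket_fun p eta u v (\<lambda>r. loopss N (r # U @ C @ D) \<phi>))) V"
  proof (intro splits_cong arg_cong2[where f = "(*)"] refl)
    fix C v D
    have "sinv (wpar p) (\<lambda>W. loopss N W \<phi>)" using nc_inv_loopss[OF inv] by (simp add: nc_inv_def)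
    from sinv_swap[OF this, of "[_]" "C @ D" U "[]"]
    have "loopss N (r # C @ D @ U) \<phi> = msgn (?W (C @ D) \<and> ?W U) * loopss N (r # U @ C @ D) \<phi>" for r
      unfolding append_Cons append_Nil append_Nil2 append_assoc .
    moreover have "loopss N (r # C @ D) (\<lambda>r. loopss N U (\<lambda>s'. \<phi> (r @ s'))) = loopss N (r # C @ D @ U) \<phi>" for r
      using loopss_append[of N "r # C @ D" U \<phi>] by simp
    ultimately show "cyc_bracket_fun p eta u v (\<lambda>r. loopss N (r # C @ D) (\<lambda>r. loopss N U (\<lambda>s'. \<phi> (r @ s')))) =
        msgn (?W (C @ D) \<and> ?W U) * cyc_bracket_fun p eta u v (\<lambda>r. loopss N (r # U @ C @ D) \<phi>)"
      by (simp only: lin_mult[OF lin_cyc_bracket])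
  qed
  also have "msgn (?W U \<and> ?W V) * \<dots> = splits (\<lambda>C v D. msgn ((wpar p u \<and> ?W []) \<noteq> (wpar p v \<and> ?W ([] @ U @ C))) *
      cyc_bracket_fun p eta u v (\<lambda>r. loopss N (r # [] @ U @ C @ D) \<phi>)) V"
    unfolding splits_mult[symmetric] append_Nil
    by (intro splits_cong)
      (simp only: mult.assoc[symmetric] msgn_mult, intro arg_cong2[where f = "(*)"] arg_cong[where f = msgn] refl, auto)
  finally show ?case by (simp only: nc_bracket_fun_def[of p eta "u # U"] splits_Cons)
qed

text \<open>Unfolding the recursion over the first letter: the Laplacian contracts every pair of
  positions once, with the sign of bringing both letters to the front.\<close>

lemma BV_splits:
  "BV_fun p eta s \<phi> = splits (\<lambda>a x. splits (\<lambda>b y c.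
     msgn ((p x \<and> wpar p a) \<noteq> (p y \<and> (wpar p a \<noteq> wpar p b))) * (eta x y * \<phi> (a @ b @ c)))) s"
proof (induction s arbitrary: \<phi>)
  case (Cons x s)
  have "msgn (p x) * (msgn ((p x' \<and> wpar p a) \<noteq> (p y \<and> (wpar p a \<noteq> wpar p b))) * (eta x' y * k)) =
      msgn ((p x' \<and> wpar p (x # a)) \<noteq> (p y \<and> (wpar p (x # a) \<noteq> wpar p b))) * (eta x' y * k)" for x' a y b k
  proof (cases "eta x' y = 0")
    case False
    then have "p x' = (\<not> p y)" using odd_form by blast
    then show ?thesis
      by (simp only: wpar_Cons) (cases "p y"; cases "wpar p a"; cases "wpar p b"; cases "p x"; simp add: msgn_def)
  qed simp
  then have "msgn (p x) * BV_fun p eta s (\<lambda>r. \<phi> (x # r)) = splits (\<lambda>a x'. splits (\<lambda>b y c.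
      msgn ((p x' \<and> wpar p (x # a)) \<noteq> (p y \<and> (wpar p (x # a) \<noteq> wpar p b))) * (eta x' y * \<phi> ((x # a) @ b @ c)))) s"
    unfolding Cons splits_mult[symmetric] by (simp only: append_Cons)
  then show ?case
    unfolding splits_Cons BV_fun.simps by (simp add: sym_bracket_fun_def mult.assoc add.commute)
qed simp

text \<open>With the contracted letters (x, e, f) and (y, g, h) removed, the form forces g = f and h
  = e. The part b between them closes up at f, while d from e to c and a from c to e form a closed
  path over \<open>d @ a\<close>. If b is empty, its free index f yields the factor N of the image
  of \<nu>.\<close>

lemma loops_cobracket:
  assumes inv: "sinv (\<lambda>y. p (fst y)) \<phi>"
  shows "loops N w (\<lambda>s. BV_fun (\<lambda>y. p (fst y)) (mat_eta N eta) s \<phi>) = cobracket_fun p eta w (\<lambda>R. loopss N R \<phi>)"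
proof -
  define K where "K s X b Y d = msgn ((p (fst X) \<and> wpar p (map fst s)) \<noteq> (p (fst Y) \<and> (wpar p (map fst s) \<noteq> wpar p (map fst b)))) *
      (mat_eta N eta X Y * \<phi> (s @ b @ d))" for s X b Y d
  let ?T = "\<lambda>a x b y d. msgn ((p x \<and> wpar p a) \<noteq> (p y \<and> (wpar p a \<noteq> wpar p b))) * eta x y * msgn ((wpar p b \<noteq> wpar p d) \<and> wpar p a)"
  have BV: "BV_fun (\<lambda>y. p (fst y)) (mat_eta N eta) s \<phi> = splits (\<lambda>s X. splits (K s X)) s" for s
    unfolding odd_form.BV_splits[OF odd_form_mat] K_def wpar_fst ..
  have "loops N w (\<lambda>s. BV_fun (\<lambda>y. p (fst y)) (mat_eta N eta) s \<phi>) =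
      splits (\<lambda>a x r. \<Sum>c<N. \<Sum>e<N. \<Sum>f<N. paths N a c e (\<lambda>s. paths N r f c (splits (K s (x, e, f))))) w"
    unfolding BV loops_def by (simp add: paths_splits splits_sum)
  also have "\<dots> = splits (\<lambda>a x r. splits (\<lambda>b y d. ?T a x b y d * loopss N [b, d @ a] \<phi>) r) w"
  proof (rule splits_cong)
    fix a x r
    have "(\<Sum>c<N. \<Sum>e<N. \<Sum>f<N. paths N a c e (\<lambda>s. paths N r f c (splits (K s (x, e, f))))) =
        (\<Sum>c<N. \<Sum>e<N. \<Sum>f<N. splits (\<lambda>b y d. ?T a x b y d *
          paths N a c e (\<lambda>s. paths N b f f (\<lambda>s'. paths N d e c (\<lambda>t'. \<phi> (s' @ t' @ s))))) r)"
    proof (intro sum.cong refl)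
      fix c e f assume "c \<in> {..<N}" "e \<in> {..<N}" "f \<in> {..<N}"
      then have e: "e < N" and f: "f < N" by auto
      have "paths N a c e (\<lambda>s. paths N r f c (splits (K s (x, e, f)))) =
          paths N a c e (\<lambda>s. splits (\<lambda>b y d. ?T a x b y d * paths N b f f (\<lambda>s'. paths N d e c (\<lambda>t'. \<phi> (s' @ t' @ s)))) r)"
      proof (rule paths_cong)
        fix s :: "('x \<times> nat \<times> nat) list" assume s: "map fst s = a"
        show "paths N r f c (splits (K s (x, e, f))) =
            splits (\<lambda>b y d. ?T a x b y d * paths N b f f (\<lambda>s'. paths N d e c (\<lambda>t'. \<phi> (s' @ t' @ s)))) r"
          unfolding paths_splits[OF f]
        proof (rule splits_cong)
          fix b y d
          have "paths N b f g (\<lambda>s'. paths N d h c (K s (x, e, f) s' (y, g, h))) =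
              (if h = e then if g = f then ?T a x b y d * paths N b f f (\<lambda>s'. paths N d e c (\<lambda>t'. \<phi> (s' @ t' @ s))) else 0 else 0)"
            for g h
          proof -
            have "paths N b f g (\<lambda>s'. paths N d h c (K s (x, e, f) s' (y, g, h))) =
                paths N b f g (\<lambda>s'. paths N d h c (\<lambda>t'. 
                  (if h = e \<and> g = f then ?T a x b y d else 0) * \<phi> (s' @ t' @ s)))"
            proof (intro paths_cong)
              fix s' t' :: "('x \<times> nat \<times> nat) list" assume "map fst s' = b" "map fst t' = d"
              then show "K s (x, e, f) s' (y, g, h) t' = (if h = e \<and> g = f then ?T a x b y d else 0) * \<phi> (s' @ t' @ s)"
                using sinv_swap[OF inv, of "[]" s "s' @ t'" "[]"] s e f
                by (auto simp: K_def mat_eta_def wpar_fst conj_commute)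
            qed
            also have "\<dots> = (if h = e \<and> g = f then ?T a x b y d else 0) *
                paths N b f g (\<lambda>s'. paths N d h c (\<lambda>t'. \<phi> (s' @ t' @ s)))"
              by (simp only: lin_mult[OF lin_paths])
            finally show ?thesis by simp
          qed
          then show "(\<Sum>g<N. \<Sum>h<N. paths N b f g (\<lambda>s'. paths N d h c (K s (x, e, f) s' (y, g, h)))) =
              ?T a x b y d * paths N b f f (\<lambda>s'. paths N d e c (\<lambda>t'. \<phi> (s' @ t' @ s)))"
            using e f by simp
        qed
      qed
      then show "paths N a c e (\<lambda>s. paths N r f c (splits (K s (x, e, f)))) =
          splits (\<lambda>b y d. ?T a x b y d * paths N a c e (\<lambda>s. paths N b f f (\<lambda>s'. paths N d e c (\<lambda>t'. \<phi> (s' @ t' @ s))))) r"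
        by (simp only: lin_splits[OF lin_paths] lin_mult[OF lin_paths])
    qed
    also have "\<dots> = splits (\<lambda>b y d. ?T a x b y d * (\<Sum>c<N. \<Sum>e<N. \<Sum>f<N.
          paths N a c e (\<lambda>s. paths N b f f (\<lambda>s'. paths N d e c (\<lambda>t'. \<phi> (s' @ t' @ s)))))) r"
      by (simp only: splits_sum sum_distrib_left)
    also have "\<dots> = splits (\<lambda>b y d. ?T a x b y d * loopss N [b, d @ a] \<phi>) r"
    proof (intro splits_cong arg_cong2[where f = "(*)"] refl)
      fix b d
      have "(\<Sum>c<N. \<Sum>e<N. \<Sum>f<N. paths N a c e (\<lambda>s. paths N b f f (\<lambda>s'. paths N d e c (\<lambda>t'. \<phi> (s' @ t' @ s))))) =
          (\<Sum>c<N. \<Sum>e<N. \<Sum>f<N. paths N b f f (\<lambda>s'. paths N a c e (\<lambda>s. paths N d e c (\<lambda>t'. \<phi> (s' @ t' @ s)))))"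
        by (intro sum.cong refl paths_lin[OF lin_paths])
      also have "\<dots> = (\<Sum>c<N. \<Sum>e<N. \<Sum>f<N. paths N b f f (\<lambda>s'. paths N d e c (\<lambda>t'. paths N a c e (\<lambda>s. \<phi> (s' @ t' @ s)))))"
        by (intro sum.cong refl paths_cong paths_lin[OF lin_paths])
      also have "\<dots> = loops N b (\<lambda>s'. \<Sum>c<N. \<Sum>e<N. paths N d e c (\<lambda>t'. paths N a c e (\<lambda>s. \<phi> (s' @ t' @ s))))"
        by (simp only: lin_sum[OF lin_loops]) (simp only: loops_def)
      also have "\<dots> = loops N b (\<lambda>s'. loops N (d @ a) (\<lambda>q. \<phi> (s' @ q)))"
        unfolding loops_append by (intro loops_cong, subst sum.swap) simp
      finally show "(\<Sum>c<N. \<Sum>e<N. \<Sum>f<N. paths N a c e (\<lambda>s. paths N b f f (\<lambda>s'. paths N d e c (\<lambda>t'. \<phi> (s' @ t' @ s))))) =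
          loopss N [b, d @ a] \<phi>" by simp
    qed
    finally show "(\<Sum>c<N. \<Sum>e<N. \<Sum>f<N. paths N a c e (\<lambda>s. paths N r f c (splits (K s (x, e, f))))) =
        splits (\<lambda>b y d. ?T a x b y d * loopss N [b, d @ a] \<phi>) r" .
  qed
  also have "\<dots> = cobracket_fun p eta w (\<lambda>R. loopss N R \<phi>)"
  proof -
    have "msgn A * k * msgn B = msgn (A \<noteq> B) * k" for A B and k :: 'k by (auto simp: msgn_def)
    then show ?thesis unfolding cobracket_fun_def by (simp only:)
  qed
  finally show ?thesis .
qed

text \<open>A pair of contracted letters lies in the first word, in the later words, or has one
  letter in each. The three cases give the cobracket of the first word, the induction hypothesis,
  and the brackets of the first word with the others.\<close>

theorem loopss_BV:
  assumes "sinv (\<lambda>y. p (fst y)) \<phi>"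
  shows "loopss N W (\<lambda>s. BV_fun (\<lambda>y. p (fst y)) (mat_eta N eta) s \<phi>) =
    nc_delta_fun p eta W (\<lambda>V. loopss N V \<phi>) + nc_nabla_fun p eta W (\<lambda>V. loopss N V \<phi>)"
  using assms
proof (induction W arbitrary: \<phi>)
  case Nil
  then show ?case by (simp add: nc_delta_fun_def nc_nabla_fun_def)
next
  case (Cons w W)
  note inv = Cons.prems
  let ?D = "BV_fun (\<lambda>y. p (fst y)) (mat_eta N eta)"
  let ?B = "sym_bracket_fun (\<lambda>y. p (fst y)) (mat_eta N eta)"
  let ?W = "wpar (wpar p)"
  have "loopss N (w # W) (\<lambda>s. ?D s \<phi>) =
      loops N w (\<lambda>s. loopss N W (\<lambda>t. ?D s (\<lambda>r. \<phi> (r @ t)) + msgn (wpar p w) * ?D t (\<lambda>r. \<phi> (s @ r)) + ?B s t \<phi>))"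
    unfolding loopss.simps odd_form.BV_append[OF odd_form_mat] wpar_fst
    by (intro loops_cong loopss_cong) simp
  also have "\<dots> = loops N w (\<lambda>s. loopss N W (\<lambda>t. ?D s (\<lambda>r. \<phi> (r @ t)))) +
      msgn (wpar p w) * loops N w (\<lambda>s. loopss N W (\<lambda>t. ?D t (\<lambda>r. \<phi> (s @ r)))) +
      loops N w (\<lambda>s. loopss N W (\<lambda>t. ?B s t \<phi>))"
    by (simp only: lin_add[OF lin_loops] lin_add[OF lin_loopss] lin_mult[OF lin_loops] lin_mult[OF lin_loopss])
  also have "loops N w (\<lambda>s. loopss N W (\<lambda>t. ?D s (\<lambda>r. \<phi> (r @ t)))) =
      loops N w (\<lambda>s. ?D s (\<lambda>r. loopss N W (\<lambda>t. \<phi> (r @ t))))"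
    by (intro loops_cong loopss_lin[OF lin_BV])
  also have "\<dots> = cobracket_fun p eta w (\<lambda>R. loopss N R (\<lambda>r. loopss N W (\<lambda>t. \<phi> (r @ t))))"
    by (rule loops_cobracket[OF sinv_loopss_right[OF inv]])
  also have "\<dots> = cobracket_fun p eta w (\<lambda>R. loopss N (R @ W) \<phi>)"
    unfolding loopss_append ..
  also have "loops N w (\<lambda>s. loopss N W (\<lambda>t. ?D t (\<lambda>r. \<phi> (s @ r)))) =
      loops N w (\<lambda>s. nc_delta_fun p eta W (\<lambda>V. loopss N V (\<lambda>r. \<phi> (s @ r))) +
        nc_nabla_fun p eta W (\<lambda>V. loopss N V (\<lambda>r. \<phi> (s @ r))))"
    by (intro loops_cong Cons.IH sinv_append_left inv)
  also have "\<dots> = nc_delta_fun p eta W (\<lambda>V. loopss N (w # V) \<phi>) + nc_nabla_fun p eta W (\<lambda>V. loopss N (w # V) \<phi>)"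
    unfolding lin_add[OF lin_loops] loops_lin[OF lin_nc_delta] loops_lin[OF lin_nc_nabla] loopss.simps(2)[of N w] ..
  also have "msgn (wpar p w) * \<dots> = splits (\<lambda>A u. splits (\<lambda>B v C.
     msgn ((wpar p u \<and> ?W (w # A)) \<noteq> (wpar p v \<and> (?W (w # A) \<noteq> ?W B))) *
       cyc_bracket_fun p eta u v (\<lambda>r. loopss N (r # (w # A) @ B @ C) \<phi>))) W +
     splits (\<lambda>A u B. msgn (?W (w # A)) * cobracket_fun p eta u (\<lambda>r. loopss N ((w # A) @ r @ B) \<phi>)) W"
    unfolding nc_delta_fun_def nc_nabla_fun_def distrib_left splits_mult[symmetric] append_Cons cyc_bracket_swap[OF inv]
    by (intro arg_cong2[where f = "(+)"] splits_cong)
      (simp_all only: mult.assoc[symmetric] msgn_mult, (intro arg_cong2[where f = "(*)"] arg_cong[where f = msgn] refl, auto)+)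
  also have "loops N w (\<lambda>s. loopss N W (\<lambda>t. ?B s t \<phi>)) =
      splits (\<lambda>B v C. msgn (wpar p v \<and> ?W B) * cyc_bracket_fun p eta w v (\<lambda>r. loopss N (r # B @ C) \<phi>)) W"
    by (rule loops_loopss_bracket[OF inv])
  finally show ?case
    by (simp only: nc_delta_fun_def[of p eta "w # W"] nc_nabla_fun_def[of p eta "w # W"] splits_Cons) simp
qed

end

section \<open>Local finiteness of the map on infinite combinations\<close>

section \<open>Passing to infinite combinations\<close>

definition word_box :: "'x set \<Rightarrow> nat \<Rightarrow> 'x list set" where
  "word_box C n = {w. set w \<subseteq> C \<and> length w \<le> n}"

definition nc_box :: "'x set \<Rightarrow> nat \<Rightarrow> 'x list list set" where
  "nc_box C n = {W. set W \<subseteq> word_box C n \<and> length W \<le> n}"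

lemma finite_word_box: "finite C \<Longrightarrow> finite (word_box C n)"
  unfolding word_box_def by (rule finite_lists_length_le)

lemma finite_nc_box: "finite C \<Longrightarrow> finite (nc_box C n)"
  unfolding nc_box_def by (rule finite_lists_length_le) (rule finite_word_box)

text \<open>A bound on the total number of letters bounds every single word; the number of words
  needs a bound of its own because of empty words.\<close>

lemma nc_boxI: 
  assumes "set (concat W) \<subseteq> C" "length W \<le> n" "length (concat W) \<le> n"
  shows "W \<in> nc_box C n"
proof -
  have "length u \<le> length (concat W)" if "u \<in> set W" for u
    using that by (auto simp: in_set_conv_decomp)
  then show ?thesis using assms by (fastforce simp: nc_box_def word_box_def)
qed

lemma mon_nonzero: "mon 1 u v \<noteq> (0 :: 'k::field_char_0) \<longleftrightarrow> v = u"
  by (simp add: mon_def)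

lemma finsupp_pairing:
  assumes "finsupp \<phi>" "\<And>w. finite {u. T u w \<noteq> 0}"
  shows "finsupp (\<lambda>u. pairing (T u) \<phi>)"
proof (rule finsupp_bounded)
  show "finite (\<Union>w\<in>{w. \<phi> w \<noteq> 0}. {u. T u w \<noteq> 0})"
    using assms by (auto simp: finsupp_def)
  fix u assume "pairing (T u) \<phi> \<noteq> 0"
  then obtain w where "w \<in> {w. \<phi> w \<noteq> 0}" "T u w * \<phi> w \<noteq> 0"
    unfolding pairing_supp[OF assms(1)] by (rule sum.not_neutral_contains_not_neutral)
  then show "u \<in> (\<Union>w\<in>{w. \<phi> w \<noteq> 0}. {u. T u w \<noteq> 0})" by auto
qed

lemma pairing_add_right:
  assumes "finsupp \<phi>" "finsupp \<psi>"
  shows "pairing f (\<lambda>w. \<phi> w + \<psi> w) = pairing f \<phi> + pairing f \<psi>"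
proof -
  let ?S = "{w. \<phi> w \<noteq> 0} \<union> {w. \<psi> w \<noteq> 0}"
  have "finite ?S" using assms by (simp add: finsupp_def)
  then have "pairing f \<chi> = (\<Sum>w\<in>?S. f w * \<chi> w)" if "\<And>w. w \<notin> ?S \<Longrightarrow> \<chi> w = 0" for \<chi>
    using that by (intro pairing_eq_sum) auto
  then show ?thesis by (simp add: sum.distrib distrib_left)
qed

text \<open>Finite support on the left makes the pairing linear on all functionals, even those of
  infinite support, as \<open>loopss_lin\<close> requires.\<close>

lemma lin_pairing:
  assumes "finsupp f" shows "lin (pairing f)"
proof -
  have "pairing f \<phi> = (\<Sum>w | f w \<noteq> 0. f w * \<phi> w)" for \<phi>
    using assms by (intro pairing_eq_sum') (auto simp: finsupp_def)
  then show ?thesis by (intro linI) (simp_all add: sum.distrib distrib_left sum_distrib_left mult_ac)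
qed

lemma paths_support:
  "c < N \<Longrightarrow> d < N \<Longrightarrow> paths N w c d \<phi> \<noteq> 0 \<Longrightarrow> \<exists>v. \<phi> v \<noteq> 0 \<and> map fst v = w \<and> snd ` set v \<subseteq> {..<N} \<times> {..<N}"
proof (induction w arbitrary: c \<phi>)
  case Nil
  then show ?case by (auto split: if_splits)
next
  case (Cons x w)
  then obtain e where e: "e \<in> {..<N}" "paths N w e d (\<lambda>v. \<phi> ((x, c, e) # v)) \<noteq> 0"
    by (auto elim: sum.not_neutral_contains_not_neutral)
  then obtain v where "\<phi> ((x, c, e) # v) \<noteq> 0" "map fst v = w" "snd ` set v \<subseteq> {..<N} \<times> {..<N}"
    using Cons.IH[of e "\<lambda>v. \<phi> ((x, c, e) # v)"] Cons.prems by auto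
  then show ?case using e(1) Cons.prems by (intro exI[of _ "(x, c, e) # v"]) auto
qed

lemma loops_support:
  assumes "loops N w \<phi> \<noteq> 0"
  shows "\<exists>v. \<phi> v \<noteq> 0 \<and> map fst v = w \<and> snd ` set v \<subseteq> {..<N} \<times> {..<N}"
proof -
  from assms obtain c where "c \<in> {..<N}" "paths N w c c \<phi> \<noteq> 0"
    unfolding loops_def by (rule sum.not_neutral_contains_not_neutral)
  then show ?thesis using paths_support by auto
qed

lemma loopss_support:
  "loopss N W \<phi> \<noteq> 0 \<Longrightarrow> \<exists>v. \<phi> v \<noteq> 0 \<and> map fst v = concat W \<and> snd ` set v \<subseteq> {..<N} \<times> {..<N}"
proof (induction W arbitrary: \<phi>)
  case (Cons w W)
  from Cons.prems obtain s where s: "loopss N W (\<lambda>t. \<phi> (s @ t)) \<noteq> 0" "map fst s = w" "snd ` set s \<subseteq> {..<N} \<times> {..<N}"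
    using loops_support by fastforce
  from Cons.IH[OF s(1)] obtain t where "\<phi> (s @ t) \<noteq> 0" "map fst t = concat W" "snd ` set t \<subseteq> {..<N} \<times> {..<N}"
    by blast
  then show ?case using s by (intro exI[of _ "s @ t"]) auto
qed auto

lemma M_words_support:
  assumes "catprod (map (M_word N) W) v \<noteq> (0 :: 'k::field_char_0)"
  shows "map fst v = concat W \<and> snd ` set v \<subseteq> {..<N} \<times> {..<N}"
proof -
  have "loopss N W (mon 1 v) \<noteq> (0 :: 'k)"
    using pairing_M_words[of "mon 1 v :: _ \<Rightarrow> 'k" N W] assms by simp
  then show ?thesis using loopss_support by (force simp: mon_nonzero)
qed

text \<open>A word is a concatenation of words in infinitely many ways, since empty factors can be
  inserted. A bound on the number of factors, available on a direct sum, restores local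
  finiteness.\<close>

definition bounded_words :: "nat \<Rightarrow> ('x list list \<Rightarrow> 'k::field_char_0) \<Rightarrow> bool" where
  "bounded_words K f \<longleftrightarrow> (\<forall>W. f W \<noteq> 0 \<longrightarrow> length W \<le> K)"

lemma finite_concat: "finite {W. concat W = v \<and> length W \<le> K}"
proof (rule finite_subset)
  show "{W. concat W = v \<and> length W \<le> K} \<subseteq> nc_box (set v) (max K (length v))"
    by (auto intro!: nc_boxI)
qed (simp add: finite_nc_box)

lemma pairing_LQT:
  fixes f :: "'x list list \<Rightarrow> 'k::field_char_0"
  assumes "bounded_words K f" and fin: "finsupp \<phi>"
  shows "pairing (LQT_map N f) \<phi> = pairing f (\<lambda>W. loopss N W \<phi>)"
proof -
  have "finite {W. f W \<noteq> 0 \<and> catprod (map (M_word N) W) v \<noteq> (0 :: 'k)}" for v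
    by (rule finite_subset[OF _ finite_concat[of "map fst v" K]])
      (use assms(1) in \<open>auto simp: bounded_words_def dest: M_words_support\<close>)
  then show ?thesis unfolding LQT_map_def
    by (subst pairing_ext1[OF fin]) (simp_all add: pairing_M_words fin)
qed

text \<open>The pullback itself can have infinite support, as empty words may be added to W. The
  truncation has finite support and stays invariant, because moves preserve the number of
  words.\<close>

definition loopss_upto :: "nat \<Rightarrow> nat \<Rightarrow> (('x \<times> nat \<times> nat) list \<Rightarrow> 'k::field_char_0) \<Rightarrow> 'x list list \<Rightarrow> 'k" where
  "loopss_upto K N \<phi> W = (if length W \<le> K then loopss N W \<phi> else 0)"

lemma finsupp_loopss_upto: 
  assumes "finsupp \<phi>" shows "finsupp (loopss_upto K N \<phi>)"
proof (rule finsupp_bounded)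
  show "finite (\<Union>v\<in>{v. \<phi> v \<noteq> 0}. {W. concat W = map fst v \<and> length W \<le> K})"
    using assms finite_concat by (auto simp: finsupp_def)
  fix W assume "loopss_upto K N \<phi> W \<noteq> 0"
  then have "length W \<le> K" "loopss N W \<phi> \<noteq> 0" by (auto simp: loopss_upto_def split: if_splits)
  then show "W \<in> (\<Union>v\<in>{v. \<phi> v \<noteq> 0}. {W. concat W = map fst v \<and> length W \<le> K})"
    using loopss_support by force
qed

lemma nc_inv_loopss_upto:
  assumes "sinv (\<lambda>y. p (fst y)) \<phi>"
  shows "nc_inv p (loopss_upto K N \<phi>)"
proof -
  have *: "sinv (wpar p) (\<lambda>W. loopss N W \<phi>)" "\<And>U V. cinv p (\<lambda>w. loopss N (U @ w # V) \<phi>)"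
    using nc_inv_loopss[OF assms] by (auto simp: nc_inv_def)
  show ?thesis unfolding nc_inv_def
  proof (intro conjI allI)
    show "sinv (wpar p) (loopss_upto K N \<phi>)"
      unfolding sinv_def
    proof (intro allI)
      show "loopss_upto K N \<phi> (a @ x # y # b) = msgn (wpar p x \<and> wpar p y) * loopss_upto K N \<phi> (a @ y # x # b)" for a x y b
        using sinvD[OF *(1), of a x y b] by (simp only: loopss_upto_def length_append length_Cons) simp
    qed
    fix U V
    show "cinv p (\<lambda>w. loopss_upto K N \<phi> (U @ w # V))"
      unfolding cinv_def
    proof (intro allI)
      show "loopss_upto K N \<phi> (U @ (u @ v) # V) = msgn (wpar p u \<and> wpar p v) * loopss_upto K N \<phi> (U @ (v @ u) # V)" for u v
        using cinvD[OF *(2)[of U V], of u v] by (simp only: loopss_upto_def length_append length_Cons) simp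
    qed
  qed
qed

lemma pairing_LQT_upto:
  assumes "bounded_words K f" "finsupp \<phi>"
  shows "pairing (LQT_map N f) \<phi> = pairing f (loopss_upto K N \<phi>)"
  unfolding pairing_LQT[OF assms]
  by (rule pairing_cong) (use assms(1) in \<open>simp add: bounded_words_def loopss_upto_def\<close>)

text \<open>The pullback truncated at a common bound is an admissible test functional for
  congruence, and on \<open>f\<close> and \<open>g\<close> it agrees with the full pullback.\<close>

theorem LQT_well_defined:
  assumes "bounded_words K f" "bounded_words L g" "nc_eq p f g"
  shows "sym_eq (\<lambda>y. p (fst y)) (LQT_map N f) (LQT_map N g)"
proof (rule sym_eqI)
  fix \<phi> :: "('a \<times> nat \<times> nat) list \<Rightarrow> 'b" assume \<phi>: "finsupp \<phi>" "sinv (\<lambda>y. p (fst y)) \<phi>"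
  have "bounded_words (max K L) f" "bounded_words (max K L) g"
    using assms by (auto simp: bounded_words_def le_max_iff_disj)
  then show "pairing (LQT_map N f) \<phi> = pairing (LQT_map N g) \<phi>"
    using nc_eqD[OF assms(3) finsupp_loopss_upto[OF \<phi>(1)] nc_inv_loopss_upto[OF \<phi>(2)]]
    by (simp add: pairing_LQT_upto \<phi>)
qed

lemma LQT_nonzero:
  fixes f :: "'x list list \<Rightarrow> 'k::field_char_0"
  shows "LQT_map N f v \<noteq> 0 \<Longrightarrow> \<exists>W. f W \<noteq> 0 \<and> catprod (map (M_word N) W) v \<noteq> (0 :: 'k)"
  unfolding LQT_map_def by (rule ext1_nonzero)

lemma LQT_carrier:
  fixes f :: "'x list list \<Rightarrow> 'k::field_char_0"
  assumes "\<And>W. f W \<noteq> 0 \<Longrightarrow> W \<in> lists (lists B)"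
  shows "LQT_map N f \<in> tens_carrier (mat_basis N B)"
  unfolding tens_carrier_def
proof (intro CollectI allI impI, rule ccontr)
  fix v assume v: "v \<notin> lists (mat_basis N B)" and "LQT_map N f v \<noteq> 0"
  then obtain W where W: "f W \<noteq> 0" "catprod (map (M_word N) W) v \<noteq> (0 :: 'k)"
    using LQT_nonzero by blast
  from M_words_support[OF W(2)] have fst: "map fst v = concat W" and snd: "snd ` set v \<subseteq> {..<N} \<times> {..<N}"
    by auto
  have "set (map fst v) \<subseteq> B" unfolding fst using assms[OF W(1)] by auto
  then have "y \<in> mat_basis N B" if "y \<in> set v" for y
    using that snd by (cases y) (force simp: mat_basis_def)
  then have "v \<in> lists (mat_basis N B)" by blast
  then show False using v by simp
qed

lemma catprod_mon: "catprod (map (mon 1) W) = (mon 1 (concat W) :: _ \<Rightarrow> 'k::field_char_0)"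
proof (rule pairing_eqI)
  fix w :: "'a list"
  have "finsupp \<phi> \<Longrightarrow> pairing (catprod (map (mon 1) W)) \<phi> = \<phi> (concat W)" for \<phi> :: "'a list \<Rightarrow> 'k"
    by (induction W arbitrary: \<phi>) (simp_all add: catprod_def pairing_cat)
  then show "pairing (catprod (map (mon 1) W)) (mon 1 w) = pairing (mon 1 (concat W)) (mon 1 w :: _ \<Rightarrow> 'k)"
    using finsupp_mon[of 1 w] by (simp only: pairing_mon mult_1)
qed

text \<open>Keeps the division into words that \<open>loopss\<close> forgets: the transpose of the
  matrix map before its words are multiplied together.\<close>

primrec loop_words :: "nat \<Rightarrow> 'x list list \<Rightarrow> (('x \<times> nat \<times> nat) list list \<Rightarrow> 'k::field_char_0) \<Rightarrow> 'k" where
  "loop_words N [] \<phi> = \<phi> []"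
| "loop_words N (w # W) \<phi> = loops N w (\<lambda>s. loop_words N W (\<lambda>V. \<phi> (s # V)))"

lemma lin_loop_words_zero: "loop_words N W (\<lambda>V. 0) = 0"
  by (induction W) (simp_all add: lin_zero[OF lin_loops])

lemma pairing_loop_words:
  "finsupp \<phi> \<Longrightarrow> pairing (catprod (map (\<lambda>w. single (M_word N w)) W)) \<phi> = loop_words N W \<phi>"
proof (induction W arbitrary: \<phi>)
  case (Cons w W)
  have "finsupp (\<lambda>S. loop_words N W (\<lambda>V. \<phi> (S @ V)))"
    by (rule finsupp_prefix[OF Cons.prems]) (simp add: lin_loop_words_zero)
  moreover from this have "finsupp (\<lambda>s. loop_words N W (\<lambda>V. \<phi> ([s] @ V)))"
    by (rule finsupp_comp_inj) (simp add: inj_def)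
  ultimately show ?case using Cons
    by (simp add: catprod_def pairing_cat pairing_single pairing_M_word)
qed (simp add: catprod_def)

lemma loop_words_support: "loop_words N W \<phi> \<noteq> 0 \<Longrightarrow> \<exists>V. \<phi> V \<noteq> 0 \<and> map (map fst) V = W"
proof (induction W arbitrary: \<phi>)
  case (Cons w W)
  from Cons.prems obtain s where s: "loop_words N W (\<lambda>V. \<phi> (s # V)) \<noteq> 0" "map fst s = w"
    using loops_support by fastforce
  from Cons.IH[OF s(1)] obtain V where "\<phi> (s # V) \<noteq> 0" "map (map fst) V = W" by blast
  then show ?case using s by (intro exI[of _ "s # V"]) auto
qed auto

text \<open>The number j counts the words already split off, so that the truncation survives the
  induction on W.\<close>

lemma loop_words_concat:
  "length W + j \<le> K \<Longrightarrow> loop_words N W (\<lambda>V. if length V + j \<le> K then \<phi> (concat V) else 0) = loopss N W \<phi>"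
proof (induction W arbitrary: j \<phi>)
  case (Cons w W)
  show ?case
    unfolding loop_words.simps loopss.simps
  proof (rule loops_cong)
    fix v
    show "loop_words N W (\<lambda>V. if length (v # V) + j \<le> K then \<phi> (concat (v # V)) else 0) = loopss N W (\<lambda>t. \<phi> (v @ t))"
      using Cons.IH[of "Suc j" "\<lambda>t. \<phi> (v @ t)"] Cons.prems by (simp cong: if_cong)
  qed
qed simp

text \<open>An equality of representatives. Concatenating the intermediate lists forgets their empty
  words; since the matrix map preserves the number of words, the bound on \<open>f\<close> carries
  over to them and permits the truncation \<open>\<psi>\<close>.\<close>

lemma sigma_M_eq_LQT:
  assumes f: "bounded_words K f"
  shows "ext1 (\<lambda>W. catprod (map (mon 1) W)) (ext1 (\<lambda>W. catprod (map (\<lambda>w. single (M_word N w)) W)) f) = LQT_map N f"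
proof (rule pairing_eqI)
  let ?M = "\<lambda>W. catprod (map (\<lambda>w. single (M_word N w)) W)"
  fix v :: "('a \<times> nat \<times> nat) list"
  let ?\<phi> = "mon 1 v :: _ \<Rightarrow> 'b"
  define \<psi> where "\<psi> V = (if length V \<le> K then ?\<phi> (concat V) else 0)" for V
  have M: "map (map fst) V = W" if "?M W V \<noteq> (0 :: 'b)" for W V
    using that pairing_loop_words[of "mon 1 V :: _ \<Rightarrow> 'b" N W] loop_words_support[of N W "mon 1 V :: _ \<Rightarrow> 'b"]
    by (auto simp: mon_nonzero)
  have K: "length V \<le> K" if V: "ext1 ?M f V \<noteq> 0" for V
    using ext1_nonzero[OF V] M f by (force simp: bounded_words_def)
  have fin: "finsupp \<psi>"
    by (rule finsupp_bounded[OF finite_concat[of v K]]) (auto simp: \<psi>_def mon_nonzero split: if_splits)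
  have "pairing (ext1 (\<lambda>W. catprod (map (mon 1) W)) (ext1 ?M f)) ?\<phi> = pairing (ext1 ?M f) (\<lambda>V. ?\<phi> (concat V))"
  proof (subst pairing_ext1)
    show "finite {V. ext1 ?M f V \<noteq> 0 \<and> catprod (map (mon 1) V) w \<noteq> (0 :: 'b)}" for w
      by (rule finite_subset[OF _ finite_concat[of w K]]) (use K in \<open>auto simp: catprod_mon mon_nonzero\<close>)
  qed (simp_all only: catprod_mon pairing_mon mult_1 finsupp_mon)
  also have "\<dots> = pairing (ext1 ?M f) \<psi>"
    by (rule pairing_cong) (simp add: \<psi>_def K)
  also have "\<dots> = pairing f (\<lambda>W. loop_words N W \<psi>)"
  proof (subst pairing_ext1[OF fin])
    show "finite {W. f W \<noteq> 0 \<and> ?M W V \<noteq> (0 :: 'b)}" for V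
      by (rule finite_subset[of _ "{map (map fst) V}"]) (auto dest: M)
  qed (simp_all add: pairing_loop_words fin)
  also have "\<dots> = pairing f (\<lambda>W. loopss N W ?\<phi>)"
    by (rule pairing_cong) (use loop_words_concat[of _ 0 K N ?\<phi>] f in \<open>simp add: \<psi>_def[abs_def] bounded_words_def\<close>)
  also have "\<dots> = pairing (LQT_map N f) ?\<phi>" by (simp only: pairing_LQT[OF f finsupp_mon])
  finally show "pairing (ext1 (\<lambda>W. catprod (map (mon 1) W)) (ext1 ?M f)) ?\<phi> = pairing (LQT_map N f) ?\<phi>" .
qed

section \<open>Invariance of traces under commutators\<close>

section \<open>Invariance under the general linear Lie algebra\<close>

definition gl_fun :: "nat \<Rightarrow> (nat \<Rightarrow> nat \<Rightarrow> 'k::field_char_0) \<Rightarrow> ('x \<times> nat \<times> nat) list \<Rightarrow> (('x \<times> nat \<times> nat) list \<Rightarrow> 'k) \<Rightarrow> 'k" where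
  "gl_fun N X s \<phi> = splits (\<lambda>u (x, a, b) v. 
     (\<Sum>d<N. X d b * \<phi> (u @ (x, a, d) # v)) - (\<Sum>c<N. X a c * \<phi> (u @ (x, c, b) # v))) s"

lemma pairing_gl_gen:
  assumes "a < N" "b < N"
  shows "pairing (gl_gen N X (x, a, b)) \<phi> = (\<Sum>d<N. X d b * \<phi> [(x, a, d)]) - (\<Sum>c<N. X a c * \<phi> [(x, c, b)])"
proof -
  let ?S = "(\<lambda>(c, d). [(x, c, d)]) ` ({..<N} \<times> {..<N})"
  have "pairing (gl_gen N X (x, a, b)) \<phi> = (\<Sum>w\<in>?S. gl_gen N X (x, a, b) w * \<phi> w)"
    by (rule pairing_eq_sum') (auto simp: gl_gen_def split: list.splits if_splits)
  also have "\<dots> = (\<Sum>c<N. \<Sum>d<N. gl_gen N X (x, a, b) [(x, c, d)] * \<phi> [(x, c, d)])"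
    by (subst sum.reindex) (auto simp: inj_on_def sum.cartesian_product case_prod_unfold)
  also have "\<dots> = (\<Sum>c<N. \<Sum>d<N. (if c = a then X d b * \<phi> [(x, c, d)] else 0) - (if d = b then X a c * \<phi> [(x, c, d)] else 0))"
    by (intro sum.cong refl) (auto simp: gl_gen_def algebra_simps)
  also have "\<dots> = (\<Sum>d<N. \<Sum>c<N. if c = a then X d b * \<phi> [(x, c, d)] else 0) -
      (\<Sum>c<N. \<Sum>d<N. if d = b then X a c * \<phi> [(x, c, d)] else 0)"
    by (subst (2) sum.swap) (simp add: sum_subtractf)
  finally show ?thesis using assms by simp
qed

lemma lin_diff: "lin L \<Longrightarrow> L (\<lambda>x. f x - g x) = L f - L g"
  using lin_add[of L f "\<lambda>x. - 1 * g x"] lin_mult[of L "- 1" g] by simp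

text \<open>X acts on both indices of every letter. At an index shared by neighbouring letters the
  two contributions cancel, and only those at the ends c and d remain.\<close>

lemma paths_gl:
  "c < N \<Longrightarrow> d < N \<Longrightarrow> paths N w c d (\<lambda>s. gl_fun N X s \<phi>) =
    (\<Sum>e<N. X e d * paths N w c e \<phi>) - (\<Sum>e<N. X c e * paths N w e d \<phi>)"
proof (induction w arbitrary: c \<phi>)
  case Nil
  then show ?case by (auto simp: gl_fun_def if_distrib[where f = "\<lambda>x. _ * x"] cong: if_cong)
next
  case (Cons x w)
  have "paths N (x # w) c d (\<lambda>s. gl_fun N X s \<phi>) =
      (\<Sum>e<N. paths N w e d (\<lambda>v. ((\<Sum>f<N. X f e * \<phi> ((x, c, f) # v)) - (\<Sum>f<N. X c f * \<phi> ((x, f, e) # v))) +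
        gl_fun N X v (\<lambda>r. \<phi> ((x, c, e) # r))))"
    by (simp add: gl_fun_def)
  also have "\<dots> = (\<Sum>e<N. \<Sum>f<N. X f e * paths N w e d (\<lambda>v. \<phi> ((x, c, f) # v))) -
        (\<Sum>e<N. \<Sum>f<N. X c f * paths N w e d (\<lambda>v. \<phi> ((x, f, e) # v))) +
        ((\<Sum>e<N. \<Sum>f<N. X f d * paths N w e f (\<lambda>r. \<phi> ((x, c, e) # r))) -
         (\<Sum>e<N. \<Sum>f<N. X e f * paths N w f d (\<lambda>r. \<phi> ((x, c, e) # r))))"
    unfolding lin_add[OF lin_paths] lin_diff[OF lin_paths] lin_sum[OF lin_paths] lin_mult[OF lin_paths]
    by (simp add: Cons sum.distrib sum_subtractf)
  also have "(\<Sum>e<N. \<Sum>f<N. X e f * paths N w f d (\<lambda>r. \<phi> ((x, c, e) # r))) =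
      (\<Sum>e<N. \<Sum>f<N. X f e * paths N w e d (\<lambda>v. \<phi> ((x, c, f) # v)))"
    by (rule sum.swap)
  also have "(\<Sum>e<N. \<Sum>f<N. X c f * paths N w e d (\<lambda>v. \<phi> ((x, f, e) # v))) =
      (\<Sum>f<N. X c f * paths N (x # w) f d \<phi>)"
    by (subst sum.swap) (simp add: sum_distrib_left)
  also have "(\<Sum>e<N. \<Sum>f<N. X f d * paths N w e f (\<lambda>r. \<phi> ((x, c, e) # r))) =
      (\<Sum>f<N. X f d * paths N (x # w) c f \<phi>)"
    by (subst sum.swap) (simp add: sum_distrib_left)
  finally show ?case by simp
qed

text \<open>On a closed path the two end terms cancel as well, which is the invariance of the trace;
  for several words the derivation acts on one closed path at a time.\<close>

lemma loopss_gl: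
  fixes W :: "'x list list" and X :: "nat \<Rightarrow> nat \<Rightarrow> 'k::field_char_0"
  shows "loopss N W (\<lambda>s. gl_fun N X s \<phi>) = 0"
proof (induction W arbitrary: \<phi>)
  case (Cons w W)
  have loops: "loops N w (\<lambda>s. gl_fun N X s \<psi>) = 0" for \<psi>
  proof -
    have "loops N w (\<lambda>s. gl_fun N X s \<psi>) =
        (\<Sum>c<N. \<Sum>e<N. X e c * paths N w c e \<psi>) - (\<Sum>c<N. \<Sum>e<N. X c e * paths N w e c \<psi>)"
      by (simp add: loops_def paths_gl sum_subtractf)
    then show ?thesis by (subst (asm) sum.swap) simp
  qed
  have lin: "lin (gl_fun N X s)" for s :: "('x \<times> nat \<times> nat) list"
    unfolding gl_fun_def
    by (rule linI) (simp_all add: distrib_left sum.distrib case_prod_unfold algebra_simps splits_add[symmetric]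
        sum_distrib_left splits_mult[symmetric])
  have "gl_fun N X (s @ t) \<phi> = gl_fun N X s (\<lambda>r. \<phi> (r @ t)) + gl_fun N X t (\<lambda>r. \<phi> (s @ r))" for s t
    by (simp add: gl_fun_def splits_append case_prod_unfold)
  then have "loopss N (w # W) (\<lambda>s. gl_fun N X s \<phi>) =
      loops N w (\<lambda>s. loopss N W (\<lambda>t. gl_fun N X s (\<lambda>r. \<phi> (r @ t)))) + loops N w (\<lambda>s. loopss N W (\<lambda>t. gl_fun N X t (\<lambda>r. \<phi> (s @ r))))"
    by (simp add: lin_add[OF lin_loopss] lin_add[OF lin_loops])
  also have "loops N w (\<lambda>s. loopss N W (\<lambda>t. gl_fun N X s (\<lambda>r. \<phi> (r @ t)))) =
      loops N w (\<lambda>s. gl_fun N X s (\<lambda>r. loopss N W (\<lambda>t. \<phi> (r @ t))))"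
    by (intro loops_cong loopss_lin[OF lin])
  finally show ?case by (simp add: loops Cons lin_zero[OF lin_loops])
qed (simp add: gl_fun_def)

lemma LQT_index_support:
  fixes f :: "'x list list \<Rightarrow> 'k::field_char_0"
  assumes "LQT_map N f v \<noteq> 0" shows "snd ` set v \<subseteq> {..<N} \<times> {..<N}"
proof -
  from LQT_nonzero[OF assms] obtain W where "catprod (map (M_word N) W) v \<noteq> (0 :: 'k)" by blast
  from M_words_support[OF this] show ?thesis by blast
qed

theorem LQT_gl_invariant:
  fixes f :: "'x list list \<Rightarrow> 'k::field_char_0"
  assumes f: "bounded_words K f"
  shows "gl_act N q X (LQT_map N f) = 0"
proof (rule pairing_eqI)
  fix w :: "('x \<times> nat \<times> nat) list"
  let ?\<phi> = "mon 1 w :: _ \<Rightarrow> 'k"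
  let ?D = "derm False q (gl_gen N X)"
  \<comment> \<open>Images of the map only involve indices below N. For letters with larger indices,
    infinitely many could be sent to the same word by the derivation.\<close>
  let ?I = "{s. snd ` set s \<subseteq> {..<N} \<times> {..<N}}"
  have D: "pairing (?D s) \<phi> = gl_fun N X s \<phi>" if "s \<in> ?I" "finsupp \<phi>" for s \<phi>
    unfolding pairing_derm[OF that(2)] gl_fun_def
  proof (rule splits_cong)
    fix u y v assume s: "s = u @ y # v"
    obtain x a b where y: "y = (x, a, b)" by (cases y)
    have "a < N" "b < N" using that(1) by (auto simp: s y)
    then show "msgn (False \<and> wpar q u) * pairing (gl_gen N X y) (\<lambda>r. \<phi> (u @ r @ v)) =
        (case y of (x, a, b) \<Rightarrow> \<lambda>v. (\<Sum>d<N. X d b * \<phi> (u @ (x, a, d) # v)) - (\<Sum>c<N. X a c * \<phi> (u @ (x, c, b) # v))) v"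
      by (simp add: y pairing_gl_gen)
  qed
  have fin: "finite {s \<in> ?I. ?D s v \<noteq> 0}" for v
  proof (rule finite_subset)
    show "{s \<in> ?I. ?D s v \<noteq> 0} \<subseteq> word_box (fst ` set v \<times> {..<N} \<times> {..<N}) (length v)"
    proof clarify
      fix s assume s: "snd ` set s \<subseteq> {..<N} \<times> {..<N}" and "?D s v \<noteq> 0"
      then have "gl_fun N X s (mon 1 v) \<noteq> 0" using D[of s "mon 1 v"] by simp
      then obtain u y t where "s = u @ y # t" and nz: "(case y of (x, a, b) \<Rightarrow> \<lambda>t. (\<Sum>d<N. X d b * mon 1 v (u @ (x, a, d) # t)) -
          (\<Sum>c<N. X a c * mon 1 v (u @ (x, c, b) # t))) t \<noteq> 0"
        unfolding gl_fun_def by (blast dest: splits_nonzero)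
      moreover obtain x a b where y: "y = (x, a, b)" by (cases y)
      ultimately have st: "s = u @ (x, a, b) # t" by simp
      have "\<exists>c d. v = u @ (x, c, d) # t"
      proof (rule ccontr)
        assume "\<not> ?thesis"
        then have "mon 1 v (u @ (x, c, d) # t) = (0 :: 'k)" for c d by (auto simp: mon_def)
        then show False using nz by (simp add: y)
      qed
      then have "length s = length v" "fst ` set s = fst ` set v" by (auto simp: st)
      moreover have "y \<in> fst ` set s \<times> {..<N} \<times> {..<N}" if "y \<in> set s" for y
        using that s by (auto simp: mem_Times_iff image_subset_iff)
      ultimately show "s \<in> word_box (fst ` set v \<times> {..<N} \<times> {..<N}) (length v)"
        by (auto simp: word_box_def)
    qed
  qed (simp add: finite_word_box)
  define \<psi> where "\<psi> s = (if s \<in> ?I then pairing (?D s) ?\<phi> else 0)" for s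
  have fin\<psi>: "finsupp \<psi>"
    by (rule finsupp_bounded[OF fin[of w]]) (auto simp: \<psi>_def split: if_splits)
  have "pairing (gl_act N q X (LQT_map N f)) ?\<phi> = pairing (LQT_map N f) (\<lambda>s. pairing (?D s) ?\<phi>)"
    unfolding gl_act_def
  proof (rule pairing_ext1)
    show "finite {s. LQT_map N f s \<noteq> 0 \<and> ?D s v \<noteq> 0}" for v
      by (rule finite_subset[OF _ fin[of v]]) (use LQT_index_support in fastforce)
  qed simp
  also have "\<dots> = pairing (LQT_map N f) \<psi>"
    by (rule pairing_cong) (use LQT_index_support in \<open>fastforce simp: \<psi>_def\<close>)
  also have "\<dots> = pairing f (\<lambda>W. loopss N W \<psi>)" by (rule pairing_LQT[OF f fin\<psi>])
  also have "\<dots> = pairing f (\<lambda>W. 0)"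
  proof (rule pairing_cong)
    fix W
    have "loopss N W (\<lambda>s. \<psi> s - gl_fun N X s ?\<phi>) = 0"
    proof (rule ccontr)
      assume "\<not> ?thesis"
      from loopss_support[OF this] obtain v where "\<psi> v - gl_fun N X v ?\<phi> \<noteq> 0" "snd ` set v \<subseteq> {..<N} \<times> {..<N}"
        by blast
      then show False using D[of v ?\<phi>] by (simp add: \<psi>_def)
    qed
    then show "loopss N W \<psi> = 0" by (simp add: lin_diff[OF lin_loopss] loopss_gl)
  qed
  finally show "pairing (gl_act N q X (LQT_map N f)) ?\<phi> = pairing 0 ?\<phi>" by simp
qed

section \<open>Intertwining for infinite combinations with boundedly many words\<close>

section \<open>Brackets and differentials of infinite combinations\<close>

text \<open>Contracted letters come from the finite set \<open>B\<close>, so a given output has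
  finitely many inputs under the brackets and differentials, and their continuous extensions are
  genuine sums.\<close>

locale finite_odd_form = odd_form +
  fixes B :: "'a set"
  assumes finite_B: "finite B"
    and form_support: "eta x y \<noteq> 0 \<Longrightarrow> x \<in> B \<and> y \<in> B"
begin

lemma sym_bracket_support:
  assumes "sym_bracket_fun p eta s t \<phi> \<noteq> 0"
  shows "\<exists>a x b c y d. s = a @ x # b \<and> t = c @ y # d \<and> x \<in> B \<and> y \<in> B \<and> \<phi> (a @ b @ c @ d) \<noteq> 0"
proof -
  from assms obtain a x b where s: "s = a @ x # b" and "splits (\<lambda>c y d. msgn ((p x \<and> wpar p a) \<noteq> (p y \<and> wpar p (a @ b @ c))) * eta x y *
      \<phi> (a @ b @ c @ d)) t \<noteq> 0"
    unfolding sym_bracket_fun_def by (blast dest: splits_nonzero)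
  then obtain c y d where t: "t = c @ y # d" and nz: "msgn ((p x \<and> wpar p a) \<noteq> (p y \<and> wpar p (a @ b @ c))) * eta x y * \<phi> (a @ b @ c @ d) \<noteq> 0"
    by (blast dest: splits_nonzero)
  from nz have "eta x y \<noteq> 0" "\<phi> (a @ b @ c @ d) \<noteq> 0" by auto
  then show ?thesis using s t form_support[of x y] by blast
qed

lemma cyc_bracket_support:
  assumes "cyc_bracket_fun p eta u v \<phi> \<noteq> 0"
  shows "\<exists>a x b c y d. u = a @ x # b \<and> v = c @ y # d \<and> x \<in> B \<and> y \<in> B \<and> \<phi> (b @ a @ d @ c) \<noteq> 0"
proof -
  from assms obtain a x b where s: "u = a @ x # b" and "splits (\<lambda>c y d.
     msgn (((p x \<and> wpar p a) \<noteq> (p y \<and> (wpar p a \<noteq> (wpar p b \<noteq> wpar p c)))) \<noteq>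
       ((wpar p b \<and> wpar p a) \<noteq> (wpar p d \<and> wpar p c))) * eta x y * \<phi> (b @ a @ d @ c)) v \<noteq> 0"
    unfolding cyc_bracket_fun_def by (blast dest: splits_nonzero)
  then obtain c y d where t: "v = c @ y # d" and nz: "msgn (((p x \<and> wpar p a) \<noteq> (p y \<and> (wpar p a \<noteq> (wpar p b \<noteq> wpar p c)))) \<noteq>
       ((wpar p b \<and> wpar p a) \<noteq> (wpar p d \<and> wpar p c))) * eta x y * \<phi> (b @ a @ d @ c) \<noteq> 0"
    by (blast dest: splits_nonzero)
  from nz have "eta x y \<noteq> 0" "\<phi> (b @ a @ d @ c) \<noteq> 0" by auto
  then show ?thesis using s t form_support[of x y] by blast
qed

lemma finite_sym_bracket: "finite {(s, t). sym_bracket p eta s t w \<noteq> 0}"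
proof (rule finite_subset)
  let ?S = "word_box (set w \<union> B) (Suc (length w))"
  show "finite (?S \<times> ?S)" using finite_B by (simp add: finite_word_box)
  show "{(s, t). sym_bracket p eta s t w \<noteq> 0} \<subseteq> ?S \<times> ?S"
  proof clarify
    fix s t assume "sym_bracket p eta s t w \<noteq> 0"
    then have "sym_bracket_fun p eta s t (mon 1 w) \<noteq> 0"
      using pairing_sym_bracket[of "mon 1 w" p eta s t] by simp
    then show "s \<in> ?S \<and> t \<in> ?S"
      by (auto dest!: sym_bracket_support simp: mon_nonzero word_box_def)
  qed
qed

lemma finite_BV: "finite {s. BV_laplacian p eta s w \<noteq> 0}"
proof (rule finite_subset)
  let ?S = "word_box (set w \<union> B) (Suc (Suc (length w)))"
  show "finite ?S" using finite_B by (simp add: finite_word_box)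
  show "{s. BV_laplacian p eta s w \<noteq> 0} \<subseteq> ?S"
  proof clarify
    fix s assume "BV_laplacian p eta s w \<noteq> 0"
    then have "BV_fun p eta s (mon 1 w) \<noteq> 0"
      using pairing_BV[of "mon 1 w" p eta s] by simp
    then obtain a x r where s: "s = a @ x # r" and "splits (\<lambda>b y c. msgn ((p x \<and> wpar p a) \<noteq> (p y \<and> (wpar p a \<noteq> wpar p b))) *
        (eta x y * mon 1 w (a @ b @ c))) r \<noteq> 0"
      unfolding BV_splits by (blast dest: splits_nonzero)
    then obtain b y c where "r = b @ y # c" "msgn ((p x \<and> wpar p a) \<noteq> (p y \<and> (wpar p a \<noteq> wpar p b))) *
        (eta x y * mon 1 w (a @ b @ c)) \<noteq> 0"
      by (blast dest: splits_nonzero)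
    then show "s \<in> ?S" using s form_support[of x y] by (auto simp: word_box_def mon_nonzero)
  qed
qed

lemma cyc_bracket_mon_support:
  assumes "cyc_bracket_fun p eta u v (\<lambda>r. mon 1 W (r # V)) \<noteq> 0"
  shows "\<exists>r. W = r # V \<and> set u \<subseteq> set r \<union> B \<and> set v \<subseteq> set r \<union> B \<and> length u + length v = Suc (Suc (length r))"
proof -
  from cyc_bracket_support[OF assms] obtain a x b c y d where "u = a @ x # b" "v = c @ y # d" "x \<in> B" "y \<in> B"
      "W = (b @ a @ d @ c) # V"
    unfolding mon_nonzero by metis
  then show ?thesis by (intro exI[of _ "b @ a @ d @ c"]) auto
qed

lemma nc_bracket_support:
  assumes "nc_bracket p eta U V W \<noteq> 0"
  shows "\<exists>A u A' C v D r. U = A @ u # A' \<and> V = C @ v # D \<and> W = r # A @ A' @ C @ D \<and>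
    set u \<subseteq> set r \<union> B \<and> set v \<subseteq> set r \<union> B \<and> length u + length v = Suc (Suc (length r))"
proof -
  have "nc_bracket_fun p eta U V (mon 1 W) \<noteq> 0"
    using pairing_nc_bracket[of "mon 1 W" p eta U V] assms by simp
  then obtain A u A' where U: "U = A @ u # A'" and "splits (\<lambda>C v D.
      msgn ((wpar p u \<and> wpar (wpar p) A) \<noteq> (wpar p v \<and> wpar (wpar p) (A @ A' @ C))) *
     cyc_bracket_fun p eta u v (\<lambda>r. mon 1 W (r # A @ A' @ C @ D))) V \<noteq> 0"
    unfolding nc_bracket_fun_def by (blast dest: splits_nonzero)
  then obtain C v D where V: "V = C @ v # D" and
      nz: "msgn ((wpar p u \<and> wpar (wpar p) A) \<noteq> (wpar p v \<and> wpar (wpar p) (A @ A' @ C))) *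
        cyc_bracket_fun p eta u v (\<lambda>r. mon 1 W (r # A @ A' @ C @ D)) \<noteq> 0"
    by (blast dest: splits_nonzero)
  from nz have "cyc_bracket_fun p eta u v (\<lambda>r. mon 1 W (r # A @ A' @ C @ D)) \<noteq> 0" by auto
  from cyc_bracket_mon_support[OF this] U V show ?thesis by blast
qed

lemma nc_delta_support:
  assumes "nc_delta p eta U W \<noteq> 0"
  shows "\<exists>A u A' v C r. U = A @ u # A' @ v # C \<and> W = r # A @ A' @ C \<and>
    set u \<subseteq> set r \<union> B \<and> set v \<subseteq> set r \<union> B \<and> length u + length v = Suc (Suc (length r))"
proof -
  have "nc_delta_fun p eta U (mon 1 W) \<noteq> 0"
    using pairing_nc_delta[of "mon 1 W" p eta U] assms by simp
  then obtain A u R where U: "U = A @ u # R" and "splits (\<lambda>A' v C.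
     msgn ((wpar p u \<and> wpar (wpar p) A) \<noteq> (wpar p v \<and> (wpar (wpar p) A \<noteq> wpar (wpar p) A'))) *
     cyc_bracket_fun p eta u v (\<lambda>r. mon 1 W (r # A @ A' @ C))) R \<noteq> 0"
    unfolding nc_delta_fun_def by (blast dest: splits_nonzero)
  then obtain A' v C where R: "R = A' @ v # C" and
      nz: "msgn ((wpar p u \<and> wpar (wpar p) A) \<noteq> (wpar p v \<and> (wpar (wpar p) A \<noteq> wpar (wpar p) A'))) *
        cyc_bracket_fun p eta u v (\<lambda>r. mon 1 W (r # A @ A' @ C)) \<noteq> 0"
    by (blast dest: splits_nonzero)
  from nz have "cyc_bracket_fun p eta u v (\<lambda>r. mon 1 W (r # A @ A' @ C)) \<noteq> 0" by auto
  from cyc_bracket_mon_support[OF this] U R show ?thesis by blast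
qed

lemma nc_nabla_support:
  assumes "nc_nabla p eta U W \<noteq> 0"
  shows "\<exists>A u C r r'. U = A @ u # C \<and> W = A @ r # r' # C \<and>
    set u \<subseteq> set r \<union> set r' \<union> B \<and> length u = Suc (Suc (length r + length r'))"
proof -
  have "nc_nabla_fun p eta U (mon 1 W) \<noteq> 0"
    using pairing_nc_nabla[of "mon 1 W" p eta U] assms by simp
  then obtain A u C where U: "U = A @ u # C" and
      nz: "msgn (wpar (wpar p) A) * cobracket_fun p eta u (\<lambda>r. mon 1 W (A @ r @ C)) \<noteq> 0"
    unfolding nc_nabla_fun_def by (blast dest: splits_nonzero)
  from nz have "cobracket_fun p eta u (\<lambda>r. mon 1 W (A @ r @ C)) \<noteq> 0" by auto
  then obtain a x q where u: "u = a @ x # q" and "splits (\<lambda>b y c.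
      msgn (((p x \<and> wpar p a) \<noteq> (p y \<and> (wpar p a \<noteq> wpar p b))) \<noteq> ((wpar p b \<noteq> wpar p c) \<and> wpar p a)) *
     eta x y * mon 1 W (A @ [b, c @ a] @ C)) q \<noteq> 0"
    unfolding cobracket_fun_def by (blast dest: splits_nonzero)
  then obtain b y c where q: "q = b @ y # c" and
      nz: "msgn (((p x \<and> wpar p a) \<noteq> (p y \<and> (wpar p a \<noteq> wpar p b))) \<noteq> ((wpar p b \<noteq> wpar p c) \<and> wpar p a)) *
     eta x y * mon 1 W (A @ [b, c @ a] @ C) \<noteq> 0"
    by (blast dest: splits_nonzero)
  from nz have xy: "eta x y \<noteq> 0" and "mon 1 W (A @ [b, c @ a] @ C) \<noteq> (0 :: 'b)" by auto
  then have W: "W = A @ [b, c @ a] @ C" unfolding mon_nonzero by simp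
  show ?thesis
    using form_support[OF xy] by (intro exI conjI) (rule U, auto simp: W u q)
qed

lemma finite_nc_bracket: "finite {(U, V). nc_bracket p eta U V W \<noteq> 0}"
proof (rule finite_subset)
  let ?S = "nc_box (set (concat W) \<union> B) (Suc (Suc (length W + length (concat W))))"
  show "finite (?S \<times> ?S)" using finite_B by (simp add: finite_nc_box)
  show "{(U, V). nc_bracket p eta U V W \<noteq> 0} \<subseteq> ?S \<times> ?S"
  proof (rule subsetI, clarify)
    fix U V assume "nc_bracket p eta U V W \<noteq> 0"
    from nc_bracket_support[OF this] show "U \<in> ?S \<and> V \<in> ?S"
      by (elim exE conjE) (intro conjI nc_boxI, auto)
  qed
qed

lemma finite_nc_delta: "finite {U. nc_delta p eta U W \<noteq> 0}"
proof (rule finite_subset)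
  let ?S = "nc_box (set (concat W) \<union> B) (Suc (Suc (length W + length (concat W))))"
  show "finite ?S" using finite_B by (simp add: finite_nc_box)
  show "{U. nc_delta p eta U W \<noteq> 0} \<subseteq> ?S"
  proof (rule subsetI, clarify)
    fix U assume "nc_delta p eta U W \<noteq> 0"
    from nc_delta_support[OF this] show "U \<in> ?S"
      by (elim exE conjE) (intro nc_boxI, auto)
  qed
qed

lemma finite_nc_nabla: "finite {U. nc_nabla p eta U W \<noteq> 0}"
proof (rule finite_subset)
  let ?S = "nc_box (set (concat W) \<union> B) (Suc (Suc (length W + length (concat W))))"
  show "finite ?S" using finite_B by (simp add: finite_nc_box)
  show "{U. nc_nabla p eta U W \<noteq> 0} \<subseteq> ?S"
  proof (rule subsetI, clarify)
    fix U assume "nc_nabla p eta U W \<noteq> 0"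
    from nc_nabla_support[OF this] show "U \<in> ?S"
      by (elim exE conjE) (intro nc_boxI, auto)
  qed
qed

lemma finite_sym_bracket_pairing:
  assumes "finsupp \<phi>" shows "finite {(s, t). sym_bracket_fun p eta s t \<phi> \<noteq> 0}"
  using finsupp_pairing[OF assms, of "\<lambda>(s, t). sym_bracket p eta s t"] finite_sym_bracket
  by (simp add: finsupp_def case_prod_unfold pairing_sym_bracket[OF assms])

lemma finite_odd_form_mat: "finite_odd_form (\<lambda>y. p (fst y)) (mat_eta N eta) (mat_basis N B)"
proof -
  interpret mat: odd_form "\<lambda>y. p (fst y)" "mat_eta N eta" by (rule odd_form_mat)
  show ?thesis
    by unfold_locales (use finite_B form_support in \<open>auto simp: mat_basis_def mat_eta_def split: if_splits\<close>)
qed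

lemma nc_bracket_fun_upto:
  assumes "length U + length V \<le> K"
  shows "nc_bracket_fun p eta U V (loopss_upto K N \<phi>) = nc_bracket_fun p eta U V (\<lambda>W. loopss N W \<phi>)"
  unfolding nc_bracket_fun_def
  by (intro splits_cong arg_cong2[where f = "(*)"] refl) (use assms in \<open>simp add: loopss_upto_def\<close>)

lemma pairing_ext2_sym:
  assumes "finsupp \<phi>"
  shows "pairing (ext2 (sym_bracket p eta) f g) \<phi> = pairing f (\<lambda>s. pairing g (\<lambda>t. sym_bracket_fun p eta s t \<phi>))"
  by (subst pairing_ext2[OF assms])
    (auto intro: finite_subset[OF _ finite_sym_bracket] simp: pairing_sym_bracket assms)

lemma pairing_ext2_nc:
  assumes "finsupp \<phi>"
  shows "pairing (ext2 (nc_bracket p eta) f g) \<phi> = pairing f (\<lambda>U. pairing g (\<lambda>V. nc_bracket_fun p eta U V \<phi>))"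
  by (subst pairing_ext2[OF assms])
    (auto intro: finite_subset[OF _ finite_nc_bracket] simp: pairing_nc_bracket assms)

lemma bounded_nc_bracket:
  assumes "bounded_words K f" "bounded_words L g"
  shows "bounded_words (K + L) (ext2 (nc_bracket p eta) f g)"
  unfolding bounded_words_def
proof (intro allI impI)
  fix W assume "ext2 (nc_bracket p eta) f g W \<noteq> 0"
  from ext2_nonzero[OF this] obtain U V where UV: "f U \<noteq> 0" "g V \<noteq> 0" "nc_bracket p eta U V W \<noteq> 0"
    by blast
  from nc_bracket_support[OF UV(3)] have "length W \<le> length U + length V"
    by (elim exE conjE) simp
  then show "length W \<le> K + L" using assms UV by (fastforce simp: bounded_words_def)
qed

text \<open>On words this is \<open>loopss_bracket\<close>; the work lies in exchanging the infinite
  combinations \<open>f\<close> and \<open>g\<close> with the sums over paths.\<close>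

theorem LQT_bracket:
  assumes f: "bounded_words K f" and g: "bounded_words L g"
  shows "sym_eq (\<lambda>y. p (fst y)) (LQT_map N (ext2 (nc_bracket p eta) f g))
    (ext2 (sym_bracket (\<lambda>y. p (fst y)) (mat_eta N eta)) (LQT_map N f) (LQT_map N g))"
proof (rule sym_eqI)
  interpret mat: finite_odd_form "\<lambda>y. p (fst y)" "mat_eta N eta" "mat_basis N B" by (rule finite_odd_form_mat)
  fix \<phi> :: "('a \<times> nat \<times> nat) list \<Rightarrow> 'b"
  assume fin: "finsupp \<phi>" and inv: "sinv (\<lambda>y. p (fst y)) \<phi>"
  let ?B = "sym_bracket_fun (\<lambda>y. p (fst y)) (mat_eta N eta)"
  have finB: "finite {(s, t). ?B s t \<phi> \<noteq> 0}" by (rule mat.finite_sym_bracket_pairing[OF fin])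
  have finB2: "finsupp (\<lambda>t. ?B s t \<phi>)" for s
  proof (rule finsupp_bounded[OF finite_imageI[OF finB, of snd]])
    show "t \<in> snd ` {(s, t). ?B s t \<phi> \<noteq> 0}" if "?B s t \<phi> \<noteq> 0" for t
      using that by (intro image_eqI[of _ _ "(s, t)"]) auto
  qed
  have finB1: "finsupp (\<lambda>s. pairing h (\<lambda>t. ?B s t \<phi>))" for h
  proof (rule finsupp_bounded[OF finite_imageI[OF finB, of fst]])
    fix s assume "pairing h (\<lambda>t. ?B s t \<phi>) \<noteq> 0"
    then have "(\<lambda>t. ?B s t \<phi>) \<noteq> (\<lambda>t. 0)" by auto
    then obtain t where "?B s t \<phi> \<noteq> 0" by blast
    then show "s \<in> fst ` {(s, t). ?B s t \<phi> \<noteq> 0}" by (intro image_eqI[of _ _ "(s, t)"]) auto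
  qed
  \<comment> \<open>\<open>D\<close> contains every V in \<open>g\<close> that the contraction can
    reach. The finite restriction \<open>g'\<close> of \<open>g\<close> makes
    \<open>lin_pairing\<close> applicable, so the pairing moves inside the sum over paths of
    U.\<close>
  define D where "D = (\<Union>(s, t)\<in>{(s, t). ?B s t \<phi> \<noteq> 0}. {V. concat V = map fst t \<and> length V \<le> L})"
  have finD: "finite D" using finB finite_concat by (auto simp: D_def)
  define g' where "g' V = (if V \<in> D then g V else 0)" for V
  have g': "finsupp g'" by (rule finsupp_bounded[OF finD]) (auto simp: g'_def split: if_splits)
  have gg': "pairing g (\<lambda>V. loopss N V (\<lambda>t. ?B s t \<phi>)) = pairing g' (\<lambda>V. loopss N V (\<lambda>t. ?B s t \<phi>))" for s
  proof -
    have "V \<in> D" if "g V \<noteq> 0" "loopss N V (\<lambda>t. ?B s t \<phi>) \<noteq> 0" for V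
      using loopss_support[OF that(2)] g that(1) by (fastforce simp: D_def bounded_words_def)
    then show ?thesis
      by (subst (1 2) pairing_eq_sum'[OF finD]) (auto simp: g'_def split: if_splits)
  qed
  have "pairing (LQT_map N (ext2 (nc_bracket p eta) f g)) \<phi> =
      pairing (ext2 (nc_bracket p eta) f g) (loopss_upto (K + L) N \<phi>)"
    by (rule pairing_LQT_upto[OF bounded_nc_bracket[OF f g] fin])
  also have "\<dots> = pairing f (\<lambda>U. pairing g (\<lambda>V. nc_bracket_fun p eta U V (loopss_upto (K + L) N \<phi>)))"
    by (rule pairing_ext2_nc[OF finsupp_loopss_upto[OF fin]])
  also have "\<dots> = pairing f (\<lambda>U. pairing g (\<lambda>V. loopss N U (\<lambda>s. loopss N V (\<lambda>t. ?B s t \<phi>))))"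
    unfolding loopss_bracket[OF inv]
  proof (intro pairing_cong nc_bracket_fun_upto)
    fix U V assume "f U \<noteq> 0" "g V \<noteq> 0"
    then have "length U \<le> K" "length V \<le> L" using f g by (auto simp: bounded_words_def)
    then show "length U + length V \<le> K + L" by simp
  qed
  also have "\<dots> = pairing f (\<lambda>U. loopss N U (\<lambda>s. pairing g (\<lambda>V. loopss N V (\<lambda>t. ?B s t \<phi>))))"
  proof (rule pairing_cong)
    fix U
    have "pairing g (\<lambda>V. loopss N U (\<lambda>s. loopss N V (\<lambda>t. ?B s t \<phi>))) =
        pairing g' (\<lambda>V. loopss N U (\<lambda>s. loopss N V (\<lambda>t. ?B s t \<phi>)))"
    proof -
      have "V \<in> D" if V: "g V \<noteq> 0" "loopss N U (\<lambda>s. loopss N V (\<lambda>t. ?B s t \<phi>)) \<noteq> 0" for V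
      proof -
        obtain s where "loopss N V (\<lambda>t. ?B s t \<phi>) \<noteq> 0" using loopss_support[OF V(2)] by blast
        from loopss_support[OF this] show ?thesis using g V(1) by (fastforce simp: D_def bounded_words_def)
      qed
      then show ?thesis
        by (subst (1 2) pairing_eq_sum'[OF finD]) (auto simp: g'_def split: if_splits)
    qed
    also have "\<dots> = loopss N U (\<lambda>s. pairing g' (\<lambda>V. loopss N V (\<lambda>t. ?B s t \<phi>)))"
      by (rule loopss_lin[OF lin_pairing[OF g'], symmetric])
    finally show "pairing g (\<lambda>V. loopss N U (\<lambda>s. loopss N V (\<lambda>t. ?B s t \<phi>))) =
        loopss N U (\<lambda>s. pairing g (\<lambda>V. loopss N V (\<lambda>t. ?B s t \<phi>)))"
      unfolding gg' .
  qed
  also have "\<dots> = pairing f (\<lambda>U. loopss N U (\<lambda>s. pairing (LQT_map N g) (\<lambda>t. ?B s t \<phi>)))"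
    by (simp only: pairing_LQT[OF g finB2])
  also have "\<dots> = pairing (LQT_map N f) (\<lambda>s. pairing (LQT_map N g) (\<lambda>t. ?B s t \<phi>))"
    by (rule pairing_LQT[OF f finB1, symmetric])
  also have "\<dots> = pairing (ext2 (sym_bracket (\<lambda>y. p (fst y)) (mat_eta N eta)) (LQT_map N f) (LQT_map N g)) \<phi>"
    by (rule mat.pairing_ext2_sym[OF fin, symmetric])
  finally show "pairing (LQT_map N (ext2 (nc_bracket p eta) f g)) \<phi> =
    pairing (ext2 (sym_bracket (\<lambda>y. p (fst y)) (mat_eta N eta)) (LQT_map N f) (LQT_map N g)) \<phi>" .
qed

text \<open>The cobracket replaces one word by two; the bracket terms lower the number of
  words.\<close>

lemma bounded_nc_diff:
  assumes "bounded_words K f"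
  shows "bounded_words (Suc K) (ext1 (nc_delta p eta) f + ext1 (nc_nabla p eta) f)"
  unfolding bounded_words_def
proof (intro allI impI)
  fix W assume "(ext1 (nc_delta p eta) f + ext1 (nc_nabla p eta) f) W \<noteq> 0"
  then have "ext1 (nc_delta p eta) f W \<noteq> 0 \<or> ext1 (nc_nabla p eta) f W \<noteq> 0" by auto
  then have "\<exists>U. f U \<noteq> 0 \<and> length W \<le> Suc (length U)"
  proof
    assume "ext1 (nc_delta p eta) f W \<noteq> 0"
    from ext1_nonzero[OF this] obtain U where U: "f U \<noteq> 0" "nc_delta p eta U W \<noteq> 0" by blast
    from nc_delta_support[OF U(2)] have "length W \<le> Suc (length U)" by (elim exE conjE) simp
    then show ?thesis using U by blast
  next
    assume "ext1 (nc_nabla p eta) f W \<noteq> 0"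
    from ext1_nonzero[OF this] obtain U where U: "f U \<noteq> 0" "nc_nabla p eta U W \<noteq> 0" by blast
    from nc_nabla_support[OF U(2)] have "length W \<le> Suc (length U)" by (elim exE conjE) simp
    then show ?thesis using U by blast
  qed
  then show "length W \<le> Suc K" using assms by (force simp: bounded_words_def)
qed

lemma nc_delta_fun_upto:
  assumes "length U \<le> K"
  shows "nc_delta_fun p eta U (loopss_upto K N \<phi>) = nc_delta_fun p eta U (\<lambda>W. loopss N W \<phi>)"
  unfolding nc_delta_fun_def
  by (intro splits_cong arg_cong2[where f = "(*)"] refl) (use assms in \<open>simp add: loopss_upto_def\<close>)

lemma nc_nabla_fun_upto:
  assumes "length U \<le> K"
  shows "nc_nabla_fun p eta U (loopss_upto (Suc K) N \<phi>) = nc_nabla_fun p eta U (\<lambda>W. loopss N W \<phi>)"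
  unfolding nc_nabla_fun_def cobracket_fun_def
  by (intro splits_cong arg_cong2[where f = "(*)"] refl) (use assms in \<open>simp add: loopss_upto_def\<close>)

theorem LQT_differential:
  assumes f: "bounded_words K f"
  shows "sym_eq (\<lambda>y. p (fst y)) (LQT_map N (ext1 (nc_delta p eta) f + ext1 (nc_nabla p eta) f))
    (ext1 (BV_laplacian (\<lambda>y. p (fst y)) (mat_eta N eta)) (LQT_map N f))"
proof (rule sym_eqI)
  interpret mat: finite_odd_form "\<lambda>y. p (fst y)" "mat_eta N eta" "mat_basis N B" by (rule finite_odd_form_mat)
  fix \<phi> :: "('a \<times> nat \<times> nat) list \<Rightarrow> 'b"
  assume fin: "finsupp \<phi>" and inv: "sinv (\<lambda>y. p (fst y)) \<phi>"
  let ?\<psi> = "loopss_upto (Suc K) N \<phi>"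
  let ?D = "BV_fun (\<lambda>y. p (fst y)) (mat_eta N eta)"
  have fin': "finsupp ?\<psi>" by (rule finsupp_loopss_upto[OF fin])
  have finD: "finsupp (\<lambda>U. nc_delta_fun p eta U ?\<psi>)"
    using finsupp_pairing[OF fin', of "nc_delta p eta"] finite_nc_delta by (simp add: pairing_nc_delta[OF fin'])
  have finN: "finsupp (\<lambda>U. nc_nabla_fun p eta U ?\<psi>)"
    using finsupp_pairing[OF fin', of "nc_nabla p eta"] finite_nc_nabla by (simp add: pairing_nc_nabla[OF fin'])
  have finBV: "finsupp (\<lambda>s. ?D s \<phi>)"
    using finsupp_pairing[OF fin, of "BV_laplacian (\<lambda>y. p (fst y)) (mat_eta N eta)"] mat.finite_BV by (simp add: pairing_BV[OF fin])
  have "pairing (LQT_map N (ext1 (nc_delta p eta) f + ext1 (nc_nabla p eta) f)) \<phi> =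
      pairing (ext1 (nc_delta p eta) f) ?\<psi> + pairing (ext1 (nc_nabla p eta) f) ?\<psi>"
    by (simp only: pairing_LQT_upto[OF bounded_nc_diff[OF f] fin] pairing_add[OF fin'])
  also have "pairing (ext1 (nc_delta p eta) f) ?\<psi> = pairing f (\<lambda>U. nc_delta_fun p eta U ?\<psi>)"
    by (subst pairing_ext1[OF fin']) (auto intro: finite_subset[OF _ finite_nc_delta] simp: pairing_nc_delta[OF fin'])
  also have "pairing (ext1 (nc_nabla p eta) f) ?\<psi> = pairing f (\<lambda>U. nc_nabla_fun p eta U ?\<psi>)"
    by (subst pairing_ext1[OF fin']) (auto intro: finite_subset[OF _ finite_nc_nabla] simp: pairing_nc_nabla[OF fin'])
  also have "pairing f (\<lambda>U. nc_delta_fun p eta U ?\<psi>) + pairing f (\<lambda>U. nc_nabla_fun p eta U ?\<psi>) =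
      pairing f (\<lambda>U. nc_delta_fun p eta U ?\<psi> + nc_nabla_fun p eta U ?\<psi>)"
    by (rule pairing_add_right[OF finD finN, symmetric])
  also have "\<dots> = pairing f (\<lambda>U. loopss N U (\<lambda>s. ?D s \<phi>))"
  proof (rule pairing_cong)
    fix U assume "f U \<noteq> 0"
    then have "length U \<le> K" using f by (auto simp: bounded_words_def)
    then show "nc_delta_fun p eta U ?\<psi> + nc_nabla_fun p eta U ?\<psi> = loopss N U (\<lambda>s. ?D s \<phi>)"
      by (simp add: loopss_BV[OF inv] nc_delta_fun_upto nc_nabla_fun_upto)
  qed
  also have "\<dots> = pairing (LQT_map N f) (\<lambda>s. ?D s \<phi>)" by (rule pairing_LQT[OF f finBV, symmetric])
  also have "\<dots> = pairing (ext1 (BV_laplacian (\<lambda>y. p (fst y)) (mat_eta N eta)) (LQT_map N f)) \<phi>"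
    by (subst pairing_ext1[OF fin]) (auto intro: finite_subset[OF _ mat.finite_BV] simp: pairing_BV[OF fin])
  finally show "pairing (LQT_map N (ext1 (nc_delta p eta) f + ext1 (nc_nabla p eta) f)) \<phi> =
    pairing (ext1 (BV_laplacian (\<lambda>y. p (fst y)) (mat_eta N eta)) (LQT_map N f)) \<phi>" .
qed

end

section \<open>Contraction with a cyclic tensor as a derivation\<close>

section \<open>Hamiltonian vector fields\<close>

text \<open>Fubini for two arbitrary formal sums: the finite support of the kernel \<open>F\<close>
  confines everything to a finite rectangle.\<close>

lemma pairing_swap:
  assumes "finite {(u, v). F u v \<noteq> 0}"
  shows "pairing f (\<lambda>u. pairing g (F u)) = pairing g (\<lambda>v. pairing f (\<lambda>u. F u v))"
proof -
  let ?S = "{(u, v). F u v \<noteq> 0}"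
  have fin: "finite (fst ` ?S)" "finite (snd ` ?S)" using assms by auto
  have mem: "u \<in> fst ` ?S" "v \<in> snd ` ?S" if "F u v \<noteq> 0" for u v
    using that by (auto intro: image_eqI[of _ _ "(u, v)"])
  have g: "pairing g (F u) = (\<Sum>v\<in>snd ` ?S. g v * F u v)" for u
    by (rule pairing_eq_sum[OF fin(2)]) (rule mem)
  have f: "pairing f (\<lambda>u. F u v) = (\<Sum>u\<in>fst ` ?S. f u * F u v)" for v
    by (rule pairing_eq_sum[OF fin(1)]) (rule mem)
  have "pairing f (\<lambda>u. pairing g (F u)) = (\<Sum>u\<in>fst ` ?S. f u * pairing g (F u))"
  proof (rule pairing_eq_sum[OF fin(1)])
    fix u assume "pairing g (F u) \<noteq> 0"
    then obtain v where "g v * F u v \<noteq> 0" unfolding g by (rule sum.not_neutral_contains_not_neutral)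
    then have "F u v \<noteq> 0" by auto
    then show "u \<in> fst ` ?S" by (rule mem)
  qed
  also have "\<dots> = (\<Sum>v\<in>snd ` ?S. g v * pairing f (\<lambda>u. F u v))"
    unfolding f g sum_distrib_left by (subst sum.swap) (simp add: mult.left_commute)
  also have "\<dots> = pairing g (\<lambda>v. pairing f (\<lambda>u. F u v))"
  proof (rule pairing_eq_sum[OF fin(2), symmetric])
    fix v assume "pairing f (\<lambda>u. F u v) \<noteq> 0"
    then obtain u where "f u * F u v \<noteq> 0" unfolding f by (rule sum.not_neutral_contains_not_neutral)
    then have "F u v \<noteq> 0" by auto
    then show "v \<in> snd ` ?S" by (rule mem)
  qed
  finally show ?thesis .
qed

lemma pairing_sum_right:
  "finite I \<Longrightarrow> (\<And>i. i \<in> I \<Longrightarrow> finsupp (\<phi> i)) \<Longrightarrow> pairing f (\<lambda>w. \<Sum>i\<in>I. \<phi> i w) = (\<Sum>i\<in>I. pairing f (\<phi> i))"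
proof (induction I rule: finite_induct)
  case (insert i I)
  have "finsupp (\<lambda>w. \<Sum>j\<in>I. \<phi> j w)"
  proof (rule finsupp_bounded)
    show "finite (\<Union>j\<in>I. {w. \<phi> j w \<noteq> 0})" using insert by (auto simp: finsupp_def)
    show "w \<in> (\<Union>j\<in>I. {w. \<phi> j w \<noteq> 0})" if "(\<Sum>j\<in>I. \<phi> j w) \<noteq> 0" for w
      using that by (auto elim: sum.not_neutral_contains_not_neutral)
  qed
  then show ?case using insert by (simp add: pairing_add_right)
qed simp

lemma pairing_splits_right:
  assumes "\<And>a x b. finsupp (\<phi> a x b)"
  shows "pairing f (\<lambda>w. splits (\<lambda>a x b. \<phi> a x b w) v) = splits (\<lambda>a x b. pairing f (\<phi> a x b)) v"
  unfolding splits_def using assms by (subst pairing_sum_right) auto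

lemma finsupp_length: 
  assumes "finsupp \<phi>" shows "\<exists>L. \<forall>w :: 'b list. \<phi> w \<noteq> 0 \<longrightarrow> length w \<le> L"
proof -
  have "finite (length ` {w. \<phi> w \<noteq> 0})" using assms by (simp add: finsupp_def)
  then show ?thesis using Max_ge by blast
qed

text \<open>If n letters of a are odd, a further odd one raises the exponent n(n-1)/2 by n.\<close>

lemma eval_sgn_snoc: "eval_sgn p (a @ [x]) = (eval_sgn p a * msgn (p x \<and> wpar p a) :: 'k::field_char_0)"
  by (simp add: eval_sgn_def wpar_def msgn_def numeral_2_eq_2 power_add)

lemma eval_sgn_mset: "mset u = mset v \<Longrightarrow> eval_sgn p u = eval_sgn p v"
  by (metis eval_sgn_def mset_filter size_mset)

context odd_form
begin

lemma sym_bracket_cong: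
  assumes "\<And>r. (wpar p r \<longleftrightarrow> wpar p s = wpar p t) \<Longrightarrow> \<phi> r = \<psi> r"
  shows "sym_bracket_fun p eta s t \<phi> = sym_bracket_fun p eta s t \<psi>"
  unfolding sym_bracket_fun_def
proof (intro splits_cong)
  fix a x b c y d assume "s = a @ x # b" "t = c @ y # d"
  then have "eta x y \<noteq> 0 \<Longrightarrow> \<phi> (a @ b @ c @ d) = \<psi> (a @ b @ c @ d)"
    using odd_form[of x y] by (intro assms) auto
  then show "msgn ((p x \<and> wpar p a) \<noteq> (p y \<and> wpar p (a @ b @ c))) * eta x y * \<phi> (a @ b @ c @ d) =
      msgn ((p x \<and> wpar p a) \<noteq> (p y \<and> wpar p (a @ b @ c))) * eta x y * \<psi> (a @ b @ c @ d)"
    by (cases "eta x y = 0") simp_all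
qed

lemma sym_bracket_move:
  assumes "sinv p \<phi>"
  shows "sym_bracket_fun p eta s t (\<lambda>r. \<phi> (r @ u)) =
    msgn (wpar p u \<and> (wpar p s = wpar p t)) * sym_bracket_fun p eta s t (\<lambda>r. \<phi> (u @ r))"
  unfolding lin_mult[OF lin_sym_bracket, symmetric]
proof (rule sym_bracket_cong)
  fix r assume r: "wpar p r \<longleftrightarrow> wpar p s = wpar p t"
  have "\<phi> (r @ u) = msgn (wpar p u \<and> wpar p r) * \<phi> (u @ r)"
    using sinv_swap[OF assms, of "[]" r u "[]"] by (simp add: conj_commute)
  then show "\<phi> (r @ u) = msgn (wpar p u \<and> (wpar p s = wpar p t)) * \<phi> (u @ r)"
    unfolding r .
qed

lemma sym_bracket_swap_left:
  assumes "sinv p \<phi>"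
  shows "sym_bracket_fun p eta (u @ v) t \<phi> = msgn (wpar p u \<and> wpar p v) * sym_bracket_fun p eta (v @ u) t \<phi>"
  unfolding sym_bracket_append_left[OF assms] sym_bracket_move[OF assms, of _ _ u] sym_bracket_move[OF assms, of _ _ v]
  by (cases "wpar p u"; cases "wpar p v"; cases "wpar p t"; simp add: msgn_def)

text \<open>Splitting the first argument as a, [x, y], b by the Leibniz rule reduces the claim to
  invariance of \<phi> where the contraction misses x and y, and to
  \<open>sym_bracket_swap_left\<close> where it meets one of them.\<close>

lemma sinv_sym_bracket:
  assumes inv: "sinv p \<phi>"
  shows "sinv p (\<lambda>s. sym_bracket_fun p eta s t \<phi>)"
  unfolding sinv_def
proof (intro allI)
  fix a x y b
  let ?m = "msgn (p x \<and> p y)"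
  have 1: "sym_bracket_fun p eta s t (\<lambda>r. \<phi> (r @ [x, y] @ b)) = ?m * sym_bracket_fun p eta s t (\<lambda>r. \<phi> (r @ [y, x] @ b))" for s
  proof -
    have "\<phi> (r @ [x, y] @ b) = ?m * \<phi> (r @ [y, x] @ b)" for r
      using sinvD[OF inv, of r x y b] by simp
    then show ?thesis by (simp only: lin_mult[OF lin_sym_bracket])
  qed
  have 2: "sym_bracket_fun p eta s t (\<lambda>r. \<phi> (a @ [x, y] @ r)) = ?m * sym_bracket_fun p eta s t (\<lambda>r. \<phi> (a @ [y, x] @ r))" for s
  proof -
    have "\<phi> (a @ [x, y] @ r) = ?m * \<phi> (a @ [y, x] @ r)" for r
      using sinvD[OF inv, of a x y r] by simp
    then show ?thesis by (simp only: lin_mult[OF lin_sym_bracket])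
  qed
  have inv': "sinv p (\<lambda>r. \<phi> (a @ r))" by (rule sinv_append_left[OF inv])
  have inv'': "sinv p (\<lambda>r. \<phi> (a @ r @ b))"
    using sinv_append_right[OF inv', of b] by simp
  have 3: "sym_bracket_fun p eta [x, y] t (\<lambda>r. \<phi> (a @ r @ b)) = ?m * sym_bracket_fun p eta [y, x] t (\<lambda>r. \<phi> (a @ r @ b))"
    using sym_bracket_swap_left[OF inv'', of "[x]" "[y]" t] by simp
  have e: "sym_bracket_fun p eta (a @ w @ b) t \<phi> =
      msgn (wpar p (w @ b) \<and> wpar p t) * sym_bracket_fun p eta a t (\<lambda>r. \<phi> (r @ w @ b)) +
      msgn (wpar p a) * (msgn (wpar p b \<and> wpar p t) * sym_bracket_fun p eta w t (\<lambda>r. \<phi> (a @ r @ b)) +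
       msgn (wpar p w) * sym_bracket_fun p eta b t (\<lambda>r. \<phi> (a @ w @ r)))" for w
    unfolding sym_bracket_append_left[OF inv] sym_bracket_append_left[OF inv'] by simp
  have "wpar p [x, y] = wpar p [y, x]" "wpar p ([x, y] @ b) = wpar p ([y, x] @ b)" by auto
  then have "sym_bracket_fun p eta (a @ [x, y] @ b) t \<phi> = ?m * sym_bracket_fun p eta (a @ [y, x] @ b) t \<phi>"
    unfolding e 1 2 3 by (simp only: distrib_left mult.left_commute)
  then show "sym_bracket_fun p eta (a @ x # y # b) t \<phi> = ?m * sym_bracket_fun p eta (a @ y # x # b) t \<phi>" by simp
qed

end

context finite_odd_form
begin

lemma finsupp_sym_bracket_left:
  assumes "finsupp \<phi>" shows "finsupp (\<lambda>s. pairing h (\<lambda>t. sym_bracket_fun p eta s t \<phi>))"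
proof (rule finsupp_bounded[OF finite_imageI[OF finite_sym_bracket_pairing[OF assms], of fst]])
  fix s assume "pairing h (\<lambda>t. sym_bracket_fun p eta s t \<phi>) \<noteq> 0"
  then have "(\<lambda>t. sym_bracket_fun p eta s t \<phi>) \<noteq> (\<lambda>t. 0)" by auto
  then obtain t where "sym_bracket_fun p eta s t \<phi> \<noteq> 0" by blast
  then show "s \<in> fst ` {(s, t). sym_bracket_fun p eta s t \<phi> \<noteq> 0}" by (intro image_eqI[of _ _ "(s, t)"]) auto
qed

text \<open>Serves to replace \<open>l_tilde\<close> by the image of \<open>m_tilde\<close> inside a
  bracket, since the two are only identified modulo coinvariants.\<close>

theorem sym_bracket_well_defined:
  assumes "sym_eq p h h'"
  shows "sym_eq p (ext2 (sym_bracket p eta) h g) (ext2 (sym_bracket p eta) h' g)"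
proof (rule sym_eqI)
  fix \<phi> :: "'a list \<Rightarrow> 'b" assume fin: "finsupp \<phi>" and inv: "sinv p \<phi>"
  have "sinv p (\<lambda>s. pairing g (\<lambda>t. sym_bracket_fun p eta s t \<phi>))"
    unfolding sinv_def
  proof (intro allI)
    fix a x y b
    have "sym_bracket_fun p eta (a @ x # y # b) t \<phi> = msgn (p x \<and> p y) * sym_bracket_fun p eta (a @ y # x # b) t \<phi>" for t
      by (rule sinvD[OF sinv_sym_bracket[OF inv]])
    then show "pairing g (\<lambda>t. sym_bracket_fun p eta (a @ x # y # b) t \<phi>) =
        msgn (p x \<and> p y) * pairing g (\<lambda>t. sym_bracket_fun p eta (a @ y # x # b) t \<phi>)"
      by (simp only: pairing_mult_right')
  qed
  then show "pairing (ext2 (sym_bracket p eta) h g) \<phi> = pairing (ext2 (sym_bracket p eta) h' g) \<phi>"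
    unfolding pairing_ext2_sym[OF fin] by (intro sym_eqD[OF assms] finsupp_sym_bracket_left[OF fin])
qed

end

text \<open>Isolates what the Hamiltonian argument uses of the structure maps \<open>b\<close> and
  the form \<open>om\<close>; it is instantiated for A and for the matrices over A. The sign in
  \<open>om_eta\<close> stems from the Koszul sign in the definition of the inverse form.\<close>

locale cyclic_tensor = finite_odd_form p eta B
  for p :: "'a \<Rightarrow> bool" and eta :: "'a \<Rightarrow> 'a \<Rightarrow> 'b::field_char_0" and B +
  fixes om :: "'a \<Rightarrow> 'a \<Rightarrow> 'b" and b :: "'a list \<Rightarrow> 'a \<Rightarrow> 'b"
  assumes b_support: "b a z \<noteq> 0 \<Longrightarrow> a \<noteq> [] \<and> set a \<subseteq> B \<and> z \<in> B"
    and b_odd: "b a z \<noteq> 0 \<Longrightarrow> p z \<noteq> wpar p a"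
    and om_odd: "z \<in> B \<Longrightarrow> x \<in> B \<Longrightarrow> om z x \<noteq> 0 \<Longrightarrow> p z \<noteq> p x"
    and om_eta: "z \<in> B \<Longrightarrow> y \<in> B \<Longrightarrow> (\<Sum>x\<in>B. om z x * eta x y) = (if z = y then msgn (p y) else 0)"
    and cyclic_letter: "form_tensor B p b om (x # w) = msgn (p x \<and> wpar p w) * form_tensor B p b om (w @ [x])"
begin

abbreviation "tensor \<equiv> form_tensor B p b om"
abbreviation "mt \<equiv> m_tilde B p b om"

lemma cinv_tensor: "cinv p tensor"
  unfolding cinv_def
proof (intro allI)
  fix u v
  show "tensor (u @ v) = msgn (wpar p u \<and> wpar p v) * tensor (v @ u)"
  proof (induction u arbitrary: v)
    case (Cons x u)
    have "tensor (x # u @ v) = msgn (p x \<and> wpar p (u @ v)) * tensor (u @ v @ [x])"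
      using cyclic_letter[of x "u @ v"] by simp
    also have "tensor (u @ v @ [x]) = msgn (wpar p u \<and> wpar p (v @ [x])) * tensor (v @ x # u)"
      using Cons[of "v @ [x]"] by simp
    finally show ?case
      by (cases "p x"; cases "wpar p u"; cases "wpar p v"; simp add: msgn_def)
  qed simp
qed

lemma tensor_support: "tensor v \<noteq> 0 \<Longrightarrow> set v \<subseteq> B"
  by (auto simp: form_tensor_def split: if_splits)

lemma tensor_snoc:
  "tensor (a @ [x]) = (if set a \<subseteq> B \<and> x \<in> B \<and> a \<noteq> [] then eval_sgn p a * msgn (p x \<and> wpar p a) * (\<Sum>z\<in>B. b a z * om z x) else 0)"
  by (auto simp: form_tensor_def eval_sgn_snoc in_lists_conv_set Suc_le_eq)

lemma tensor_even: "tensor (a @ [x]) \<noteq> 0 \<Longrightarrow> p x = wpar p a"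
proof -
  assume *: "tensor (a @ [x]) \<noteq> 0"
  then have x: "x \<in> B" and "(\<Sum>z\<in>B. b a z * om z x) \<noteq> 0" by (auto simp: tensor_snoc split: if_splits)
  from this(2) obtain z where "z \<in> B" "b a z * om z x \<noteq> 0" by (rule sum.not_neutral_contains_not_neutral)
  then show ?thesis using b_odd[of a z] om_odd[of z x] x by auto
qed

text \<open>Contracting with \<open>eta\<close> cancels \<open>om\<close> and leaves the structure
  maps. The sign of carrying x past a cancels the one by which \<open>eval_sgn\<close> changes when
  x is appended to a.\<close>

lemma tensor_contraction:
  "(\<Sum>x\<in>B. tensor (a @ [x]) * (msgn (p x \<and> wpar p a) * eta x y)) = dual_gen p b y a"
proof (cases "set a \<subseteq> B \<and> a \<noteq> [] \<and> y \<in> B")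
  case True
  have "(\<Sum>x\<in>B. tensor (a @ [x]) * (msgn (p x \<and> wpar p a) * eta x y)) =
      (\<Sum>x\<in>B. \<Sum>z\<in>B. eval_sgn p a * b a z * (om z x * eta x y))"
  proof (rule sum.cong[OF refl])
    fix x assume "x \<in> B"
    have "msgn (p x \<and> wpar p a) * msgn (p x \<and> wpar p a) = (1 :: 'b)" by (simp add: msgn_mult)
    then show "tensor (a @ [x]) * (msgn (p x \<and> wpar p a) * eta x y) = (\<Sum>z\<in>B. eval_sgn p a * b a z * (om z x * eta x y))"
      using True \<open>x \<in> B\<close> by (simp add: tensor_snoc sum_distrib_left sum_distrib_right mult_ac msgn_def)
  qed
  also have "\<dots> = (\<Sum>z\<in>B. eval_sgn p a * b a z * (\<Sum>x\<in>B. om z x * eta x y))"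
    by (subst sum.swap) (simp add: sum_distrib_left)
  also have "\<dots> = (\<Sum>z\<in>B. if z = y then eval_sgn p a * b a y * msgn (p y) else 0)"
    by (rule sum.cong) (use True in \<open>auto simp: om_eta\<close>)
  also have "\<dots> = dual_gen p b y a" using True finite_B by (simp add: dual_gen_def)
  finally show ?thesis .
next
  case False
  then have "dual_gen p b y a = 0" using b_support[of a y] by (auto simp: dual_gen_def)
  moreover have "tensor (a @ [x]) * (msgn (p x \<and> wpar p a) * eta x y) = 0" for x
    using False form_support[of x y] by (auto simp: tensor_snoc)
  ultimately show ?thesis by (simp only: sum.neutral_const)
qed

text \<open>Rotating the letter in which \<open>G\<close> contracts to the end makes the \<open>n\<close> terms of \<open>splits G\<close> on the words of
  length \<open>n\<close> equal in sum, which cancels the factor \<open>1/n\<close> in \<open>m_tilde\<close>.\<close>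

lemma rotation_sum:
  assumes rot: "\<And>a x c. tensor (a @ x # c) * G a x c = tensor (c @ a @ [x]) * G (c @ a) x []"
    and bound: "\<And>a x c. G a x c \<noteq> 0 \<Longrightarrow> length a + length c \<le> L"
  shows "pairing mt (splits G) = (\<Sum>a\<in>word_box B L. \<Sum>x\<in>B. tensor (a @ [x]) * G a x [])"
proof -
  define S where "S n = {v. set v \<subseteq> B \<and> length v = n}" for n
  define H where "H v = tensor v * G (butlast v) (last v) []" for v
  have finS: "finite (S n)" for n unfolding S_def by (rule finite_lists_length_eq[OF finite_B])
  have box: "word_box B (Suc L) = (\<Union>n\<in>{..Suc L}. S n)" by (auto simp: word_box_def S_def)
  have "pairing mt (splits G) = (\<Sum>v\<in>word_box B (Suc L). mt v * splits G v)"
  proof (rule pairing_eq_sum')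
    fix v assume "mt v \<noteq> 0" "splits G v \<noteq> 0"
    then have "set v \<subseteq> B" using tensor_support[of v] by (auto simp: m_tilde_def)
    moreover obtain a x c where "v = a @ x # c" "G a x c \<noteq> 0" using splits_nonzero[OF \<open>splits G v \<noteq> 0\<close>] by blast
    ultimately show "v \<in> word_box B (Suc L)" using bound[of a x c] by (simp add: word_box_def)
  qed (rule finite_word_box[OF finite_B])
  also have "\<dots> = (\<Sum>n\<le>Suc L. \<Sum>v\<in>S n. mt v * splits G v)"
    unfolding box by (rule sum.UNION_disjoint) (auto simp: finS, auto simp: S_def)
  also have "\<dots> = (\<Sum>n\<le>Suc L. \<Sum>v\<in>S n. H v)"
  proof (rule sum.cong[OF refl])
    fix n
    show "(\<Sum>v\<in>S n. mt v * splits G v) = (\<Sum>v\<in>S n. H v)"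
    proof (cases "n = 0")
      case True
      then have "S n = {[]}" by (auto simp: S_def)
      then show ?thesis by (simp add: H_def m_tilde_def form_tensor_def)
    next
      case False
      have "mt v * splits G v = (\<Sum>i<n. H (drop (Suc i) v @ take (Suc i) v)) / of_nat n" if "v \<in> S n" for v
      proof -
        have len: "length v = n" using that by (simp add: S_def)
        have "tensor v * splits G v = (\<Sum>i<n. tensor v * G (take i v) (v ! i) (drop (Suc i) v))"
          by (simp add: splits_def len sum_distrib_left)
        also have "\<dots> = (\<Sum>i<n. H (drop (Suc i) v @ take (Suc i) v))"
        proof (rule sum.cong[OF refl])
          fix i assume "i \<in> {..<n}"
          then have i: "i < length v" using len by simp
          have "tensor v * G (take i v) (v ! i) (drop (Suc i) v) =
              tensor (take i v @ v ! i # drop (Suc i) v) * G (take i v) (v ! i) (drop (Suc i) v)"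
            using id_take_nth_drop[OF i] by simp
          also have "\<dots> = tensor (drop (Suc i) v @ take i v @ [v ! i]) * G (drop (Suc i) v @ take i v) (v ! i) []"
            by (rule rot)
          also have "\<dots> = H (drop (Suc i) v @ take (Suc i) v)"
            unfolding H_def take_Suc_conv_app_nth[OF i] append_assoc[symmetric] butlast_snoc last_snoc ..
          finally show "tensor v * G (take i v) (v ! i) (drop (Suc i) v) = H (drop (Suc i) v @ take (Suc i) v)" .
        qed
        finally show ?thesis by (simp add: m_tilde_def len)
      qed
      then have "(\<Sum>v\<in>S n. mt v * splits G v) = (\<Sum>i<n. \<Sum>v\<in>S n. H (drop (Suc i) v @ take (Suc i) v)) / of_nat n"
        by (subst sum.swap) (simp add: sum_divide_distrib)
      also have "(\<Sum>i<n. \<Sum>v\<in>S n. H (drop (Suc i) v @ take (Suc i) v)) = (\<Sum>i<n. \<Sum>v\<in>S n. H v)"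
      proof (rule sum.cong[OF refl])
        fix i assume "i \<in> {..<n}"
        have inj: "inj_on (\<lambda>v. drop (Suc i) v @ take (Suc i) v) (S n)"
        proof (rule inj_onI)
          fix u v assume "u \<in> S n" "v \<in> S n" "drop (Suc i) u @ take (Suc i) u = drop (Suc i) v @ take (Suc i) v"
          then have "drop (Suc i) u = drop (Suc i) v \<and> take (Suc i) u = take (Suc i) v"
            by (simp add: S_def)
          then show "u = v" by (metis append_take_drop_id)
        qed
        have "(\<lambda>v. drop (Suc i) v @ take (Suc i) v) ` S n = S n"
          by (rule endo_inj_surj[OF finS _ inj]) (fastforce simp: S_def dest: in_set_dropD in_set_takeD)
        then show "(\<Sum>v\<in>S n. H (drop (Suc i) v @ take (Suc i) v)) = (\<Sum>v\<in>S n. H v)"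
          using sum.reindex[OF inj, of H] by simp
      qed
      finally show ?thesis using False by simp
    qed
  qed
  also have "\<dots> = (\<Sum>v\<in>word_box B (Suc L). H v)"
    unfolding box by (rule sum.UNION_disjoint[symmetric]) (auto simp: finS, auto simp: S_def)
  also have "\<dots> = (\<Sum>v\<in>(\<lambda>(a, x). a @ [x]) ` (word_box B L \<times> B). H v)"
  proof (rule sum.mono_neutral_right[OF finite_word_box[OF finite_B]])
    show "(\<lambda>(a, x). a @ [x]) ` (word_box B L \<times> B) \<subseteq> word_box B (Suc L)" by (auto simp: word_box_def)
    show "\<forall>v\<in>word_box B (Suc L) - (\<lambda>(a, x). a @ [x]) ` (word_box B L \<times> B). H v = 0"
    proof
      fix v assume v: "v \<in> word_box B (Suc L) - (\<lambda>(a, x). a @ [x]) ` (word_box B L \<times> B)"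
      show "H v = 0"
      proof (cases v rule: rev_cases)
        case (snoc a x)
        then have "v \<in> (\<lambda>(a, x). a @ [x]) ` (word_box B L \<times> B)"
          using v by (intro image_eqI[of _ _ "(a, x)"]) (auto simp: word_box_def)
        then show ?thesis using v by blast
      qed (simp add: H_def form_tensor_def)
    qed
  qed
  also have "\<dots> = (\<Sum>a\<in>word_box B L. \<Sum>x\<in>B. tensor (a @ [x]) * G a x [])"
    by (subst sum.reindex) (auto simp: inj_on_def H_def sum.cartesian_product case_prod_unfold)
  finally show ?thesis .
qed

text \<open>Common core for the symmetric and the cyclic bracket, which differ only in
  \<open>K\<close>, the sign and value attached to a pair of contracted letters. By
  \<open>rot\<close> it rotates with the same sign as the tensor, so the product is unchanged;
  \<open>last\<close> is asked only for \<open>p y \<noteq> wpar p a\<close>, the parity of the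
  nonzero terms.\<close>

lemma hamiltonian_splits:
  assumes rot: "\<And>a x c d y e. t = d @ y # e \<Longrightarrow> K a x c d y e = msgn (wpar p c \<and> (p x \<noteq> wpar p a)) * K (c @ a) x [] d y e"
    and last: "\<And>a x d y e. t = d @ y # e \<Longrightarrow> p y \<noteq> wpar p a \<Longrightarrow>
      K a x [] d y e = msgn (p x \<and> wpar p a) * (msgn (wpar p d) * \<phi> (d @ a @ e))"
    and K_bound: "\<And>a x c d y e. K a x c d y e \<noteq> 0 \<Longrightarrow> length a + length c \<le> L"
    and bound: "\<And>w. \<phi> w \<noteq> 0 \<Longrightarrow> length w \<le> L"
  shows "pairing mt (splits (\<lambda>a x c. splits (\<lambda>d y e. eta x y * K a x c d y e) t)) =
    splits (\<lambda>d y e. msgn (wpar p d) * pairing (dual_gen p b y) (\<lambda>r. \<phi> (d @ r @ e))) t"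
proof -
  have "pairing mt (splits (\<lambda>a x c. splits (\<lambda>d y e. eta x y * K a x c d y e) t)) =
      (\<Sum>a\<in>word_box B L. \<Sum>x\<in>B. tensor (a @ [x]) * splits (\<lambda>d y e. eta x y * K a x [] d y e) t)"
  proof (rule rotation_sum)
    fix a x c
    have "tensor (a @ x # c) = msgn (wpar p c \<and> (p x \<noteq> wpar p a)) * tensor (c @ a @ [x])"
      using cinvD[OF cinv_tensor, of "a @ [x]" c] by (simp add: conj_commute eq_commute)
    moreover have "splits (\<lambda>d y e. eta x y * K a x c d y e) t =
        msgn (wpar p c \<and> (p x \<noteq> wpar p a)) * splits (\<lambda>d y e. eta x y * K (c @ a) x [] d y e) t"
      unfolding splits_mult[symmetric]
    proof (rule splits_cong)
      fix d y e assume t: "t = d @ y # e"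
      show "eta x y * K a x c d y e = msgn (wpar p c \<and> (p x \<noteq> wpar p a)) * (eta x y * K (c @ a) x [] d y e)"
        unfolding rot[OF t, of a x c] by (rule mult.left_commute)
    qed
    ultimately show "tensor (a @ x # c) * splits (\<lambda>d y e. eta x y * K a x c d y e) t =
        tensor (c @ a @ [x]) * splits (\<lambda>d y e. eta x y * K (c @ a) x [] d y e) t"
      by (simp add: msgn_def)
    show "splits (\<lambda>d y e. eta x y * K a x c d y e) t \<noteq> 0 \<Longrightarrow> length a + length c \<le> L"
      using splits_nonzero[of "\<lambda>d y e. eta x y * K a x c d y e" t] K_bound[of a x c] by auto
  qed
  also have "\<dots> = splits (\<lambda>d y e. \<Sum>a\<in>word_box B L. \<Sum>x\<in>B. tensor (a @ [x]) * (eta x y * K a x [] d y e)) t"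
    by (simp add: splits_sum splits_mult)
  also have "\<dots> = splits (\<lambda>d y e. msgn (wpar p d) * pairing (dual_gen p b y) (\<lambda>r. \<phi> (d @ r @ e))) t"
  proof (rule splits_cong)
    fix d y e assume t: "t = d @ y # e"
    have "(\<Sum>a\<in>word_box B L. \<Sum>x\<in>B. tensor (a @ [x]) * (eta x y * K a x [] d y e)) =
        (\<Sum>a\<in>word_box B L. dual_gen p b y a * (msgn (wpar p d) * \<phi> (d @ a @ e)))"
    proof (rule sum.cong[OF refl])
      fix a
      have "tensor (a @ [x]) * (eta x y * K a x [] d y e) =
          tensor (a @ [x]) * (msgn (p x \<and> wpar p a) * eta x y) * (msgn (wpar p d) * \<phi> (d @ a @ e))" for x
      proof (cases "tensor (a @ [x]) = 0 \<or> eta x y = 0")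
        case False
        then have "p y \<noteq> wpar p a" using tensor_even[of a x] odd_form[of x y] by auto
        then show ?thesis using last[OF t, of a x] by simp
      qed auto
      then show "(\<Sum>x\<in>B. tensor (a @ [x]) * (eta x y * K a x [] d y e)) = dual_gen p b y a * (msgn (wpar p d) * \<phi> (d @ a @ e))"
        by (simp only: tensor_contraction[symmetric] sum_distrib_right)
    qed
    also have "\<dots> = pairing (dual_gen p b y) (\<lambda>r. msgn (wpar p d) * \<phi> (d @ r @ e))"
    proof (rule pairing_eq_sum'[symmetric, OF finite_word_box[OF finite_B]])
      fix a assume "dual_gen p b y a \<noteq> 0" "msgn (wpar p d) * \<phi> (d @ a @ e) \<noteq> 0"
      then show "a \<in> word_box B L"
        using b_support[of a y] bound[of "d @ a @ e"] by (auto simp: dual_gen_def word_box_def split: if_splits)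
    qed
    finally show "(\<Sum>a\<in>word_box B L. \<Sum>x\<in>B. tensor (a @ [x]) * (eta x y * K a x [] d y e)) =
      msgn (wpar p d) * pairing (dual_gen p b y) (\<lambda>r. \<phi> (d @ r @ e))"
      by (simp only: pairing_mult_right')
  qed
  finally show ?thesis .
qed

lemma sym_hamiltonian:
  assumes fin: "finsupp \<phi>" and inv: "sinv p \<phi>"
  shows "pairing mt (\<lambda>v. sym_bracket_fun p eta v t \<phi>) =
    splits (\<lambda>d y e. msgn (wpar p d) * pairing (dual_gen p b y) (\<lambda>r. \<phi> (d @ r @ e))) t"
proof -
  obtain L where L: "\<And>w. \<phi> w \<noteq> 0 \<Longrightarrow> length w \<le> L" using finsupp_length[OF fin] by blast
  define K where "K a x c d y e = msgn ((p x \<and> wpar p a) \<noteq> (p y \<and> wpar p (a @ c @ d))) * \<phi> (a @ c @ d @ e)" for a x c d y e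
  have eq: "(\<lambda>v. sym_bracket_fun p eta v t \<phi>) = splits (\<lambda>a x c. splits (\<lambda>d y e. eta x y * K a x c d y e) t)"
    unfolding sym_bracket_fun_def K_def by (simp only: mult_ac)
  show ?thesis unfolding eq
  proof (rule hamiltonian_splits)
    fix a x c d y e
    have "\<phi> (a @ c @ d @ e) = msgn (wpar p a \<and> wpar p c) * \<phi> (c @ a @ d @ e)"
      using sinv_swap[OF inv, of "[]" a c "d @ e"] by simp
    then show "K a x c d y e = msgn (wpar p c \<and> (p x \<noteq> wpar p a)) * K (c @ a) x [] d y e"
      unfolding K_def
      by (cases "p x"; cases "p y"; cases "wpar p a"; cases "wpar p c"; cases "wpar p d"; simp add: msgn_def)
    have "\<phi> (a @ d @ e) = msgn (wpar p a \<and> wpar p d) * \<phi> (d @ a @ e)"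
      using sinv_swap[OF inv, of "[]" a d e] by simp
    then show "p y \<noteq> wpar p a \<Longrightarrow> K a x [] d y e = msgn (p x \<and> wpar p a) * (msgn (wpar p d) * \<phi> (d @ a @ e))"
      unfolding K_def
      by (cases "p x"; cases "p y"; cases "wpar p a"; cases "wpar p d"; simp add: msgn_def)
    show "K a x c d y e \<noteq> 0 \<Longrightarrow> length a + length c \<le> L"
      using L[of "a @ c @ d @ e"] by (auto simp: K_def)
  qed (rule L)
qed

lemma cyc_hamiltonian:
  assumes fin: "finsupp \<phi>" and inv: "cinv p \<phi>"
  shows "pairing mt (\<lambda>v. cyc_bracket_fun p eta v t \<phi>) =
    splits (\<lambda>d y e. msgn (wpar p d) * pairing (dual_gen p b y) (\<lambda>r. \<phi> (d @ r @ e))) t"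
proof -
  obtain L where L: "\<And>w. \<phi> w \<noteq> 0 \<Longrightarrow> length w \<le> L" using finsupp_length[OF fin] by blast
  define K where "K a x c d y e = msgn (((p x \<and> wpar p a) \<noteq> (p y \<and> (wpar p a \<noteq> (wpar p c \<noteq> wpar p d)))) \<noteq>
       ((wpar p c \<and> wpar p a) \<noteq> (wpar p e \<and> wpar p d))) * \<phi> (c @ a @ e @ d)" for a x c d y e
  have eq: "(\<lambda>v. cyc_bracket_fun p eta v t \<phi>) = splits (\<lambda>a x c. splits (\<lambda>d y e. eta x y * K a x c d y e) t)"
    unfolding cyc_bracket_fun_def K_def by (simp only: mult_ac)
  show ?thesis unfolding eq
  proof (rule hamiltonian_splits)
    fix a x c d y e
    show "K a x c d y e = msgn (wpar p c \<and> (p x \<noteq> wpar p a)) * K (c @ a) x [] d y e"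
      unfolding K_def
      by (cases "p x"; cases "p y"; cases "wpar p a"; cases "wpar p c"; cases "wpar p d"; cases "wpar p e"; simp add: msgn_def)
    have "\<phi> (a @ e @ d) = msgn (wpar p (a @ e) \<and> wpar p d) * \<phi> (d @ a @ e)"
      using cinvD[OF inv, of "a @ e" d] by simp
    then show "p y \<noteq> wpar p a \<Longrightarrow> K a x [] d y e = msgn (p x \<and> wpar p a) * (msgn (wpar p d) * \<phi> (d @ a @ e))"
      unfolding K_def
      by (cases "p x"; cases "p y"; cases "wpar p a"; cases "wpar p d"; cases "wpar p e"; simp add: msgn_def)
    show "K a x c d y e \<noteq> 0 \<Longrightarrow> length a + length c \<le> L"
      using L[of "c @ a @ e @ d"] by (auto simp: K_def)
  qed (rule L)
qed

lemma derm_support: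
  assumes "derm True p (dual_gen p b) t w \<noteq> 0"
  shows "\<exists>c y d r. t = c @ y # d \<and> w = c @ r @ d \<and> r \<noteq> [] \<and> y \<in> B"
proof -
  have "splits (\<lambda>c y d. msgn (True \<and> wpar p c) * pairing (dual_gen p b y) (\<lambda>r. mon 1 w (c @ r @ d))) t \<noteq> 0"
    using pairing_derm[of "mon 1 w" True p "dual_gen p b" t] assms by simp
  then obtain c y d where t: "t = c @ y # d" and "msgn (True \<and> wpar p c) * pairing (dual_gen p b y) (\<lambda>r. mon 1 w (c @ r @ d)) \<noteq> 0"
    by (blast dest: splits_nonzero)
  then have "pairing (dual_gen p b y) (\<lambda>r. mon 1 w (c @ r @ d)) \<noteq> 0" by auto
  moreover have "pairing (dual_gen p b y) (\<lambda>r. mon 1 w (c @ r @ d)) = pairing (dual_gen p b y) (\<lambda>r. 0)"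
    if "\<And>r. dual_gen p b y r \<noteq> 0 \<Longrightarrow> w \<noteq> c @ r @ d"
    using that by (intro pairing_cong) (auto simp: mon_def)
  ultimately obtain r where "dual_gen p b y r \<noteq> 0" "w = c @ r @ d" by auto
  then show ?thesis using t b_support[of r y] by (auto simp: dual_gen_def split: if_splits)
qed

theorem sym_bracket_m_tilde:
  "sym_eq p (ext2 (sym_bracket p eta) mt g) (CE_diff p b g)"
proof (rule sym_eqI)
  fix \<phi> :: "'a list \<Rightarrow> 'b" assume fin: "finsupp \<phi>" and inv: "sinv p \<phi>"
  have fin_derm: "finite {t. g t \<noteq> 0 \<and> derm True p (dual_gen p b) t w \<noteq> 0}" for w
  proof (rule finite_subset)
    show "{t. g t \<noteq> 0 \<and> derm True p (dual_gen p b) t w \<noteq> 0} \<subseteq> word_box (set w \<union> B) (length w)"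
    proof (rule subsetI, clarify)
      fix t assume "derm True p (dual_gen p b) t w \<noteq> 0"
      from derm_support[OF this] show "t \<in> word_box (set w \<union> B) (length w)"
        by (auto simp: word_box_def Suc_le_eq)
    qed
  qed (simp add: finite_word_box finite_B)
  have "pairing (ext2 (sym_bracket p eta) mt g) \<phi> = pairing g (\<lambda>t. pairing mt (\<lambda>v. sym_bracket_fun p eta v t \<phi>))"
    unfolding pairing_ext2_sym[OF fin] by (rule pairing_swap[OF finite_sym_bracket_pairing[OF fin]])
  also have "\<dots> = pairing (CE_diff p b g) \<phi>"
    unfolding CE_diff_def pairing_ext1[OF fin fin_derm]
    by (simp add: sym_hamiltonian[OF fin inv] pairing_derm[OF fin])
  finally show "pairing (ext2 (sym_bracket p eta) mt g) \<phi> = pairing (CE_diff p b g) \<phi>" .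
qed

text \<open>Bracketing with a single word meets one word of W at a time, where
  \<open>cyc_hamiltonian\<close> gives the derivation of that word. What remains is the sign of
  returning the new word from the front to its place.\<close>

theorem nc_bracket_m_tilde:
  assumes f: "\<And>W. f W \<noteq> 0 \<Longrightarrow> [] \<notin> set W"
  shows "nc_eq p (ext2 (nc_bracket p eta) (single mt) f) (SCC_diff p b f)"
proof (rule nc_eqI)
  fix \<phi> :: "'a list list \<Rightarrow> 'b" assume fin: "finsupp \<phi>" and inv: "nc_inv p \<phi>"
  let ?d = "\<lambda>w. single (derm True p (dual_gen p b) w)"
  let ?D = "derm True (wpar p) ?d"
  have fin1: "finsupp (\<lambda>r. \<phi> (r # V))" for V by (rule finsupp_Cons_left[OF fin])
  have fin2: "finsupp (\<lambda>r. \<phi> (U @ r # V))" for U V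
    using finsupp_Cons_left[OF finsupp_append_left[OF fin]] .
  have finU: "finsupp (\<lambda>r. \<phi> (U @ r @ V))" for U V
    using finsupp_append_right[OF finsupp_append_left[OF fin, of U], of V] by simp
  have inv1: "cinv p (\<lambda>r. \<phi> (r # V))" for V
  proof -
    have "cinv p (\<lambda>w. \<phi> ([] @ w # V))" using inv unfolding nc_inv_def by blast
    then show ?thesis by simp
  qed
  have pairD: "pairing (?D W) \<psi> = splits (\<lambda>A w C. msgn (wpar (wpar p) A) *
      pairing (derm True p (dual_gen p b) w) (\<lambda>r. \<psi> (A @ r # C))) W" if \<psi>: "finsupp \<psi>" for W \<psi>
  proof -
    have "finsupp (\<lambda>r. \<psi> (A @ r @ C))" for A C
      using finsupp_append_right[OF finsupp_append_left[OF \<psi>, of A], of C] by simp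
    then show ?thesis by (simp add: pairing_derm[OF \<psi>] pairing_single)
  qed
  have fin_D: "finite {W. f W \<noteq> 0 \<and> ?D W V \<noteq> 0}" for V
  proof (rule finite_subset)
    let ?n = "length V + length (concat V)"
    show "{W. f W \<noteq> 0 \<and> ?D W V \<noteq> 0} \<subseteq> nc_box (set (concat V) \<union> B) ?n"
    proof (rule subsetI, clarify)
      fix W assume "?D W V \<noteq> 0"
      then have "splits (\<lambda>A w C. msgn (wpar (wpar p) A) *
          pairing (derm True p (dual_gen p b) w) (\<lambda>r. mon 1 V (A @ r # C))) W \<noteq> 0"
        using pairD[of "mon 1 V" W] by simp
      then obtain A w C where W: "W = A @ w # C" and "msgn (wpar (wpar p) A) *
          pairing (derm True p (dual_gen p b) w) (\<lambda>r. mon 1 V (A @ r # C)) \<noteq> 0"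
        by (blast dest: splits_nonzero)
      then have "pairing (derm True p (dual_gen p b) w) (\<lambda>r. mon 1 V (A @ r # C)) \<noteq> 0" by auto
      moreover have "pairing (derm True p (dual_gen p b) w) (\<lambda>r. mon 1 V (A @ r # C)) = pairing (derm True p (dual_gen p b) w) (\<lambda>r. 0)"
        if "\<And>r. derm True p (dual_gen p b) w r \<noteq> 0 \<Longrightarrow> V \<noteq> A @ r # C"
        using that by (intro pairing_cong) (auto simp: mon_def)
      ultimately obtain r where r: "derm True p (dual_gen p b) w r \<noteq> 0" "V = A @ r # C" by auto
      from derm_support[OF r(1)] obtain c y d q where "w = c @ y # d" "r = c @ q @ d" "q \<noteq> []" "y \<in> B" by blast
      then show "W \<in> nc_box (set (concat V) \<union> B) ?n"
        unfolding W r(2) by (intro nc_boxI) (auto simp: Suc_le_eq)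
    qed
  qed (simp add: finite_nc_box finite_B)
  have finB: "finite {(U, W). nc_bracket_fun p eta U W \<phi> \<noteq> 0}"
    using finsupp_pairing[OF fin, of "\<lambda>(U, W). nc_bracket p eta U W"] finite_nc_bracket
    by (simp add: finsupp_def case_prod_unfold pairing_nc_bracket[OF fin])
  have finB1: "finsupp (\<lambda>U. pairing f (\<lambda>W. nc_bracket_fun p eta U W \<phi>))"
  proof (rule finsupp_bounded[OF finite_imageI[OF finB, of fst]])
    fix U assume "pairing f (\<lambda>W. nc_bracket_fun p eta U W \<phi>) \<noteq> 0"
    then have "(\<lambda>W. nc_bracket_fun p eta U W \<phi>) \<noteq> (\<lambda>W. 0)" by auto
    then obtain W where "nc_bracket_fun p eta U W \<phi> \<noteq> 0" by blast
    then show "U \<in> fst ` {(U, W). nc_bracket_fun p eta U W \<phi> \<noteq> 0}" by (intro image_eqI[of _ _ "(U, W)"]) auto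
  qed
  have finB2: "finite {(v, W). nc_bracket_fun p eta [v] W \<phi> \<noteq> 0}"
    using finite_vimageI[OF finB, of "\<lambda>(v, W). ([v], W)"]
    by (simp add: vimage_def case_prod_unfold inj_def prod_eq_iff)
  have finC: "finsupp (\<lambda>v. msgn m * cyc_bracket_fun p eta v w (\<lambda>r. \<phi> (r # V)))" for m w V
  proof (rule finsupp_mult_const, rule finsupp_bounded)
    show "finite (\<Union>r\<in>{r. \<phi> (r # V) \<noteq> 0}. word_box (set r \<union> B) (Suc (length r)))"
      using fin1[of V] finite_B by (auto simp: finsupp_def finite_word_box)
    fix v assume "cyc_bracket_fun p eta v w (\<lambda>r. \<phi> (r # V)) \<noteq> 0"
    from cyc_bracket_support[OF this] obtain a x c d y e where
      "v = a @ x # c" "x \<in> B" "\<phi> ((c @ a @ e @ d) # V) \<noteq> 0" by blast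
    then show "v \<in> (\<Union>r\<in>{r. \<phi> (r # V) \<noteq> 0}. word_box (set r \<union> B) (Suc (length r)))"
      by (intro UN_I[of "c @ a @ e @ d"]) (auto simp: word_box_def)
  qed
  have word: "nc_bracket_fun p eta [v] W \<phi> = splits (\<lambda>C w D. msgn (wpar p w \<and> wpar (wpar p) C) *
      cyc_bracket_fun p eta v w (\<lambda>r. \<phi> (r # C @ D))) W" for v W
    by (simp add: nc_bracket_fun_def)
  have "pairing (ext2 (nc_bracket p eta) (single mt) f) \<phi> =
      pairing mt (\<lambda>v. pairing f (\<lambda>W. nc_bracket_fun p eta [v] W \<phi>))"
    unfolding pairing_ext2_nc[OF fin] by (rule pairing_single[OF finB1])
  also have "\<dots> = pairing f (\<lambda>W. pairing mt (\<lambda>v. nc_bracket_fun p eta [v] W \<phi>))"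
    by (rule pairing_swap[OF finB2])
  also have "\<dots> = pairing f (\<lambda>W. pairing (?D W) \<phi>)"
  proof (rule pairing_cong)
    fix W
    have "pairing mt (\<lambda>v. nc_bracket_fun p eta [v] W \<phi>) = splits (\<lambda>C w D. msgn (wpar p w \<and> wpar (wpar p) C) *
        pairing mt (\<lambda>v. cyc_bracket_fun p eta v w (\<lambda>r. \<phi> (r # C @ D)))) W"
      unfolding word by (subst pairing_splits_right[OF finC]) (simp only: pairing_mult_right')
    also have "\<dots> = pairing (?D W) \<phi>"
      unfolding pairD[OF fin]
    proof (rule splits_cong)
      fix C w D
      \<comment> \<open>The derived word has the parity opposite to w, and \<open>?s\<close> is the
        sign of carrying it back past C. Together with the sign of bringing w to the front this
        leaves the sign of an odd derivation passing C.\<close>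
      let ?s = "msgn (\<not> wpar p w \<and> wpar (wpar p) C) :: 'b"
      have "pairing mt (\<lambda>v. cyc_bracket_fun p eta v w (\<lambda>r. \<phi> (r # C @ D))) =
          splits (\<lambda>d y e. msgn (wpar p d) * pairing (dual_gen p b y) (\<lambda>r. \<phi> ((d @ r @ e) # C @ D))) w"
        by (rule cyc_hamiltonian[OF fin1 inv1])
      also have "\<dots> = splits (\<lambda>d y e. msgn (wpar p d) * pairing (dual_gen p b y) (\<lambda>r. ?s * \<phi> (C @ (d @ r @ e) # D))) w"
      proof (intro splits_cong arg_cong2[where f = "(*)"] refl pairing_cong)
        fix d y e r assume w: "w = d @ y # e" and "dual_gen p b y r \<noteq> 0"
        then have "p y \<noteq> wpar p r" using b_odd[of r y] by (auto simp: dual_gen_def split: if_splits)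
        then have par: "wpar p (d @ r @ e) = (\<not> wpar p w)" unfolding w by auto
        have "\<phi> ([d @ r @ e] @ C @ D) = msgn (wpar p (d @ r @ e) \<and> wpar (wpar p) C) * \<phi> (C @ [d @ r @ e] @ D)"
          using sinv_swap[of "wpar p" \<phi> "[]" "[d @ r @ e]" C D] inv unfolding nc_inv_def by simp
        then show "\<phi> ((d @ r @ e) # C @ D) = ?s * \<phi> (C @ (d @ r @ e) # D)" unfolding par by simp
      qed
      also have "\<dots> = ?s * pairing (derm True p (dual_gen p b) w) (\<lambda>r. \<phi> (C @ r # D))"
        unfolding pairing_mult_right' pairing_derm[OF fin2] splits_mult[symmetric] by (simp add: mult.left_commute)
      finally show "msgn (wpar p w \<and> wpar (wpar p) C) * pairing mt (\<lambda>v. cyc_bracket_fun p eta v w (\<lambda>r. \<phi> (r # C @ D))) =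
          msgn (wpar (wpar p) C) * pairing (derm True p (dual_gen p b) w) (\<lambda>r. \<phi> (C @ r # D))"
        by (simp add: msgn_def)
    qed
    finally show "pairing mt (\<lambda>v. nc_bracket_fun p eta [v] W \<phi>) = pairing (?D W) \<phi>" .
  qed
  also have "\<dots> = pairing (SCC_diff p b f) \<phi>"
    unfolding SCC_diff_def by (rule pairing_ext1[OF fin fin_D, symmetric])
  finally show "pairing (ext2 (nc_bracket p eta) (single mt) f) \<phi> = pairing (SCC_diff p b f) \<phi>" .
qed

end

section \<open>Symmetrisation of the cyclic tensor into the commutator structure\<close>

context cyclic_tensor
begin

text \<open>On an invariant functional all permuted summands of the commutator structure contribute equally.\<close>

theorem sym_eq_l_tilde: "sym_eq p (l_tilde B p b om) mt"
proof (rule sym_eqI)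
  fix \<phi> :: "'a list \<Rightarrow> 'b" assume fin: "finsupp \<phi>" and inv: "sinv p \<phi>"
  obtain L where L: "\<And>w. \<phi> w \<noteq> 0 \<Longrightarrow> length w \<le> L" using finsupp_length[OF fin] by blast
  define S where "S n = {v. set v \<subseteq> B \<and> length v = n}" for n
  have finS: "finite (S n)" for n unfolding S_def by (rule finite_lists_length_eq[OF finite_B])
  have box: "word_box B L = (\<Union>n\<in>{..L}. S n)" by (auto simp: word_box_def S_def)
  have expand: "pairing f \<phi> = (\<Sum>n\<le>L. \<Sum>v\<in>S n. f v * \<phi> v)" if f: "\<And>v. f v \<noteq> 0 \<Longrightarrow> set v \<subseteq> B" for f
  proof -
    have "pairing f \<phi> = (\<Sum>v\<in>word_box B L. f v * \<phi> v)"
      by (rule pairing_eq_sum'[OF finite_word_box[OF finite_B]]) (simp add: word_box_def f L)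
    then show ?thesis unfolding box by (subst (asm) sum.UNION_disjoint) (auto simp: finS, auto simp: S_def)
  qed
  have S_Suc: "(\<Sum>v\<in>S (Suc m). F v) = (\<Sum>x\<in>B. \<Sum>a\<in>S m. F (a @ [x]))" for m and F :: "'a list \<Rightarrow> 'b"
  proof -
    have "S (Suc m) = (\<lambda>(x, a). a @ [x]) ` (B \<times> S m)"
    proof (intro equalityI subsetI)
      fix v assume v: "v \<in> S (Suc m)"
      show "v \<in> (\<lambda>(x, a). a @ [x]) ` (B \<times> S m)"
      proof (cases v rule: rev_cases)
        case (snoc a x)
        then show ?thesis using v by (intro image_eqI[of _ _ "(x, a)"]) (auto simp: S_def)
      qed (use v in \<open>simp add: S_def\<close>)
    qed (auto simp: S_def)
    then show ?thesis
      by (simp add: sum.reindex inj_on_def case_prod_unfold prod_eq_iff sum.cartesian_product)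
  qed
  have main: "(\<Sum>a\<in>S m. l_tilde B p b om (a @ [x]) * \<phi> (a @ [x])) = (\<Sum>a\<in>S m. mt (a @ [x]) * \<phi> (a @ [x]))"
    if x: "x \<in> B" and m: "m \<noteq> 0" for m x
  proof -
    let ?P = "permutations_of_set {..<m}"
    define T where "T a = eval_sgn p (a @ [x]) * (\<Sum>z\<in>B. b a z * om z x) * \<phi> (a @ [x])" for a
    have perm: "(\<Sum>a\<in>S m. T (map ((!) a) ps)) = (\<Sum>a\<in>S m. T a)" if ps: "ps \<in> ?P" for ps
    proof -
      have len: "length ps = m" using ps by (simp add: permutations_of_set_def distinct_card[symmetric])
      have set: "set ps = {..<m}" using ps by (simp add: permutations_of_set_def)
      have inj: "inj_on (\<lambda>a. map ((!) a) ps) (S m)"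
      proof (rule inj_onI)
        fix a a' assume "a \<in> S m" "a' \<in> S m" and eq: "map ((!) a) ps = map ((!) a') ps"
        then have l: "length a = m" "length a' = m" by (auto simp: S_def)
        from eq have "\<forall>i\<in>{..<m}. a ! i = a' ! i" by (simp add: set)
        then show "a = a'" using l by (intro nth_equalityI) auto
      qed
      have "(\<lambda>a. map ((!) a) ps) ` S m = S m"
      proof (rule endo_inj_surj[OF finS _ inj])
        show "(\<lambda>a. map ((!) a) ps) ` S m \<subseteq> S m"
          using set len by (force simp: S_def)
      qed
      then show ?thesis using sum.reindex[OF inj, of T] by simp
    qed
    have "l_tilde B p b om (a @ [x]) * \<phi> (a @ [x]) = (\<Sum>ps\<in>?P. T (map ((!) a) ps)) / fact (Suc m)" if a: "a \<in> S m" for a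
    proof -
      have la: "length a = m" "set a \<subseteq> B" using a by (auto simp: S_def)
      have "form_tensor B p (commutator_consts p b) om (a @ [x]) * \<phi> (a @ [x]) =
          eval_sgn p (a @ [x]) * (\<Sum>z\<in>B. (\<Sum>ps\<in>?P. koszul p a ps * b (map ((!) a) ps) z) * om z x) * \<phi> (a @ [x])"
        using la m x by (simp add: form_tensor_def commutator_consts_def in_lists_conv_set subset_iff Suc_le_eq)
      also have "\<dots> = (\<Sum>ps\<in>?P. eval_sgn p (a @ [x]) * (\<Sum>z\<in>B. b (map ((!) a) ps) z * om z x) * (koszul p a ps * \<phi> (a @ [x])))"
        unfolding sum_distrib_left sum_distrib_right by (subst sum.swap) (simp add: mult_ac)
      also have "\<dots> = (\<Sum>ps\<in>?P. T (map ((!) a) ps))"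
      proof (rule sum.cong[OF refl])
        fix ps assume ps: "ps \<in> ?P"
        have mv: "sym_move p a (koszul p a ps :: 'b) (map ((!) a) ps)"
          using ps la unfolding sym_move_def by blast
        have "\<phi> (a @ [x]) = koszul p a ps * \<phi> (map ((!) a) ps @ [x])"
          by (rule sinv_sym_move[OF sinv_append_right[OF inv] mv])
        then have "koszul p a ps * \<phi> (a @ [x]) = \<phi> (map ((!) a) ps @ [x])"
          using koszul_cases[of p a ps, where 'k = 'b] by auto
        moreover have "eval_sgn p (a @ [x]) = (eval_sgn p (map ((!) a) ps @ [x]) :: 'b)"
          using sym_move_mset[OF mv] by (intro eval_sgn_mset) simp
        ultimately show "eval_sgn p (a @ [x]) * (\<Sum>z\<in>B. b (map ((!) a) ps) z * om z x) * (koszul p a ps * \<phi> (a @ [x])) =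
            T (map ((!) a) ps)" by (simp add: T_def)
      qed
      finally show ?thesis by (simp add: l_tilde_def la del: fact_Suc)
    qed
    then have "(\<Sum>a\<in>S m. l_tilde B p b om (a @ [x]) * \<phi> (a @ [x])) = (\<Sum>ps\<in>?P. \<Sum>a\<in>S m. T (map ((!) a) ps)) / fact (Suc m)"
      by (subst sum.swap) (simp add: sum_divide_distrib del: fact_Suc)
    \<comment> \<open>There are m! permutations with equal contributions, which turns the factor
      1/(m+1)! of \<open>l_tilde\<close> into the 1/(m+1) of \<open>m_tilde\<close>.\<close>
    also have "\<dots> = fact m * (\<Sum>a\<in>S m. T a) / fact (Suc m)"
      by (simp add: perm)
    also have "\<dots> = (\<Sum>a\<in>S m. T a) / of_nat (Suc m)"
      by (simp only: fact_Suc mult.commute[of "of_nat (Suc m)"]) (simp del: of_nat_Suc)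
    also have "\<dots> = (\<Sum>a\<in>S m. mt (a @ [x]) * \<phi> (a @ [x]))"
      unfolding sum_divide_distrib
    proof (rule sum.cong[OF refl])
      fix a assume "a \<in> S m"
      then have "length a = m" "set a \<subseteq> B" by (auto simp: S_def)
      then show "T a / of_nat (Suc m) = mt (a @ [x]) * \<phi> (a @ [x])"
        using m x by (simp add: T_def m_tilde_def form_tensor_def in_lists_conv_set subset_iff Suc_le_eq)
    qed
    finally show ?thesis .
  qed
  have "(\<Sum>v\<in>S n. l_tilde B p b om v * \<phi> v) = (\<Sum>v\<in>S n. mt v * \<phi> v)" for n
  proof -
    consider "n < 2" | m where "n = Suc m" "m \<noteq> 0" by (metis One_nat_def less_2_cases_iff not0_implies_Suc)
    then show ?thesis
    proof cases
      case 1
      then show ?thesis by (intro sum.cong refl) (auto simp: S_def l_tilde_def m_tilde_def form_tensor_def)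
    next
      case 2
      then show ?thesis by (simp add: S_Suc main)
    qed
  qed
  moreover have "set v \<subseteq> B" if "l_tilde B p b om v \<noteq> 0" for v
    using that by (auto simp: l_tilde_def form_tensor_def split: if_splits)
  moreover have "set v \<subseteq> B" if "mt v \<noteq> 0" for v
    using that by (auto simp: m_tilde_def form_tensor_def split: if_splits)
  ultimately show "pairing (l_tilde B p b om) \<phi> = pairing mt \<phi>" by (simp add: expand)
qed

end

section \<open>Uniqueness and shape of the inverse form\<close>

section \<open>The inverse form\<close>

text \<open>\<open>R\<close> and \<open>L\<close> are a right and a left inverse of the matrix of
  the form; they may be given by different formulas, and their agreement on \<open>B\<close> is
  derived.\<close>

locale invertible_form =
  fixes B :: "'x set" and p :: "'x \<Rightarrow> bool" and om R L :: "'x \<Rightarrow> 'x \<Rightarrow> 'k::field_char_0"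
  assumes fin: "finite B"
    and right: "x \<in> B \<Longrightarrow> y \<in> B \<Longrightarrow> (\<Sum>u\<in>B. om x u * R u y) = (if x = y then 1 else 0)"
    and left: "x \<in> B \<Longrightarrow> y \<in> B \<Longrightarrow> (\<Sum>u\<in>B. L x u * om u y) = (if x = y then 1 else 0)"
    and odd: "x \<in> B \<Longrightarrow> y \<in> B \<Longrightarrow> om x y \<noteq> 0 \<Longrightarrow> p x \<noteq> p y"
begin

text \<open>Associativity: L = L (om R') = (L om) R' = R'. The right inverse \<open>R'\<close> is
  arbitrary so that modifications of \<open>R\<close> can be fed in.\<close>

lemma right_eq_left:
  assumes R': "\<And>x y. x \<in> B \<Longrightarrow> y \<in> B \<Longrightarrow> (\<Sum>u\<in>B. om x u * R' u y) = (if x = y then 1 else 0)"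
    and "x \<in> B" "y \<in> B"
  shows "R' x y = L x y"
proof -
  have "L x y = (\<Sum>u\<in>B. L x u * (\<Sum>v\<in>B. om u v * R' v y))"
    using assms fin by (simp add: R' if_distrib[of "(*) _"] cong: if_cong)
  also have "\<dots> = (\<Sum>v\<in>B. (\<Sum>u\<in>B. L x u * om u v) * R' v y)"
    unfolding sum_distrib_left sum_distrib_right by (subst sum.swap) (simp add: mult.assoc)
  also have "\<dots> = (\<Sum>v\<in>B. if v = x then R' v y else 0)"
    by (rule sum.cong) (use assms in \<open>auto simp: left\<close>)
  also have "\<dots> = R' x y" using assms fin by simp
  finally show ?thesis by simp
qed

lemma left_right: "x \<in> B \<Longrightarrow> y \<in> B \<Longrightarrow> (\<Sum>u\<in>B. om x u * L u y) = (if x = y then 1 else 0)"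
  by (subst right[symmetric]) (auto intro!: sum.cong simp: right_eq_left[OF right])

text \<open>Keeping only the parity-changing entries of \<open>R\<close> gives another right
  inverse, because \<open>om\<close> changes parity; by uniqueness it is \<open>L\<close>.\<close>

lemma left_odd:
  assumes "x \<in> B" "y \<in> B" "L x y \<noteq> 0" shows "p x \<noteq> p y"
proof -
  define R' where "R' u y = (if p u \<noteq> p y then R u y else 0)" for u y
  have "(\<Sum>u\<in>B. om x u * R' u y) = (if x = y then 1 else 0)" if xy: "x \<in> B" "y \<in> B" for x y
  proof (cases "p x = p y")
    case True
    have "(\<Sum>u\<in>B. om x u * R' u y) = (\<Sum>u\<in>B. om x u * R u y)"
      by (rule sum.cong) (use odd[OF xy(1)] True in \<open>auto simp: R'_def\<close>)
    then show ?thesis using xy by (simp add: right)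
  next
    case False
    have "(\<Sum>u\<in>B. om x u * R' u y) = 0"
      by (rule sum.neutral) (use odd[OF xy(1)] False in \<open>auto simp: R'_def\<close>)
    then show ?thesis using False by auto
  qed
  from right_eq_left[OF this assms(1,2)] show ?thesis using assms(3) by (auto simp: R'_def split: if_splits)
qed

text \<open>As matrices, the defining equation says that om eta om equals om up to the sign of the
  row. Multiplying by \<open>L\<close> on the left and by \<open>R\<close> on the right determines
  eta and turns that sign into \<open>msgn (p y)\<close>.\<close>

lemma inv_form_eq: "inv_form B p om = (\<lambda>x y. if x \<in> B \<and> y \<in> B then msgn (p y) * L x y else 0)"
  unfolding inv_form_def
proof (rule the_equality, intro conjI allI impI ballI)
  let ?e = "\<lambda>x y. if x \<in> B \<and> y \<in> B then msgn (p y) * L x y else 0"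
  show "?e x y = 0" if "x \<notin> B \<or> y \<notin> B" for x y using that by auto
  have sq: "msgn c * (msgn c * k) = k" for c and k :: 'k by (simp add: msgn_def)
  show "msgn (p x) * (\<Sum>u\<in>B. \<Sum>v\<in>B. om x u * om v y * ?e u v) = om x y" if xy: "x \<in> B" "y \<in> B" for x y
  proof -
    have "(\<Sum>u\<in>B. \<Sum>v\<in>B. om x u * om v y * ?e u v) = (\<Sum>v\<in>B. \<Sum>u\<in>B. om v y * msgn (p v) * (om x u * L u v))"
      by (subst sum.swap) (intro sum.cong refl, simp add: mult_ac)
    also have "\<dots> = (\<Sum>v\<in>B. om v y * msgn (p v) * (if x = v then 1 else 0))"
      unfolding sum_distrib_left[symmetric] by (rule sum.cong) (use xy left_right in auto)
    also have "\<dots> = (\<Sum>v\<in>B. if v = x then om x y * msgn (p x) else 0)"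
      by (rule sum.cong) auto
    also have "\<dots> = om x y * msgn (p x)" using fin xy by simp
    finally show ?thesis using sq[of "p x" "om x y"] by (simp add: mult_ac)
  qed
  fix e assume e: "(\<forall>x y. x \<notin> B \<or> y \<notin> B \<longrightarrow> e x y = 0) \<and>
    (\<forall>x\<in>B. \<forall>y\<in>B. msgn (p x) * (\<Sum>u\<in>B. \<Sum>v\<in>B. om x u * om v y * e u v) = om x y)"
  show "e = ?e"
  proof (intro ext)
    fix x y
    show "e x y = ?e x y"
    proof (cases "x \<in> B \<and> y \<in> B")
      case True
      have K: "(\<Sum>u\<in>B. \<Sum>v\<in>B. om z u * om v w * e u v) = msgn (p z) * om z w" if "z \<in> B" "w \<in> B" for z w
      proof -
        have eq: "msgn (p z) * (\<Sum>u\<in>B. \<Sum>v\<in>B. om z u * om v w * e u v) = om z w"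
          using e that by blast
        show ?thesis unfolding eq[symmetric] sq ..
      qed
      have "(\<Sum>z\<in>B. \<Sum>w\<in>B. L x z * (\<Sum>u\<in>B. \<Sum>v\<in>B. om z u * om v w * e u v) * R w y) =
          (\<Sum>z\<in>B. \<Sum>w\<in>B. L x z * msgn (p z) * (om z w * R w y))"
        by (intro sum.cong refl, subst K) (simp_all add: mult_ac)
      also have "\<dots> = (\<Sum>z\<in>B. L x z * msgn (p z) * (if z = y then 1 else 0))"
        unfolding sum_distrib_left[symmetric] by (rule sum.cong) (use True right in auto)
      also have "\<dots> = (\<Sum>z\<in>B. if z = y then msgn (p y) * L x y else 0)" by (rule sum.cong) auto
      also have "\<dots> = msgn (p y) * L x y" using True fin by simp
      finally have 1: "(\<Sum>z\<in>B. \<Sum>w\<in>B. L x z * (\<Sum>u\<in>B. \<Sum>v\<in>B. om z u * om v w * e u v) * R w y) = msgn (p y) * L x y" .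
      have "(\<Sum>z\<in>B. \<Sum>w\<in>B. L x z * (\<Sum>u\<in>B. \<Sum>v\<in>B. om z u * om v w * e u v) * R w y) =
          (\<Sum>z\<in>B. \<Sum>w\<in>B. \<Sum>u\<in>B. \<Sum>v\<in>B. (L x z * om z u) * (om v w * R w y) * e u v)"
        by (simp add: sum_distrib_left sum_distrib_right mult_ac)
      also have "\<dots> = (\<Sum>z\<in>B. \<Sum>u\<in>B. \<Sum>v\<in>B. \<Sum>w\<in>B. (L x z * om z u) * (om v w * R w y) * e u v)"
        by (rule sum.cong[OF refl], subst sum.swap, rule sum.cong[OF refl], rule sum.swap)
      also have "\<dots> = (\<Sum>u\<in>B. \<Sum>v\<in>B. \<Sum>z\<in>B. \<Sum>w\<in>B. (L x z * om z u) * (om v w * R w y) * e u v)"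
        by (subst sum.swap, rule sum.cong[OF refl], rule sum.swap)
      also have "\<dots> = (\<Sum>u\<in>B. \<Sum>v\<in>B. (\<Sum>z\<in>B. L x z * om z u) * (\<Sum>w\<in>B. om v w * R w y) * e u v)"
        by (intro sum.cong refl) (simp only: sum_product, simp only: sum_distrib_right)
      also have "\<dots> = (\<Sum>u\<in>B. \<Sum>v\<in>B. if v = y then if u = x then e x y else 0 else 0)"
        by (intro sum.cong refl) (use True in \<open>auto simp: left right\<close>)
      also have "\<dots> = e x y" using True fin by simp
      finally show ?thesis using 1 True by simp
    qed (use e in auto)
  qed
qed

lemma finite_odd_form_inv: "finite_odd_form p (inv_form B p om) B"
  by unfold_locales (use left_odd fin in \<open>auto simp: inv_form_eq split: if_splits\<close>)

lemma form_inv_form: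
  assumes "z \<in> B" "y \<in> B"
  shows "(\<Sum>x\<in>B. om z x * inv_form B p om x y) = (if z = y then msgn (p y) else 0)"
proof -
  have "(\<Sum>x\<in>B. om z x * inv_form B p om x y) = msgn (p y) * (\<Sum>x\<in>B. om z x * L x y)"
    using assms by (simp add: inv_form_eq sum_distrib_left mult_ac)
  then show ?thesis using assms by (simp add: left_right)
qed

end

section \<open>The trace pairing and tensors with matrix coefficients\<close>

section \<open>Matrices over a cyclic tensor\<close>

lemma unit_prod_snoc: "unit_prod (ps @ [(k, l)]) c d = (if l = d then unit_prod ps c k else 0)"
  by (induction ps arbitrary: c) auto

lemma unit_trace_snoc: "l < N \<Longrightarrow> unit_trace N (ps @ [(k, l)]) = unit_prod ps l k"
  by (simp add: unit_trace_def unit_prod_snoc)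

lemma unit_trace_Cons: "k < N \<Longrightarrow> unit_trace N ((k, l) # ps) = unit_prod ps l k"
  by (simp add: unit_trace_def)

lemma unit_trace_pair: "unit_trace N [(a, b), (c, d)] = (if a < N \<and> b = c \<and> d = a then 1 else 0)"
proof (cases "a < N")
  case True
  then show ?thesis by (auto simp: unit_trace_Cons)
qed (auto simp: unit_trace_def intro!: sum.neutral)

lemma sum_mat_basis:
  "finite B \<Longrightarrow> (\<Sum>u\<in>mat_basis N B. F u) = (\<Sum>x\<in>B. \<Sum>i<N. \<Sum>j<N. F (x, i, j))"
  by (simp add: mat_basis_def sum.cartesian_product case_prod_unfold)

lemma sum_delta_delta:
  fixes k :: "'k::comm_ring_1" and N :: nat
  assumes "a < N" "b < N"
  shows "(\<Sum>i<N. \<Sum>j<N. if i = a \<and> j = b then k else 0) = k"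
proof -
  have "(\<Sum>i<N. \<Sum>j<N. if i = a \<and> j = b then k else 0) = (\<Sum>i<N. if i = a then (\<Sum>j<N. if j = b then k else 0) else 0)"
    by (intro sum.cong refl) auto
  also have "\<dots> = k" by (subst sum.delta, simp, subst sum.delta) (use assms in simp_all)
  finally show ?thesis .
qed

text \<open>The trace pairs E_ij with E_ji, so on matrix units the inverse is again the exchange of
  the two indices.\<close>

definition mat_inverse :: "('x \<Rightarrow> 'x \<Rightarrow> 'k::field_char_0) \<Rightarrow> 'x \<times> nat \<times> nat \<Rightarrow> 'x \<times> nat \<times> nat \<Rightarrow> 'k" where
  "mat_inverse R u v = (if fst (snd u) = snd (snd v) \<and> snd (snd u) = fst (snd v) then R (fst u) (fst v) else 0)"

lemma shift_mat_form: "shift_form (\<lambda>y. par (fst y)) (mat_form N ip) = mat_form N (shift_form par ip)"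
  by (simp add: shift_form_def mat_form_def fun_eq_iff)

lemma (in invertible_form) invertible_mat:
  "invertible_form (mat_basis N B) (\<lambda>y. p (fst y)) (mat_form N om) (mat_inverse R) (mat_inverse L)"
proof
  show "finite (mat_basis N B)" using fin by (simp add: mat_basis_def)
  fix x y assume "x \<in> mat_basis N B" "y \<in> mat_basis N B"
  then obtain x0 a b y0 c d where x: "x = (x0, a, b)" "x0 \<in> B" "a < N" "b < N" and y: "y = (y0, c, d)" "y0 \<in> B" "c < N" "d < N"
    by (auto simp: mat_basis_def)
  have "(\<Sum>u\<in>mat_basis N B. mat_form N om x u * mat_inverse R u y) =
      (\<Sum>u0\<in>B. \<Sum>i<N. \<Sum>j<N. if i = b \<and> j = a then (if a = c \<and> b = d then om x0 u0 * R u0 y0 else 0) else 0)"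
    unfolding sum_mat_basis[OF fin]
    by (intro sum.cong refl) (use x y in \<open>auto simp: mat_form_def unit_trace_pair mat_inverse_def\<close>)
  also have "\<dots> = (if a = c \<and> b = d then \<Sum>u0\<in>B. om x0 u0 * R u0 y0 else 0)"
    by (cases "a = c \<and> b = d") (auto simp: sum_delta_delta x(3,4) y(3,4) intro!: sum.neutral)
  finally show "(\<Sum>u\<in>mat_basis N B. mat_form N om x u * mat_inverse R u y) = (if x = y then 1 else 0)"
    using x y by (simp add: right)
  have "(\<Sum>u\<in>mat_basis N B. mat_inverse L x u * mat_form N om u y) =
      (\<Sum>u0\<in>B. \<Sum>i<N. \<Sum>j<N. if i = b \<and> j = a then (if a = c \<and> b = d then L x0 u0 * om u0 y0 else 0) else 0)"
    unfolding sum_mat_basis[OF fin]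
    by (intro sum.cong refl) (use x y in \<open>auto simp: mat_form_def unit_trace_pair mat_inverse_def\<close>)
  also have "\<dots> = (if a = c \<and> b = d then \<Sum>u0\<in>B. L x0 u0 * om u0 y0 else 0)"
    by (cases "a = c \<and> b = d") (auto simp: sum_delta_delta x(3,4) y(3,4) intro!: sum.neutral)
  finally show "(\<Sum>u\<in>mat_basis N B. mat_inverse L x u * mat_form N om u y) = (if x = y then 1 else 0)"
    using x y by (simp add: left)
  show "mat_form N om x y \<noteq> 0 \<Longrightarrow> p (fst x) \<noteq> p (fst y)"
    using x y odd by (auto simp: mat_form_def)
qed

lemma (in invertible_form) inv_form_mat:
  "inv_form (mat_basis N B) (\<lambda>y. p (fst y)) (mat_form N om) = mat_eta N (inv_form B p om)"
  unfolding invertible_form.inv_form_eq[OF invertible_mat] inv_form_eq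
  by (auto simp: fun_eq_iff mat_basis_def mat_inverse_def mat_eta_def)

lemma shift_mat_consts:
  "shift_consts (\<lambda>y. par (fst y)) (mat_consts N B mu) w y =
    (if w \<in> lists (mat_basis N B) \<and> y \<in> mat_basis N B
     then shift_consts par mu (map fst w) (fst y) * unit_prod (map snd w) (fst (snd y)) (snd (snd y)) else 0)"
proof -
  have "(\<Sum>i<length w. if par (fst (w ! i)) then length w - 1 - i else 0) =
      (\<Sum>i<length (map fst w). if par (map fst w ! i) then length (map fst w) - 1 - i else 0)"
    by (rule sum.cong) auto
  then show ?thesis by (simp add: shift_consts_def mat_consts_def)
qed

lemma eval_sgn_map_fst: "eval_sgn (\<lambda>y. p (fst y)) v = eval_sgn p (map fst v)"
  by (simp add: eval_sgn_def filter_map o_def)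

text \<open>The sum over the matrix unit linking the structure map to the last argument collapses to
  one term, which closes the product of matrix units to a trace.\<close>

lemma mat_form_tensor:
  assumes "finite B"
  shows "form_tensor (mat_basis N B) (\<lambda>y. p (fst y)) (shift_consts (\<lambda>y. par (fst y)) (mat_consts N B mu)) (mat_form N om) v =
    (if v \<in> lists (mat_basis N B) then form_tensor B p (shift_consts par mu) om (map fst v) * unit_trace N (map snd v) else 0)"
proof (cases "v \<in> lists (mat_basis N B) \<and> 2 \<le> length v")
  case True
  then obtain a x where v: "v = a @ [x]" by (cases v rule: rev_cases) auto
  obtain x0 k l where x: "x = (x0, k, l)" by (cases x)
  have kl: "k < N" "l < N" "x0 \<in> B" and a: "a \<in> lists (mat_basis N B)" using True by (auto simp: v x mat_basis_def)
  have fst: "map fst v \<in> lists B" using True by (fastforce simp: mat_basis_def)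
  let ?b = "shift_consts par mu"
  have "(\<Sum>y\<in>mat_basis N B. shift_consts (\<lambda>y. par (fst y)) (mat_consts N B mu) a y * mat_form N om y x) =
      (\<Sum>y0\<in>B. \<Sum>i<N. \<Sum>j<N. if i = l \<and> j = k then ?b (map fst a) y0 * om y0 x0 * unit_prod (map snd a) l k else 0)"
    unfolding sum_mat_basis[OF assms]
    by (intro sum.cong refl) (use a kl in \<open>auto simp: shift_mat_consts mat_basis_def mat_form_def unit_trace_pair x\<close>)
  also have "\<dots> = (\<Sum>y0\<in>B. ?b (map fst a) y0 * om y0 x0) * unit_trace N (map snd v)"
    using kl by (simp add: sum_delta_delta v x unit_trace_snoc sum_distrib_right)
  finally show ?thesis using True fst
    by (simp add: form_tensor_def eval_sgn_map_fst v x)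
qed (auto simp: form_tensor_def)

text \<open>Parity and support conditions are inherited from the tensor factor A; cyclic invariance
  combines that of the tensor for A with that of the trace.\<close>

lemma (in cyclic_tensor) cyclic_tensor_mat:
  assumes b: "b = shift_consts par mu" and inv: "invertible_form B p om R L" and eta: "eta = inv_form B p om"
  shows "cyclic_tensor (\<lambda>y. p (fst y)) (mat_eta N eta) (mat_basis N B) (mat_form N om)
    (shift_consts (\<lambda>y. par (fst y)) (mat_consts N B mu))"
proof -
  interpret mat: finite_odd_form "\<lambda>y. p (fst y)" "mat_eta N eta" "mat_basis N B" by (rule finite_odd_form_mat)
  let ?b = "shift_consts (\<lambda>y. par (fst y)) (mat_consts N B mu)"
  note mat_b = shift_mat_consts[of par N B mu, folded b]
  show ?thesis
  proof
    fix a z assume nz: "?b a z \<noteq> 0"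
    then have *: "set a \<subseteq> mat_basis N B" "z \<in> mat_basis N B" "b (map fst a) (fst z) \<noteq> 0"
      by (auto simp: mat_b split: if_splits)
    then show "a \<noteq> [] \<and> set a \<subseteq> mat_basis N B \<and> z \<in> mat_basis N B" using b_support by fastforce
    show "p (fst z) \<noteq> wpar (\<lambda>y. p (fst y)) a" using b_odd[OF *(3)] by (simp add: wpar_fst)
  next
    fix x :: "'a \<times> nat \<times> nat" and w
    let ?t = "form_tensor (mat_basis N B) (\<lambda>y. p (fst y)) ?b (mat_form N om)"
    note t = mat_form_tensor[OF finite_B, of N p par mu om, folded b]
    obtain x0 k l where x: "x = (x0, k, l)" by (cases x)
    have "x \<in> mat_basis N B \<Longrightarrow> k < N \<and> l < N" by (auto simp: x mat_basis_def)
    then show "?t (x # w) = msgn (p (fst x) \<and> wpar (\<lambda>y. p (fst y)) w) * ?t (w @ [x])"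
      using cyclic_letter[of x0 "map fst w"]
      by (auto simp: t x wpar_fst unit_trace_snoc unit_trace_Cons mult.assoc)
  qed (use invertible_form.odd[OF invertible_form.invertible_mat[OF inv]]
      invertible_form.form_inv_form[OF invertible_form.invertible_mat[OF inv]]
      invertible_form.inv_form_mat[OF inv] eta in \<open>auto\<close>)
qed

lemma cat_one:
  fixes f :: "'x list \<Rightarrow> 'k::field_char_0"
  shows "cat f (mon 1 []) = f"
  by (rule pairing_eqI) (simp only: pairing_cat[OF finsupp_mon] pairing_mon append_Nil2 mult_1)

lemma LQT_single:
  fixes f :: "'x list \<Rightarrow> 'k::field_char_0"
  shows "LQT_map N (single f) v = (if snd ` set v \<subseteq> {..<N} \<times> {..<N} then f (map fst v) * unit_trace N (map snd v) else 0)"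
proof -
  have "LQT_map N (single f) v = (\<Sum>W\<in>{[map fst v]}. single f W * catprod (map (M_word N) W) v)"
    unfolding LQT_map_def ext1_def
  proof (rule Sum_any.expand_superset)
    show "{W. single f W * catprod (map (M_word N) W) v \<noteq> 0} \<subseteq> {[map fst v]}"
    proof clarify
      fix W :: "'x list list" assume nz: "single f W * catprod (map (M_word N) W) v \<noteq> 0"
      then obtain w where w: "W = [w]" by (auto simp: single_def split: list.splits)
      from nz have "catprod (map (M_word N) W) v \<noteq> (0 :: 'k)" by auto
      from M_words_support[OF this] show "W = [map fst v]" by (simp add: w)
    qed
  qed simp
  then show ?thesis by (auto simp: single_def catprod_def cat_one M_word_def)
qed

text \<open>Word by word, passing to matrices multiplies the tensor by the trace and keeps the
  length, hence the factor 1/(k+1); the equality holds for representatives.\<close>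

lemma LQT_m_tilde:
  assumes "finite B"
  shows "LQT_map N (single (m_tilde B p (shift_consts par mu) om)) =
    m_tilde (mat_basis N B) (\<lambda>y. p (fst y)) (shift_consts (\<lambda>y. par (fst y)) (mat_consts N B mu)) (mat_form N om)"
proof
  fix v :: "('a \<times> nat \<times> nat) list"
  have "v \<in> lists (mat_basis N B) \<longleftrightarrow> map fst v \<in> lists B \<and> snd ` set v \<subseteq> {..<N} \<times> {..<N}"
    by (auto simp: mat_basis_def mem_Times_iff in_lists_conv_set image_subset_iff)
  moreover have "form_tensor B p (shift_consts par mu) om (map fst v) = 0" if "map fst v \<notin> lists B"
    using that by (simp only: form_tensor_def simp_thms if_False)
  ultimately show "LQT_map N (single (m_tilde B p (shift_consts par mu) om)) v =
    m_tilde (mat_basis N B) (\<lambda>y. p (fst y)) (shift_consts (\<lambda>y. par (fst y)) (mat_consts N B mu)) (mat_form N om) v"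
    unfolding LQT_single m_tilde_def mat_form_tensor[OF assms] length_map
    by (cases "v \<in> lists (mat_basis N B)"; cases "map fst v \<in> lists B"; simp only: simp_thms if_True if_False)
      (simp_all)
qed

section \<open>Shift signs and cyclicity for the A-infinity algebra\<close>

section \<open>The cyclic tensor of a cyclic A-infinity algebra\<close>

lemma minus_one_power: "(- 1) ^ n = (msgn (odd n) :: 'k::comm_ring_1)"
  by (simp add: msgn_def)

definition shift_exponent :: "('x \<Rightarrow> bool) \<Rightarrow> 'x list \<Rightarrow> nat" where
  "shift_exponent par w = (\<Sum>i<length w. if par (w ! i) then length w - 1 - i else 0)"

lemma shift_consts_eq: "shift_consts par mu w x = msgn (odd (shift_exponent par w)) * mu w x"
  by (simp add: shift_consts_def shift_exponent_def minus_one_power)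

lemma shift_exponent_Nil: "shift_exponent par [] = 0"
  by (simp add: shift_exponent_def)

lemma shift_exponent_Cons: "shift_exponent par (x # w) = (if par x then length w else 0) + shift_exponent par w"
  unfolding shift_exponent_def length_Cons sum.lessThan_Suc_shift by (simp cong: if_cong)

text \<open>Appending a letter raises the weight of every earlier odd letter by one, and the new
  letter has weight 0.\<close>

lemma shift_exponent_snoc: "odd (shift_exponent par (w @ [x])) \<longleftrightarrow> (odd (shift_exponent par w) \<noteq> wpar par w)"
  by (induction w) (auto simp: shift_exponent_Cons shift_exponent_Nil)

lemma wpar_not: "wpar (\<lambda>x. \<not> q x) w \<longleftrightarrow> odd (length w) \<noteq> wpar q w"
  by (induction w) auto

context cyclic_ainf_algebra
begin

abbreviation "par \<equiv> \<lambda>a. a \<in> A1"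
abbreviation "sp \<equiv> \<lambda>a. a \<notin> A1"
abbreviation "mu \<equiv> struct_consts scale B m"
abbreviation "sb \<equiv> shift_consts par mu"
abbreviation "som \<equiv> shift_form par ip"

lemma basis_parity: "x \<in> B \<Longrightarrow> x \<in> A0 \<longleftrightarrow> x \<notin> A1"
proof -
  assume x: "x \<in> B"
  then have "x \<noteq> 0" using independent_basis dependent_zero by blast
  then show ?thesis using x homogeneous_basis even_odd_disjoint by blast
qed

text \<open>The part of v on basis elements outside S lies in T, and also in S as the difference of
  v and its other part. So it is 0, and independence applies.\<close>

lemma representation_homogeneous:
  assumes S: "subspace S" and T: "subspace T" and disj: "S \<inter> T = {0}" and B: "B \<subseteq> S \<union> T"
    and v: "v \<in> S" and x: "x \<in> B" "x \<notin> S"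
  shows "representation B v x = 0"
proof -
  let ?r = "representation B v"
  have "v = (\<Sum>y\<in>B. scale (?r y) y)"
    using sum_representation_eq[of B v B] independent_basis span_basis finite_basis by simp
  also have "\<dots> = (\<Sum>y\<in>B \<inter> S. scale (?r y) y) + (\<Sum>y\<in>B - S. scale (?r y) y)"
    using finite_basis by (subst sum.union_disjoint[symmetric]) (auto intro: arg_cong2[where f = sum])
  finally have e: "v = (\<Sum>y\<in>B \<inter> S. scale (?r y) y) + (\<Sum>y\<in>B - S. scale (?r y) y)" .
  have eq: "(\<Sum>y\<in>B - S. scale (?r y) y) = v - (\<Sum>y\<in>B \<inter> S. scale (?r y) y)"
    by (subst eq_diff_eq, subst add.commute, rule e[symmetric])
  have "(\<Sum>y\<in>B - S. scale (?r y) y) \<in> S"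
    unfolding eq by (intro subspace_diff[OF S] v subspace_sum[OF S] subspace_scale[OF S]) auto
  moreover have "(\<Sum>y\<in>B - S. scale (?r y) y) \<in> T"
    by (intro subspace_sum[OF T] subspace_scale[OF T]) (use B in auto)
  ultimately have "(\<Sum>y\<in>B - S. scale (?r y) y) = 0" using disj by blast
  then show ?thesis
    using independentD[OF independent_basis, of "B - S" ?r x] finite_basis x by auto
qed

lemma struct_consts_parity:
  assumes "mu w x \<noteq> 0"
  shows "x \<in> A1 \<longleftrightarrow> odd (length w) \<noteq> wpar par w"
proof -
  from assms have w: "w \<noteq> []" "w \<in> lists B" "x \<in> B" and rep: "representation B (m w) x \<noteq> 0"
    by (auto simp: struct_consts_def split: if_splits)
  have "set w \<subseteq> A0 \<union> A1" using w(2) homogeneous_basis by auto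
  note mw = m_parity[OF w(1) this]
  show ?thesis
  proof (cases "odd (length w) \<noteq> wpar par w")
    case True
    then have "m w \<in> A1" using mw by (simp only: if_True simp_thms)
    then have "x \<in> A1"
      using representation_homogeneous[OF subspace_odd subspace_even, of "m w" x] even_odd_disjoint homogeneous_basis w rep
      by blast
    then show ?thesis using True by simp
  next
    case False
    then have "m w \<in> A0" using mw by (simp only: if_False simp_thms)
    then have "x \<in> A0"
      using representation_homogeneous[OF subspace_even subspace_odd, of "m w" x] even_odd_disjoint homogeneous_basis w rep
      by blast
    then show ?thesis using False basis_parity w by simp
  qed
qed

lemma ip_sum_left: "ip (\<Sum>x\<in>S. scale (r x) x) z = (\<Sum>x\<in>S. r x * ip x z)"
proof -
  interpret l: Vector_Spaces.linear scale "(*)" "\<lambda>a. ip a z" by (rule ip_linear_left)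
  show ?thesis by (simp add: l.sum l.scale)
qed

lemma ip_sum_right: "ip z (\<Sum>x\<in>S. scale (r x) x) = (\<Sum>x\<in>S. r x * ip z x)"
proof -
  interpret l: Vector_Spaces.linear scale "(*)" "ip z" by (rule ip_linear_right)
  show ?thesis by (simp add: l.sum l.scale)
qed

lemma basis_expansion: "(\<Sum>x\<in>B. scale (representation B v x) x) = v"
  using sum_representation_eq[of B v B] independent_basis span_basis finite_basis by simp

lemma ip_m: "w \<noteq> [] \<Longrightarrow> w \<in> lists B \<Longrightarrow> ip (m w) z = (\<Sum>x\<in>B. mu w x * ip x z)"
  using ip_sum_left[of "representation B (m w)" B z] by (simp add: basis_expansion struct_consts_def)

text \<open>The sign in graded symmetry occurs only for two odd elements, where the odd form
  vanishes.\<close>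

lemma ip_basis_symmetric: "x \<in> B \<Longrightarrow> y \<in> B \<Longrightarrow> ip x y = ip y x"
proof -
  assume *: "x \<in> B" "y \<in> B"
  then have "ip x y = msgn (x \<in> A1 \<and> y \<in> A1) * ip y x" using ip_symmetric homogeneous_basis by blast
  then show ?thesis using ip_odd[of y x] by (cases "x \<in> A1 \<and> y \<in> A1") auto
qed

text \<open>The map \<open>T\<close> records the pairings of a vector with the basis. Nondegeneracy
  makes it injective, hence surjective in finite dimension; the preimages of the basis elements form
  the dual basis, and \<open>D\<close> holds their coordinates.\<close>

lemma dual_basis: "\<exists>D. \<forall>y\<in>B. \<forall>z\<in>B. (\<Sum>x\<in>B. D y x * ip x z) = (if y = z then 1 else 0)"
proof -
  define T where "T a = (\<Sum>y\<in>B. scale (ip a y) y)" for a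
  have coeff: "f y = g y" if "(\<Sum>y\<in>B. scale (f y) y) = (\<Sum>y\<in>B. scale (g y) y)" "y \<in> B" for f g y
  proof -
    have "(\<Sum>y\<in>B. scale (f y - g y) y) = 0"
      using that(1) by (simp add: scale_left_diff_distrib sum_subtractf)
    then have "f y - g y = 0"
      using independentD[OF independent_basis finite_basis order_refl, of "\<lambda>y. f y - g y" y] that(2) by simp
    then show ?thesis by simp
  qed
  have ip_add: "ip (a + c) y = ip a y + ip c y" and ip_scale: "ip (scale k a) y = k * ip a y"
    and ip_diff: "ip (a - c) y = ip a y - ip c y" for a c y k
  proof -
    interpret l: Vector_Spaces.linear scale "(*)" "\<lambda>a. ip a y" by (rule ip_linear_left)
    show "ip (a + c) y = ip a y + ip c y" "ip (scale k a) y = k * ip a y" "ip (a - c) y = ip a y - ip c y"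
      by (simp_all add: l.add l.scale l.diff)
  qed
  interpret fd: finite_dimensional_vector_space scale B
    by unfold_locales (use finite_basis independent_basis span_basis in auto)
  have "Vector_Spaces.linear scale scale T"
    unfolding module_hom_iff_linear[symmetric] module_hom_def module_hom_axioms_def
    using module_axioms
    by (simp add: T_def ip_add ip_scale scale_left_distrib sum.distrib scale_sum_right)
  moreover have "inj T"
  proof (rule injI)
    fix a c assume "T a = T c"
    then have "ip a y = ip c y" if "y \<in> B" for y using coeff[of "ip a" "ip c" y] that by (simp add: T_def)
    then have "ip (a - c) z = 0" for z
      using ip_sum_right[of "a - c" "representation B z" B] by (simp add: basis_expansion ip_diff)
    then show "a = c" using ip_nondegenerate[of "a - c"] by simp
  qed
  ultimately have "surj T" by (rule fd.linear_inj_imp_surj)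
  then have "\<exists>d. T d = y" for y by (metis surj_def)
  then obtain d where d: "\<And>y. T (d y) = y" by metis
  have "(\<Sum>x\<in>B. representation B (d y) x * ip x z) = (if y = z then 1 else 0)" if "y \<in> B" "z \<in> B" for y z
  proof -
    have "(\<Sum>x\<in>B. representation B (d y) x * ip x z) = ip (d y) z"
      using ip_sum_left[of "representation B (d y)" B z] by (simp add: basis_expansion)
    moreover have "(\<Sum>x\<in>B. scale (if x = y then 1 else 0) x) = y"
    proof -
      have "(\<Sum>x\<in>B. scale (if x = y then 1 else 0) x) = (\<Sum>x\<in>B. if x = y then x else 0)"
        by (rule sum.cong) auto
      then show ?thesis using that finite_basis by simp
    qed
    then have "ip (d y) z = (if z = y then 1 else 0)"
      using coeff[of "ip (d y)" "\<lambda>x. if x = y then 1 else 0" z] d[of y] that by (simp add: T_def)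
    ultimately show ?thesis by auto
  qed
  then show ?thesis by (intro exI[of _ "\<lambda>y. representation B (d y)"] ballI)
qed

lemma invertible_shift_form: "\<exists>R L. invertible_form B sp som R L"
proof -
  from dual_basis obtain D where
    D: "\<And>y z. y \<in> B \<Longrightarrow> z \<in> B \<Longrightarrow> (\<Sum>x\<in>B. D y x * ip x z) = (if y = z then 1 else 0)" by blast
  \<comment> \<open>The factors \<open>msgn\<close> undo the sign in \<open>shift_form\<close>. The
    left inverse comes directly from the dual basis, the right one from its transpose, by symmetry
    of the form on the basis.\<close>
  have "invertible_form B sp som (\<lambda>x y. msgn (par y) * D y x) (\<lambda>y x. D y x * msgn (par x))"
  proof
    fix x y assume xy: "x \<in> B" "y \<in> B"
    have "(\<Sum>u\<in>B. som x u * (msgn (par y) * D y u)) = msgn (par x) * msgn (par y) * (\<Sum>u\<in>B. D y u * ip u x)"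
      unfolding sum_distrib_left
      by (rule sum.cong) (use xy ip_basis_symmetric in \<open>simp_all add: shift_form_def mult_ac\<close>)
    then show "(\<Sum>u\<in>B. som x u * (msgn (par y) * D y u)) = (if x = y then 1 else 0)"
      using xy by (auto simp: D msgn_def)
    have "(\<Sum>u\<in>B. D x u * msgn (par u) * som u y) = (\<Sum>u\<in>B. D x u * ip u y)"
      by (rule sum.cong) (auto simp: shift_form_def msgn_def)
    then show "(\<Sum>u\<in>B. D x u * msgn (par u) * som u y) = (if x = y then 1 else 0)"
      using xy by (simp add: D)
    assume "som x y \<noteq> 0"
    then have "ip x y \<noteq> 0" by (auto simp: shift_form_def)
    then show "sp x \<noteq> sp y" using ip_odd[of x y] basis_parity[OF xy(1)] basis_parity[OF xy(2)] by blast
  qed (rule finite_basis)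
  then show ?thesis by blast
qed

text \<open>The sign in the shifted form depends on the output x, but the parity of the structure
  maps fixes it on all nonzero terms, so it leaves the sum.\<close>

lemma tensor_eq_ip:
  assumes "u \<noteq> []" "u \<in> lists B" "z \<in> B"
  shows "form_tensor B sp sb som (u @ [z]) = eval_sgn sp (u @ [z]) *
    msgn (odd (shift_exponent par u) \<noteq> (odd (length u) \<noteq> wpar par u)) * ip (m u) z"
proof -
  let ?s = "odd (shift_exponent par u)"
  have "sb u x * som x z = msgn (?s \<noteq> (odd (length u) \<noteq> wpar par u)) * (mu u x * ip x z)" for x
  proof (cases "mu u x = 0")
    case False
    have "sb u x * som x z = msgn ?s * msgn (par x) * (mu u x * ip x z)"
      by (simp add: shift_consts_eq shift_form_def mult_ac)
    also have "par x = (odd (length u) \<noteq> wpar par u)" by (rule struct_consts_parity[OF False])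
    finally show ?thesis unfolding msgn_mult .
  qed (simp add: shift_consts_def)
  then have "(\<Sum>x\<in>B. sb u x * som x z) = msgn (?s \<noteq> (odd (length u) \<noteq> wpar par u)) * ip (m u) z"
    by (simp only: ip_m[OF assms(1,2)] sum_distrib_left)
  moreover have "2 \<le> length (u @ [z])" using assms(1) by (cases u) auto
  ultimately show ?thesis using assms by (simp add: form_tensor_def mult.assoc)
qed

text \<open>This is the axiom \<open>m_cyclic\<close> with all signs expressed through five
  parities; \<open>eval_sgn\<close> is common to both sides, as it depends only on the multiset of
  letters.\<close>

lemma tensor_cyclic:
  "form_tensor B sp sb som (x # w) = msgn (sp x \<and> wpar sp w) * form_tensor B sp sb som (w @ [x])"
proof (cases "w = [] \<or> x \<notin> B \<or> w \<notin> lists B")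
  case True
  then show ?thesis by (auto simp: form_tensor_def)
next
  case False
  then obtain v z where w: "w = v @ [z]" by (cases w rule: rev_cases) auto
  have B: "x \<in> B" "z \<in> B" "v \<in> lists B" using False by (auto simp: w)
  let ?s = "odd (shift_exponent par v)"
  have s1: "odd (shift_exponent par (x # v)) = ((par x \<and> odd (length v)) \<noteq> ?s)"
    unfolding shift_exponent_Cons by auto
  have t1: "form_tensor B sp sb som (x # w) = eval_sgn sp (x # v @ [z]) *
      msgn (((par x \<and> odd (length v)) \<noteq> ?s) \<noteq> (odd (length (x # v)) \<noteq> wpar par (x # v))) * ip (m (x # v)) z"
    using tensor_eq_ip[of "x # v" z] B unfolding s1 w by simp
  have t2: "form_tensor B sp sb som (w @ [x]) = eval_sgn sp (x # v @ [z]) *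
      msgn ((?s \<noteq> wpar par v) \<noteq> (odd (length w) \<noteq> wpar par w)) * ip (m w) x"
  proof -
    have "eval_sgn sp (w @ [x]) = (eval_sgn sp (x # v @ [z]) :: 'k)" by (rule eval_sgn_mset) (simp add: w)
    then show ?thesis using tensor_eq_ip[of w x] False shift_exponent_snoc[of par v z] by (simp add: w)
  qed
  have "set w \<subseteq> A0 \<union> A1" "x \<in> A0 \<union> A1" using False homogeneous_basis by auto
  then have "ip (m w) x = (- 1) ^ length w * msgn (par x \<and> wpar par w) * ip (m (x # butlast w)) (last w)"
    using False by (intro m_cyclic) auto
  then have c: "ip (m w) x = msgn (odd (length w)) * msgn (par x \<and> wpar par w) * ip (m (x # v)) z"
    unfolding minus_one_power by (simp add: w)
  have sp: "wpar sp w = (odd (length w) \<noteq> wpar par w)" by (rule wpar_not)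
  show ?thesis
    unfolding t1 t2 c sp unfolding w
    by (cases "par x"; cases "par z"; cases "wpar par v"; cases "odd (length v)"; cases ?s; simp add: msgn_def)
qed

lemma cyclic_tensor_shift: "cyclic_tensor sp (inv_form B sp som) B som sb"
proof -
  from invertible_shift_form obtain R L where "invertible_form B sp som R L" by blast
  then interpret invertible_form B sp som R L .
  interpret finite_odd_form sp "inv_form B sp som" B by (rule finite_odd_form_inv)
  show ?thesis
  proof
    fix a z assume nz: "sb a z \<noteq> 0"
    then have mu: "mu a z \<noteq> 0" by (auto simp: shift_consts_def)
    then show "a \<noteq> [] \<and> set a \<subseteq> B \<and> z \<in> B" by (auto simp: struct_consts_def split: if_splits)
    show "sp z \<noteq> wpar sp a" using struct_consts_parity[OF mu] by (simp add: wpar_not)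
  qed (use odd form_inv_form tensor_cyclic in auto)
qed

end

section \<open>Coefficients of the powers of \<hbar>\<close>

section \<open>Adjoining \<open>\<hbar>\<close>\<close>

lemma sym_eq_refl:
  fixes f :: "'x list \<Rightarrow> 'k::field_char_0"
  shows "sym_eq p f f"
  by (rule sym_eqI) simp

lemma sym_eq_trans:
  fixes f :: "'x list \<Rightarrow> 'k::field_char_0"
  shows "sym_eq p f g \<Longrightarrow> sym_eq p g h \<Longrightarrow> sym_eq p f h"
  by (rule sym_eqI) (simp add: sym_eqD)

lemma sym_eq_sum:
  fixes f :: "'i \<Rightarrow> 'x list \<Rightarrow> 'k::field_char_0"
  shows "(\<And>i. i \<in> I \<Longrightarrow> sym_eq p (f i) (g i)) \<Longrightarrow> sym_eq p (\<Sum>i\<in>I. f i) (\<Sum>i\<in>I. g i)"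
  by (rule sym_eqI) (auto simp: pairing_sum intro!: sum.cong sym_eqD)

lemma bounded_words_sum: "(\<And>i. i \<in> I \<Longrightarrow> bounded_words K (f i)) \<Longrightarrow> bounded_words K (\<Sum>i\<in>I. f i)"
  unfolding bounded_words_def sum_apply by (metis sum.neutral)

text \<open>The common bound K lets one truncated functional test all summands at once.\<close>

lemma LQT_sum:
  fixes f :: "'i \<Rightarrow> 'x list list \<Rightarrow> 'k::field_char_0"
  assumes "\<And>i. i \<in> I \<Longrightarrow> bounded_words K (f i)"
  shows "LQT_map N (\<Sum>i\<in>I. f i) = (\<Sum>i\<in>I. LQT_map N (f i))"
proof (rule pairing_eqI)
  fix v :: "('x \<times> nat \<times> nat) list"
  have "pairing (LQT_map N (\<Sum>i\<in>I. f i)) (mon 1 v) = (\<Sum>i\<in>I. pairing (f i) (loopss_upto K N (mon 1 v)))"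
    by (simp only: pairing_LQT_upto[OF bounded_words_sum[OF assms] finsupp_mon] pairing_sum finsupp_loopss_upto finsupp_mon)
  also have "\<dots> = (\<Sum>i\<in>I. pairing (LQT_map N (f i)) (mon 1 v))"
    by (rule sum.cong[OF refl], rule pairing_LQT_upto[symmetric, OF assms finsupp_mon])
  finally show "pairing (LQT_map N (\<Sum>i\<in>I. f i)) (mon 1 v) = pairing (\<Sum>i\<in>I. LQT_map N (f i)) (mon 1 v)"
    by (simp only: pairing_sum finsupp_mon)
qed

lemma LQT_zero: "LQT_map N 0 = 0"
  by (simp add: LQT_map_def ext1_def fun_eq_iff)

lemma sigma_M_hbar: "bounded_words K (F n) \<Longrightarrow> sigma_hbar (M_hbar N F) n = LQT_map N (F n)"
  unfolding sigma_hbar_def M_hbar_def hlin_def by (rule sigma_M_eq_LQT)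

context finite_odd_form
begin

text \<open>Each coefficient of the bracket is a finite sum of brackets of coefficients; a bound on
  the number of words uniform in the power of \<hbar> lets the map be applied termwise.\<close>

lemma LQT_hbar_bracket:
  assumes F: "\<And>n. bounded_words K (F n)" and G: "\<And>n. bounded_words L (G n)"
  shows "P_eq (\<lambda>y. p (fst y)) (sigma_hbar (M_hbar N (Pnc_bracket p eta F G)))
    (P_bracket (\<lambda>y. p (fst y)) (mat_eta N eta) (sigma_hbar (M_hbar N F)) (sigma_hbar (M_hbar N G)))"
  unfolding P_eq_def
proof
  fix n
  have b: "bounded_words (K + L) (ext2 (nc_bracket p eta) (F i) (G j))" for i j
    by (rule bounded_nc_bracket[OF F G])
  have B: "Pnc_bracket p eta F G n = (\<Sum>i\<le>n. ext2 (nc_bracket p eta) (F i) (G (n - i)))"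
    by (simp add: Pnc_bracket_def hbil_def)
  have "bounded_words (K + L) (Pnc_bracket p eta F G n)" unfolding B by (rule bounded_words_sum[OF b])
  then have "sigma_hbar (M_hbar N (Pnc_bracket p eta F G)) n =
      (\<Sum>i\<le>n. LQT_map N (ext2 (nc_bracket p eta) (F i) (G (n - i))))"
    by (simp only: sigma_M_hbar) (simp only: B LQT_sum[OF b])
  moreover have "P_bracket (\<lambda>y. p (fst y)) (mat_eta N eta) (sigma_hbar (M_hbar N F)) (sigma_hbar (M_hbar N G)) n =
      (\<Sum>i\<le>n. ext2 (sym_bracket (\<lambda>y. p (fst y)) (mat_eta N eta)) (LQT_map N (F i)) (LQT_map N (G (n - i))))"
    by (simp add: P_bracket_def hbil_def sigma_M_hbar[OF F] sigma_M_hbar[OF G])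
  ultimately show "sym_eq (\<lambda>y. p (fst y)) (sigma_hbar (M_hbar N (Pnc_bracket p eta F G)) n)
    (P_bracket (\<lambda>y. p (fst y)) (mat_eta N eta) (sigma_hbar (M_hbar N F)) (sigma_hbar (M_hbar N G)) n)"
    using sym_eq_sum[OF LQT_bracket[OF F G]] by simp
qed

lemma LQT_hbar_differential:
  assumes F: "\<And>n. bounded_words K (F n)"
  shows "P_eq (\<lambda>y. p (fst y)) (sigma_hbar (M_hbar N (Pnc_diff p eta F)))
    (P_diff (\<lambda>y. p (fst y)) (mat_eta N eta) (sigma_hbar (M_hbar N F)))"
  unfolding P_eq_def
proof
  fix n
  show "sym_eq (\<lambda>y. p (fst y)) (sigma_hbar (M_hbar N (Pnc_diff p eta F)) n)
    (P_diff (\<lambda>y. p (fst y)) (mat_eta N eta) (sigma_hbar (M_hbar N F)) n)"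
  proof (cases n)
    \<comment> \<open>Multiplication by \<hbar> leaves no constant term on either side.\<close>
    case 0
    have "Pnc_diff p eta F 0 = 0" "bounded_words 0 (Pnc_diff p eta F 0)"
      by (simp_all add: Pnc_diff_def hmult_def bounded_words_def)
    then have "sigma_hbar (M_hbar N (Pnc_diff p eta F)) 0 = 0" by (simp add: sigma_M_hbar LQT_zero)
    then show ?thesis using 0 by (simp add: P_diff_def hmult_def sym_eq_refl)
  next
    case (Suc k)
    have D: "Pnc_diff p eta F n = ext1 (nc_delta p eta) (F k) + ext1 (nc_nabla p eta) (F k)"
      by (simp add: Suc Pnc_diff_def hmult_def hlin_def)
    then have "sigma_hbar (M_hbar N (Pnc_diff p eta F)) n = LQT_map N (ext1 (nc_delta p eta) (F k) + ext1 (nc_nabla p eta) (F k))"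
      using sigma_M_hbar[of "Suc K" "Pnc_diff p eta F" n N] bounded_nc_diff[OF F[of k]] by simp
    moreover have "P_diff (\<lambda>y. p (fst y)) (mat_eta N eta) (sigma_hbar (M_hbar N F)) n =
        ext1 (BV_laplacian (\<lambda>y. p (fst y)) (mat_eta N eta)) (LQT_map N (F k))"
      by (simp add: Suc P_diff_def hmult_def hlin_def sigma_M_hbar[OF F])
    ultimately show ?thesis using LQT_differential[OF F] by simp
  qed
qed

end

text \<open>The direct sum over the number of words enters here, as one bound for all powers of
  \<hbar>.\<close>

lemma Pnc_carrier_bounded:
  fixes F :: "nat \<Rightarrow> 'x list list \<Rightarrow> 'k::field_char_0"
  assumes "F \<in> Pnc_carrier B" shows "\<exists>K. \<forall>n. bounded_words K (F n)"
proof -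
  from assms obtain K where K: "\<And>n W. n > K \<or> length W > K \<Longrightarrow> F n W = 0"
    unfolding Pnc_carrier_def by blast
  have "bounded_words K (F n)" for n
    unfolding bounded_words_def using K[of n] not_le by blast
  then show ?thesis by blast
qed

section \<open>Transfer from the shifted algebra to the shifted matrix Lie algebra\<close>

theorem theorem4p11:
  fixes scale :: "'k::field_char_0 \<Rightarrow> 'a::ab_group_add \<Rightarrow> 'a"
    and A0 A1 B :: "'a set"
    and m :: "'a list \<Rightarrow> 'a"
    and ip :: "'a \<Rightarrow> 'a \<Rightarrow> 'k"
    and N :: nat
  assumes A: "cyclic_ainf_algebra scale A0 A1 B m ip"
    and N: "1 \<le> N"
  shows "let
      \<comment> \<open>data on \<open>\<Sigma>A\<close>\<close>
      par = (\<lambda>a. a \<in> A1);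
      p = (\<lambda>a. a \<notin> A1);
      mu = struct_consts scale B m;
      b = shift_consts par mu;
      om = shift_form par ip;
      eta = inv_form B p om;
      mt = m_tilde B p b om;
      \<comment> \<open>data on \<open>\<Sigma>gl\<^sub>N(A)\<close>\<close>
      BN = mat_basis N B;
      parN = (\<lambda>y. par (fst y));
      pN = (\<lambda>y. p (fst y));
      bN = shift_consts parN (mat_consts N B mu);
      omN = shift_form parN (mat_form N ip);
      etaN = inv_form BN pN omN;
      lt = l_tilde BN pN bN omN;
      \<Phi> = (\<lambda>F. sigma_hbar (M_hbar N F))
    in
      \<comment> \<open>a well-defined map into the invariants\<close>
      (\<forall>F \<in> Pnc_carrier B. \<Phi> F \<in> P_carrier BN \<and>
         (\<forall>X. P_eq pN (hlin (gl_act N pN X) (\<Phi> F)) 0)) \<and>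
      (\<forall>F \<in> Pnc_carrier B. \<forall>G \<in> Pnc_carrier B. Pnc_eq p F G \<longrightarrow> P_eq pN (\<Phi> F) (\<Phi> G)) \<and>
      \<comment> \<open>Lie brackets\<close>
      (\<forall>F \<in> Pnc_carrier B. \<forall>G \<in> Pnc_carrier B.
         P_eq pN (\<Phi> (Pnc_bracket p eta F G)) (P_bracket pN etaN (\<Phi> F) (\<Phi> G))) \<and>
      \<comment> \<open>differentials\<close>
      (\<forall>F \<in> Pnc_carrier B.
         P_eq pN (\<Phi> (Pnc_diff p eta F)) (P_diff pN etaN (\<Phi> F))) \<and>
      (\<forall>F \<in> Pnc_carrier B.
         P_eq pN (\<Phi> (Pnc_bracket p eta (hconst (single mt)) F))
           (P_bracket pN etaN (hconst lt) (\<Phi> F))) \<and>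
      \<comment> \<open>modulo \<open>\<hbar>\<close> and \<open>\<nu>\<close>: the Loday-Quillen-Tsygan map and its complexes\<close>
      (\<forall>F \<in> Pnc_carrier B. F 0 \<in> SCC_carrier B \<longrightarrow> sym_eq pN (\<Phi> F 0) (LQT_map N (F 0))) \<and>
      (\<forall>f \<in> SCC_carrier B. nc_eq p (ext2 (nc_bracket p eta) (single mt) f) (SCC_diff p b f)) \<and>
      (\<forall>g \<in> CE_carrier BN. sym_eq pN (ext2 (sym_bracket pN etaN) lt g) (CE_diff pN bN g))"
proof -
  interpret A: cyclic_ainf_algebra scale A0 A1 B m ip by (rule A)
  from A.invertible_shift_form obtain R L where inv: "invertible_form B A.sp A.som R L" by blast
  define p where "p = A.sp"
  define pN :: "'a \<times> nat \<times> nat \<Rightarrow> bool" where "pN = (\<lambda>y. p (fst y))"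
  define eta where "eta = inv_form B p A.som"
  define mt where "mt = m_tilde B p A.sb A.som"
  define bN where "bN = shift_consts (\<lambda>y. fst y \<in> A1) (mat_consts N B A.mu)"
  define BN where "BN = mat_basis N B"
  define omN where "omN = mat_form N A.som"
  define mtN where "mtN = m_tilde BN pN bN omN"
  define lt where "lt = l_tilde BN pN bN omN"
  let ?\<Phi> = "\<lambda>F. sigma_hbar (M_hbar N F) :: nat \<Rightarrow> ('a \<times> nat \<times> nat) list \<Rightarrow> 'k"
  have omN: "shift_form (\<lambda>y. fst y \<in> A1) (mat_form N ip) = omN"
    unfolding omN_def by (rule shift_mat_form)
  have etaN: "inv_form BN pN omN = mat_eta N eta"
    unfolding BN_def pN_def p_def omN_def eta_def by (rule invertible_form.inv_form_mat[OF inv])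
  \<comment> \<open>Two instances of the Hamiltonian argument are set up, one for the cyclic words
    over the algebra and one for the symmetric words over its matrices.\<close>
  interpret T: cyclic_tensor p eta B A.som A.sb
    unfolding p_def eta_def by (rule A.cyclic_tensor_shift)
  interpret TN: cyclic_tensor pN "mat_eta N eta" BN omN bN
    unfolding pN_def BN_def omN_def bN_def
    by (rule T.cyclic_tensor_mat[OF refl inv[folded p_def] eta_def])
  have LQT_mt: "LQT_map N (single mt) = mtN"
    unfolding mt_def mtN_def BN_def pN_def bN_def omN_def by (rule LQT_m_tilde[OF A.finite_basis])
  have lt_mtN: "sym_eq pN lt mtN"
    unfolding lt_def mtN_def by (rule TN.sym_eq_l_tilde)
  have bounded_mt: "bounded_words 1 (hconst (single mt) n)" for n
    by (auto simp: bounded_words_def hconst_def single_def split: list.splits)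
  have "(\<forall>F \<in> Pnc_carrier B. ?\<Phi> F \<in> P_carrier BN \<and>
         (\<forall>X. P_eq pN (hlin (gl_act N pN X) (?\<Phi> F)) 0)) \<and>
      (\<forall>F \<in> Pnc_carrier B. \<forall>G \<in> Pnc_carrier B. Pnc_eq p F G \<longrightarrow> P_eq pN (?\<Phi> F) (?\<Phi> G)) \<and>
      (\<forall>F \<in> Pnc_carrier B. \<forall>G \<in> Pnc_carrier B.
         P_eq pN (?\<Phi> (Pnc_bracket p eta F G)) (P_bracket pN (mat_eta N eta) (?\<Phi> F) (?\<Phi> G))) \<and>
      (\<forall>F \<in> Pnc_carrier B.
         P_eq pN (?\<Phi> (Pnc_diff p eta F)) (P_diff pN (mat_eta N eta) (?\<Phi> F))) \<and>
      (\<forall>F \<in> Pnc_carrier B.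
         P_eq pN (?\<Phi> (Pnc_bracket p eta (hconst (single mt)) F))
           (P_bracket pN (mat_eta N eta) (hconst lt) (?\<Phi> F))) \<and>
      (\<forall>F \<in> Pnc_carrier B. F 0 \<in> SCC_carrier B \<longrightarrow> sym_eq pN (?\<Phi> F 0) (LQT_map N (F 0))) \<and>
      (\<forall>f \<in> SCC_carrier B. nc_eq p (ext2 (nc_bracket p eta) (single mt) f) (SCC_diff p A.sb f)) \<and>
      (\<forall>g \<in> CE_carrier BN. sym_eq pN (ext2 (sym_bracket pN (mat_eta N eta)) lt g) (CE_diff pN bN g))"
  proof (intro conjI ballI allI impI)
    fix F :: "nat \<Rightarrow> 'a list list \<Rightarrow> 'k" assume F: "F \<in> Pnc_carrier B"
    then obtain K where K: "\<And>n. bounded_words K (F n)" using Pnc_carrier_bounded by blast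
    have \<Phi>: "?\<Phi> F n = LQT_map N (F n)" for n by (rule sigma_M_hbar[OF K])
    show "?\<Phi> F \<in> P_carrier BN"
      unfolding P_carrier_def mem_Collect_eq \<Phi> BN_def
      by (intro allI LQT_carrier) (use F in \<open>auto simp: Pnc_carrier_def\<close>)
    show "P_eq pN (hlin (gl_act N pN X) (?\<Phi> F)) 0" for X
      by (simp add: P_eq_def hlin_def \<Phi> LQT_gl_invariant[OF K] sym_eq_refl flip: zero_fun_def)
    show "P_eq pN (?\<Phi> (Pnc_diff p eta F)) (P_diff pN (mat_eta N eta) (?\<Phi> F))"
      unfolding pN_def by (rule T.LQT_hbar_differential[OF K])
    show "sym_eq pN (?\<Phi> F 0) (LQT_map N (F 0))"
      unfolding \<Phi> by (rule sym_eq_refl)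
    show "P_eq pN (?\<Phi> (Pnc_bracket p eta (hconst (single mt)) F)) (P_bracket pN (mat_eta N eta) (hconst lt) (?\<Phi> F))"
      unfolding P_eq_def
    proof
      fix n
      have "P_eq pN (?\<Phi> (Pnc_bracket p eta (hconst (single mt)) F))
          (P_bracket pN (mat_eta N eta) (?\<Phi> (hconst (single mt))) (?\<Phi> F))"
        unfolding pN_def by (rule T.LQT_hbar_bracket) (rule bounded_mt, rule K)
      then have "sym_eq pN (?\<Phi> (Pnc_bracket p eta (hconst (single mt)) F) n)
          (P_bracket pN (mat_eta N eta) (?\<Phi> (hconst (single mt))) (?\<Phi> F) n)"
        unfolding P_eq_def by blast
      \<comment> \<open>The image of \<open>mt\<close> is exactly its matrix version
        \<open>mtN\<close>, which is identified with \<open>lt\<close> modulo symmetric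
        coinvariants; well-definedness of the bracket then lets \<open>lt\<close> take its
        place.\<close>
      moreover have "sym_eq pN (hconst lt i) (?\<Phi> (hconst (single mt)) i)" for i
      proof -
        have "?\<Phi> (hconst (single mt)) i = LQT_map N (hconst (single mt) i)"
          by (rule sigma_M_hbar[OF bounded_mt])
        then show ?thesis using lt_mtN by (simp add: hconst_def LQT_mt LQT_zero sym_eq_refl)
      qed
      then have "sym_eq pN (P_bracket pN (mat_eta N eta) (hconst lt) (?\<Phi> F) n)
          (P_bracket pN (mat_eta N eta) (?\<Phi> (hconst (single mt))) (?\<Phi> F) n)"
        unfolding P_bracket_def hbil_def by (intro sym_eq_sum TN.sym_bracket_well_defined)
      ultimately show "sym_eq pN (?\<Phi> (Pnc_bracket p eta (hconst (single mt)) F) n)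
          (P_bracket pN (mat_eta N eta) (hconst lt) (?\<Phi> F) n)"
        by (intro sym_eqI) (simp add: sym_eqD)
    qed
    fix G :: "nat \<Rightarrow> 'a list list \<Rightarrow> 'k" assume G: "G \<in> Pnc_carrier B"
    then obtain L where L: "\<And>n. bounded_words L (G n)" using Pnc_carrier_bounded by blast
    show "P_eq pN (?\<Phi> F) (?\<Phi> G)" if "Pnc_eq p F G"
      using that unfolding P_eq_def Pnc_eq_def sigma_M_hbar[OF K] sigma_M_hbar[OF L] pN_def
      by (intro allI LQT_well_defined[OF K L]) blast
    show "P_eq pN (?\<Phi> (Pnc_bracket p eta F G)) (P_bracket pN (mat_eta N eta) (?\<Phi> F) (?\<Phi> G))"
      unfolding pN_def by (rule T.LQT_hbar_bracket[OF K L])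
  next
    fix f :: "'a list list \<Rightarrow> 'k" assume "f \<in> SCC_carrier B"
    then show "nc_eq p (ext2 (nc_bracket p eta) (single mt) f) (SCC_diff p A.sb f)"
      unfolding mt_def by (intro T.nc_bracket_m_tilde) (auto simp: SCC_carrier_def)
  next
    fix g :: "('a \<times> nat \<times> nat) list \<Rightarrow> 'k"
    show "sym_eq pN (ext2 (sym_bracket pN (mat_eta N eta)) lt g) (CE_diff pN bN g)"
      using TN.sym_bracket_well_defined[OF lt_mtN] TN.sym_bracket_m_tilde[folded mtN_def]
      by (rule sym_eq_trans)
  qed
  then show ?thesis
    unfolding Let_def omN etaN[unfolded BN_def pN_def eta_def p_def] eta_def mt_def lt_def bN_def BN_def pN_def p_def .
qed

end
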